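(* Consider a hidden Markov model of order $K^*$ as in the context, such that $(X_j)_{j\ge1}$ is a stationary ergodic Markov chain with parameters $(\pi^*,\mathbf Q^* )$, $\mathbf Q^*$ is invertible and $(f_1^*,\dots,f^*_{K^*})$ is linearly independent. Let $M_0$ be such that $\mathbf N_M$ has rank $K^*$ for all $M\in\mathcal M$ with $M\ge M_0$ (such an $M_0$ exists), and let $M\in\mathcal M$ with $M\ge M_0$. Let $$\hat K_{\mathrm{sp.}}(C)=\#\Big\{i\ :\ \sigma_i(\hat{\mathbf N}_M)>C\sqrt{\log(n)/n}\Big\}.$$ Then there exist $C_0$, depending only on $(\mathbf Q^*,\Phi_M)$, and $n_0$, depending only on $(\mathbf Q^*,\Phi_M,\mathbf O_M)$, such that for all $C\ge C_0$ and all $n\ge n_0C^2(1+\log C)$, $$\mathbb P\big(\hat K_{\mathrm{sp.}}(C)\ne K^*\big)\le n^{-2},$$ so that $\hat K_{\mathrm{sp.}}(C)\to K^*$ almost surely.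
   Context: Model. $(\mathcal Y,\mu)$ is a measured space with $\mu$ $\sigma$-finite. $(X_j)_{j\ge1}$ is a Markov chain on $\{1,\dots,K^*\}$ with transition matrix $\mathbf Q^*$ and initial distribution $\pi^*$. Conditionally on $(X_j)_j$ the $\mathcal Y$-valued variables $(Y_j)_{j\ge1}$ are independent, and $Y_j$ given $X_j=k$ has density $f_k^*\in\mathbf L^2(\mathcal Y,\mu)$ with respect to $\mu$. $(\mathfrak P_M)_{M\in\mathcal M}$, $\mathcal M\subset\mathbb N$, is a nested sequence of subspaces of $\mathbf L^2(\mathcal Y,\mu)$ with $\dim\mathfrak P_M=M$ and union dense in $\mathbf L^2(\mathcal Y,\mu)$. For $M\in\mathcal M$, $\Phi_M=(\varphi_1,\dots,\varphi_M)$ (dependence of $\varphi_a$ on $M$ omitted) is an orthonormal basis of $\mathfrak P_M$. Define the $M\times M$ matrices $$\mathbf N_M(a,b)=\mathbb E[\varphi_a(Y_1)\varphi_b(Y_2)],\qquad \hat{\mathbf N}_M(a,b)=\frac1n\sum_{s=1}^n\varphi_a(Y_s)\varphi_b(Y_{s+1}),$$ and the $M\times K^*$ matrix $\mathbf O_M(m,k)=\int\varphi_mf_k^*\,d\mu$. $\sigma_1(B)\ge\sigma_2(B)\ge\cdots$ denote the singular values of a matrix $B$.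
   Formalization: For the probability bound and almost sure convergence the functions of Φ_M are assumed essentially bounded; without this the claim fails (e.g. iid uniform Y, φ_2 = c(y^{-0.4}−m)). The constants are stated for sample spaces on one arbitrary underlying set; pushing forward removes this. *)

theory Defs
  imports
    "HOL-Probability.Probability"
    "Jordan_Normal_Form.Char_Poly"
    "Jordan_Normal_Form.DL_Rank"
begin

text \<open>
  Indexing: hidden states, basis functions and matrix rows/columns are numbered from 0
  (states \<open>{..<K}\<close>, basis functions \<open>\<phi> a\<close> with \<open>a < M\<close>). Time starts at 1; the values of
  the processes at time 0 are never used. Singular values are numbered from 1.
\<close>

subsection \<open>The space of square integrable functions\<close>

text \<open>
  Elements are functions rather than classes modulo a.e. equality. A subspace is a set
  of functions closed under a.e. equality, and identities between elements hold a.e.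
\<close>

definition L2 :: "'y measure \<Rightarrow> ('y \<Rightarrow> real) set" where
  "L2 \<mu> = {g \<in> borel_measurable \<mu>. integrable \<mu> (\<lambda>y. (g y)\<^sup>2)}"

definition L2_subspace :: "'y measure \<Rightarrow> ('y \<Rightarrow> real) set \<Rightarrow> bool" where
  "L2_subspace \<mu> S \<longleftrightarrow>
     S \<subseteq> L2 \<mu> \<and> (\<lambda>y. 0) \<in> S \<and>
     (\<forall>g\<in>S. \<forall>h\<in>S. (\<lambda>y. g y + h y) \<in> S) \<and>
     (\<forall>c. \<forall>g\<in>S. (\<lambda>y. c * g y) \<in> S) \<and>
     (\<forall>g\<in>S. \<forall>h\<in>borel_measurable \<mu>. (AE y in \<mu>. g y = h y) \<longrightarrow> h \<in> S)"

text \<open>A subspace that has an orthonormal basis with \<open>M\<close> elements has dimension \<open>M\<close>.\<close>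

definition L2_orthonormal_basis ::
  "'y measure \<Rightarrow> nat \<Rightarrow> (nat \<Rightarrow> 'y \<Rightarrow> real) \<Rightarrow> ('y \<Rightarrow> real) set \<Rightarrow> bool" where
  "L2_orthonormal_basis \<mu> M \<phi> S \<longleftrightarrow>
     (\<forall>a<M. \<phi> a \<in> S) \<and>
     (\<forall>a<M. \<forall>b<M. (\<integral>y. \<phi> a y * \<phi> b y \<partial>\<mu>) = (if a = b then 1 else 0)) \<and>
     (\<forall>g\<in>S. \<exists>c. AE y in \<mu>. g y = (\<Sum>a<M. c a * \<phi> a y))"

definition L2_lin_indep :: "'y measure \<Rightarrow> nat \<Rightarrow> (nat \<Rightarrow> 'y \<Rightarrow> real) \<Rightarrow> bool" where
  "L2_lin_indep \<mu> K f \<longleftrightarrow>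
     (\<forall>c. (AE y in \<mu>. (\<Sum>k<K. c k * f k y) = 0) \<longrightarrow> (\<forall>k<K. c k = 0))"

definition approximation_spaces ::
  "'y measure \<Rightarrow> nat set \<Rightarrow> (nat \<Rightarrow> ('y \<Rightarrow> real) set) \<Rightarrow> (nat \<Rightarrow> nat \<Rightarrow> 'y \<Rightarrow> real) \<Rightarrow> bool"
where
  "approximation_spaces \<mu> \<M> \<PP> \<Phi> \<longleftrightarrow>
     (\<forall>M\<in>\<M>. L2_subspace \<mu> (\<PP> M) \<and> L2_orthonormal_basis \<mu> M (\<Phi> M) (\<PP> M)) \<and>
     (\<forall>M\<in>\<M>. \<forall>M'\<in>\<M>. M \<le> M' \<longrightarrow> \<PP> M \<subseteq> \<PP> M') \<and>
     (\<forall>g\<in>L2 \<mu>. \<forall>\<epsilon>>0. \<exists>h\<in>(\<Union>M\<in>\<M>. \<PP> M). sqrt (\<integral>y. (g y - h y)\<^sup>2 \<partial>\<mu>) < \<epsilon>)"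

subsection \<open>Hidden Markov models\<close>

definition stochastic_matrix :: "nat \<Rightarrow> real mat \<Rightarrow> bool" where
  "stochastic_matrix K Q \<longleftrightarrow>
     Q \<in> carrier_mat K K \<and> (\<forall>i<K. \<forall>j<K. 0 \<le> Q $$ (i, j)) \<and>
     (\<forall>i<K. (\<Sum>j<K. Q $$ (i, j)) = 1)"

definition markov_chain ::
  "'w measure \<Rightarrow> (nat \<Rightarrow> 'w \<Rightarrow> nat) \<Rightarrow> nat \<Rightarrow> real vec \<Rightarrow> real mat \<Rightarrow> bool" where
  "markov_chain P X K \<pi> Q \<longleftrightarrow>
     stochastic_matrix K Q \<and> \<pi> \<in> carrier_vec K \<and>
     (\<forall>j\<ge>1. X j \<in> measurable P (count_space {..<K})) \<and>
     (\<forall>k<K. \<P>(\<omega> in P. X 1 \<omega> = k) = \<pi> $ k) \<and>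
     (\<forall>n\<ge>1. \<forall>x. \<forall>k<K. \<P>(\<omega> in P. \<forall>j\<in>{1..n}. X j \<omega> = x j) \<noteq> 0 \<longrightarrow>
        \<P>(\<omega> in P. X (Suc n) \<omega> = k \<bar> \<forall>j\<in>{1..n}. X j \<omega> = x j) = Q $$ (x n, k))"

definition stationary_distribution :: "real vec \<Rightarrow> real mat \<Rightarrow> bool" where
  "stationary_distribution \<pi> Q \<longleftrightarrow> transpose_mat Q *\<^sub>v \<pi> = \<pi>"

text \<open>
  On a finite state space an ergodic transition matrix is an irreducible one;
  aperiodicity is not required.
\<close>

definition ergodic_matrix :: "nat \<Rightarrow> real mat \<Rightarrow> bool" where
  "ergodic_matrix K Q \<longleftrightarrow> (\<forall>i<K. \<forall>j<K. \<exists>n. (Q ^\<^sub>m n) $$ (i, j) > 0)"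

definition sigma_of_process :: "'w measure \<Rightarrow> (nat \<Rightarrow> 'w \<Rightarrow> nat) \<Rightarrow> 'w measure" where
  "sigma_of_process P X = sigma (space P) {X j -` {k} \<inter> space P | j k. 1 \<le> j}"

text \<open>
  The last condition says that, conditionally on the whole sequence \<open>X\<close>, the
  variables \<open>Y 1, \<dots>, Y n\<close> are independent and \<open>Y j\<close> has density \<open>f (X j)\<close>.
\<close>

definition hidden_markov_model ::
  "'y measure \<Rightarrow> 'w measure \<Rightarrow> (nat \<Rightarrow> 'w \<Rightarrow> nat) \<Rightarrow> (nat \<Rightarrow> 'w \<Rightarrow> 'y) \<Rightarrow>
   nat \<Rightarrow> real vec \<Rightarrow> real mat \<Rightarrow> (nat \<Rightarrow> 'y \<Rightarrow> real) \<Rightarrow> bool" where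
  "hidden_markov_model \<mu> P X Y K \<pi> Q f \<longleftrightarrow>
     prob_space P \<and> markov_chain P X K \<pi> Q \<and>
     (\<forall>k<K. f k \<in> L2 \<mu> \<and> (AE y in \<mu>. 0 \<le> f k y) \<and> prob_space (density \<mu> (\<lambda>y. ennreal (f k y)))) \<and>
     (\<forall>j\<ge>1. Y j \<in> measurable P \<mu>) \<and>
     (\<forall>n A. (\<forall>j\<in>{1..n}. A j \<in> sets \<mu>) \<longrightarrow>
        (AE \<omega> in P.
           real_cond_exp P (sigma_of_process P X) (\<lambda>\<omega>. \<Prod>j\<in>{1..n}. indicator (A j) (Y j \<omega>)) \<omega> =
           (\<Prod>j\<in>{1..n}. measure (density \<mu> (\<lambda>y. ennreal (f (X j \<omega>) y))) (A j))))"

definition N_mat :: "'w measure \<Rightarrow> (nat \<Rightarrow> 'w \<Rightarrow> 'y) \<Rightarrow> nat \<Rightarrow> (nat \<Rightarrow> 'y \<Rightarrow> real) \<Rightarrow> real mat" where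
  "N_mat P Y M \<phi> = mat M M (\<lambda>(a, b). \<integral>\<omega>. \<phi> a (Y 1 \<omega>) * \<phi> b (Y 2 \<omega>) \<partial>P)"

definition N_hat :: "(nat \<Rightarrow> 'w \<Rightarrow> 'y) \<Rightarrow> nat \<Rightarrow> (nat \<Rightarrow> 'y \<Rightarrow> real) \<Rightarrow> nat \<Rightarrow> 'w \<Rightarrow> real mat" where
  "N_hat Y M \<phi> n \<omega> =
     mat M M (\<lambda>(a, b). (1 / real n) * (\<Sum>s=1..n. \<phi> a (Y s \<omega>) * \<phi> b (Y (s + 1) \<omega>)))"

definition O_mat ::
  "'y measure \<Rightarrow> nat \<Rightarrow> (nat \<Rightarrow> 'y \<Rightarrow> real) \<Rightarrow> nat \<Rightarrow> (nat \<Rightarrow> 'y \<Rightarrow> real) \<Rightarrow> real mat" where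
  "O_mat \<mu> M \<phi> K f = mat M K (\<lambda>(m, k). \<integral>y. \<phi> m y * f k y \<partial>\<mu>)"

subsection \<open>Singular values and the spectral order estimator\<close>

text \<open>
  Square roots of the eigenvalues of \<open>transpose B * B\<close>, with algebraic multiplicity and in
  decreasing order; only the first \<open>min (dim_row B) (dim_col B)\<close> are kept, the others vanish.
\<close>

definition singular_values :: "real mat \<Rightarrow> real list" where
  "singular_values B =
     take (min (dim_row B) (dim_col B))
       (rev (sorted_list_of_multiset
          (image_mset sqrt (proots (char_poly (transpose_mat B * B))))))"

definition singular_value :: "real mat \<Rightarrow> nat \<Rightarrow> real" where
  "singular_value B i = singular_values B ! (i - 1)"

definition K_spectral ::
  "(nat \<Rightarrow> 'w \<Rightarrow> 'y) \<Rightarrow> nat \<Rightarrow> (nat \<Rightarrow> 'y \<Rightarrow> real) \<Rightarrow> real \<Rightarrow> nat \<Rightarrow> 'w \<Rightarrow> nat" where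
  "K_spectral Y M \<phi> C n \<omega> =
     card {i \<in> {1..M}. singular_value (N_hat Y M \<phi> n \<omega>) i > C * sqrt (ln (real n) / real n)}"

end

theory Submission
  imports Defs "Jordan_Normal_Form.Spectral_Radius" "HOL-Real_Asymp.Real_Asymp"
begin

text \<open>
  Let \<open>N\<close> and \<open>N'\<close> be the matrices of the joint moments of two consecutive observations and of
  their empirical means. The estimator counts the singular values of \<open>N'\<close> above
  \<open>t = C * sqrt (ln n / n)\<close>. Two facts make this count equal to \<open>K\<close> with high probability: \<open>N\<close> has
  exactly \<open>K\<close> nonzero singular values, and all entries of \<open>N'\<close> are within \<open>t / M\<close> of those of \<open>N\<close>.

  The second fact bounds the operator norm of \<open>N' - N\<close> by \<open>t\<close>. By Weyl's inequality, in the counting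
  form \<open>count_singular_values_above_perturbation\<close>, at most \<open>rank N\<close> singular values of \<open>N'\<close> then exceed
  \<open>t\<close>, and at least as many as those of \<open>N\<close> that exceed \<open>2 * t\<close>. As soon as \<open>2 * t\<close> is below the
  smallest positive singular value of \<open>N\<close>, both bounds are \<open>rank N = K\<close>. That smallest value depends on
  \<open>Q\<close> and \<open>Omat\<close> only, because \<open>N = Omat * diag \<pi> * Q * transpose Omat\<close> (\<open>N_mat_factorization\<close>) and
  because an irreducible \<open>Q\<close> has only one stationary distribution \<open>\<pi>\<close>; this is why \<open>n0\<close> can be chosen
  before the model.

  The same factorization gives the rank: \<open>\<pi>\<close> is positive and \<open>Q\<close> is invertible, so \<open>N\<close> has rank \<open>K\<close>
  as soon as \<open>Omat\<close> is injective. This holds for large \<open>M\<close>: the Gram matrix of the densities is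
  invertible, by continuity of the determinant so is the matrix of their inner products with good
  enough approximations from the spaces \<open>\<PP> M\<close>, and a kernel vector of \<open>Omat\<close> lies in the kernel of
  the latter.

  The closeness of the entries is a concentration inequality for the sum of the
  \<open>u (Y s) * v (Y (s + 1))\<close> (\<open>concentration_consecutive_products\<close>). Given the hidden path, the terms
  with odd \<open>s\<close> are independent, and so are those with even \<open>s\<close>, so that Hoeffding's inequality applies
  to each half. The conditional mean given the path is a sum of a function of two
  consecutive hidden states. The Poisson equation \<open>h - Q h = v\<close> turns it, up to a bounded
  boundary term, into a sum of martingale differences of the hidden chain, and Azuma's inequality
  applies. The equation is solved with a matrix that depends on \<open>Q\<close> only and exists without
  aperiodicity, so the constants depend on \<open>Q\<close> and on the bounds on the basis functions only. Since
  the tail at \<open>n * t / M\<close> is a power of \<open>1 / n\<close> whose exponent grows with \<open>C\<close>, a large \<open>C0\<close> gives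
  \<open>1 / n\<^sup>2\<close>, and the Borel-Cantelli lemma gives the almost sure convergence.
\<close>

text \<open>The symbols \<open>\<bullet>\<close> and \<open>$\<close> belong to the vectors whose dimension is a term.\<close>

unbundle no inner_syntax
no_notation vec_nth (infixl "$" 90)

section \<open>Orthogonal diagonalization of symmetric real matrices\<close>

text \<open>
  Fewer than \<open>n\<close> linear equations in \<open>n\<close> unknowns: padding with zero rows gives a square matrix with
  determinant zero. All dimension counts below rest on this.
\<close>

lemma underdetermined_system:
  fixes rs :: "real Matrix.vec list"
  assumes rs: "set rs \<subseteq> carrier_vec n" and len: "length rs < n"
  shows "\<exists>v\<in>carrier_vec n. v \<noteq> 0\<^sub>v n \<and> (\<forall>r\<in>set rs. r \<bullet> v = 0)"
proof -
  define ps where "ps = rs @ replicate (n - length rs) (0\<^sub>v n)"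
  have ps: "length ps = n" "set ps \<subseteq> carrier_vec n"
    using rs len by (auto simp: ps_def)
  define B where "B = mat_of_rows n ps"
  have B: "B \<in> carrier_mat n n" using ps by (auto simp: B_def)
  have row_B: "Matrix.row B i = ps ! i" if "i < n" for i
    using ps that unfolding B_def by (intro mat_of_rows_row) auto
  have "transpose_mat B *\<^sub>v unit_vec n (n - 1) = 0\<^sub>v n"
  proof -
    have "transpose_mat B *\<^sub>v unit_vec n (n - 1) = Matrix.row B (n - 1)"
      using B len by (intro eq_vecI) auto
    also have "\<dots> = 0\<^sub>v n"
    proof -
      have "ps ! (n - 1) = 0\<^sub>v n" using len by (auto simp: ps_def nth_append)
      then show ?thesis using len row_B[of "n - 1"] by simp
    qed
    finally show ?thesis .
  qed
  then have "Determinant.det (transpose_mat B) = 0"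
    using B len by (subst det_0_iff_vec_prod_zero_field[of _ n]) (auto intro!: exI[of _ "unit_vec n (n - 1)"])
  then have "Determinant.det B = 0" using B by (simp add: Determinant.det_transpose)
  then obtain v where v: "v \<in> carrier_vec n" "v \<noteq> 0\<^sub>v n" "B *\<^sub>v v = 0\<^sub>v n"
    using det_0_iff_vec_prod_zero_field[OF B] by auto
  have "r \<bullet> v = 0" if "r \<in> set rs" for r
  proof -
    from that obtain i where i: "i < length rs" "r = rs ! i" by (auto simp: in_set_conv_nth)
    have "(B *\<^sub>v v) $ i = r \<bullet> v"
      using i len B row_B by (simp add: ps_def nth_append)
    with v(3) i len show ?thesis by simp
  qed
  with v show ?thesis by blast
qed

text \<open>
  A complex eigenvector \<open>x + \<i> y\<close> exists; symmetry makes its eigenvalue real, so that \<open>x\<close> and \<open>y\<close>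
  satisfy the eigenvector equation over the reals and one of them is not zero.
\<close>

lemma symmetric_real_eigenvector:
  fixes A :: "real mat"
  assumes A: "A \<in> carrier_mat n n" and sym: "transpose_mat A = A" and n: "0 < n"
  shows "\<exists>e. \<exists>v\<in>carrier_vec n. v \<noteq> 0\<^sub>v n \<and> A *\<^sub>v v = e \<cdot>\<^sub>v v"
proof -
  define C where "C = map_mat complex_of_real A"
  have C: "C \<in> carrier_mat n n" using A by (simp add: C_def)
  obtain l where "l \<in> spectrum C" using spectrum_non_empty[OF C n] by auto
  then obtain w where w: "w \<in> carrier_vec n" "w \<noteq> 0\<^sub>v n" "C *\<^sub>v w = l \<cdot>\<^sub>v w"
    using C by (auto simp: spectrum_def eigenvalue_def eigenvector_def)
  define x where "x = (\<lambda>i. Re (w $ i))"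
  define y where "y = (\<lambda>i. Im (w $ i))"
  define a where "a = (\<lambda>i j. A $$ (i, j))"
  have a_sym: "a i j = a j i" if "i < n" "j < n" for i j
  proof -
    have "transpose_mat A $$ (j, i) = A $$ (i, j)" using A that by simp
    then show ?thesis by (simp add: sym a_def)
  qed
  have row: "(\<Sum>j<n. complex_of_real (a i j) * (w $ j)) = l * w $ i" if "i < n" for i
  proof -
    have "(C *\<^sub>v w) $ i = (\<Sum>j<n. complex_of_real (a i j) * (w $ j))"
      using that w(1) A by (auto simp: C_def scalar_prod_def a_def atLeast0LessThan intro!: sum.cong)
    then show ?thesis using w that by simp
  qed
  have re: "(\<Sum>j<n. a i j * x j) = Re l * x i - Im l * y i" if "i < n" for i
    using arg_cong[OF row[OF that], of Re] by (simp add: x_def y_def)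
  have im: "(\<Sum>j<n. a i j * y j) = Re l * y i + Im l * x i" if "i < n" for i
    using arg_cong[OF row[OF that], of Im] by (simp add: x_def y_def algebra_simps)
  \<comment> \<open>Symmetry gives \<open>y \<bullet> A x = x \<bullet> A y\<close>; inserting \<open>re\<close> and \<open>im\<close>, only \<open>Im l * (|x|\<^sup>2 + |y|\<^sup>2) = 0\<close> remains.\<close>
  have "(\<Sum>i<n. y i * (\<Sum>j<n. a i j * x j)) = (\<Sum>i<n. x i * (\<Sum>j<n. a i j * y j))"
    unfolding sum_distrib_left
    by (subst sum.swap, intro sum.cong refl) (simp add: a_sym mult_ac)
  then have "(\<Sum>i<n. y i * (Re l * x i - Im l * y i)) = (\<Sum>i<n. x i * (Re l * y i + Im l * x i))"
    using re im by simp
  then have "Im l * (\<Sum>i<n. (x i)\<^sup>2 + (y i)\<^sup>2) = 0"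
    by (simp add: sum_distrib_left algebra_simps power2_eq_square sum.distrib sum_subtractf)
  moreover have "(\<Sum>i<n. (x i)\<^sup>2 + (y i)\<^sup>2) \<noteq> 0"
  proof
    assume "(\<Sum>i<n. (x i)\<^sup>2 + (y i)\<^sup>2) = 0"
    then have "\<forall>i<n. (x i)\<^sup>2 + (y i)\<^sup>2 = 0"
      by (subst (asm) sum_nonneg_eq_0_iff) auto
    then have "\<forall>i<n. w $ i = 0"
      by (auto simp: x_def y_def complex_eq_iff sum_power2_eq_zero_iff)
    then have "w = 0\<^sub>v n" using w by (intro eq_vecI) auto
    with w show False by simp
  qed
  ultimately have im0: "Im l = 0" by simp
  have ev: "A *\<^sub>v Matrix.vec n z = Re l \<cdot>\<^sub>v Matrix.vec n z"
    if z: "\<And>i. i < n \<Longrightarrow> (\<Sum>j<n. a i j * z j) = Re l * z i" for z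
    using A z by (intro eq_vecI)
      (auto simp: scalar_prod_def a_def atLeast0LessThan[symmetric])
  have "\<exists>i<n. x i \<noteq> 0 \<or> y i \<noteq> 0"
    by (rule ccontr) (use \<open>(\<Sum>i<n. (x i)\<^sup>2 + (y i)\<^sup>2) \<noteq> 0\<close> in auto)
  then obtain z i where z: "z = x \<or> z = y" "i < n" "z i \<noteq> 0" by auto
  have "Matrix.vec n z \<noteq> 0\<^sub>v n" using z by (metis index_vec index_zero_vec(1))
  moreover have "A *\<^sub>v Matrix.vec n z = Re l \<cdot>\<^sub>v Matrix.vec n z"
    using z re im im0 by (intro ev) auto
  ultimately show ?thesis by (intro exI[of _ "Re l"] bexI[of _ "Matrix.vec n z"]) auto
qed

text \<open>
  The reflection that exchanges the unit vectors \<open>u\<close> and \<open>unit_vec n 0\<close>. It completes \<open>u\<close> to an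
  orthonormal basis without the Gram-Schmidt process.
\<close>

lemma householder:
  fixes u :: "nat \<Rightarrow> real"
  assumes u: "(\<Sum>i<n. (u i)\<^sup>2) = 1" and n: "0 < n"
  shows "\<exists>H\<in>carrier_mat n n. transpose_mat H = H \<and> H * H = 1\<^sub>m n \<and> (\<forall>i<n. H $$ (i, 0) = u i)"
proof -
  define w where "w = (\<lambda>i. u i - (if i = 0 then 1 else 0))"
  define q where "q = (\<Sum>i<n. (w i)\<^sup>2)"
  define t where "t = 2 / q"
  \<comment> \<open>If \<open>u\<close> is already the first unit vector, then \<open>q = 0\<close> and \<open>t = 2 / 0 = 0\<close>, so that \<open>H\<close> is the identity.\<close>
  define H where "H = mat n n (\<lambda>(i, j). (if i = j then 1 else 0) - t * w i * w j)"
  have "q = (\<Sum>i<n. (u i)\<^sup>2) + (\<Sum>i<n. if i = 0 then 1 - 2 * u i else 0)"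
    unfolding q_def w_def sum.distrib[symmetric]
    by (intro sum.cong refl) (auto simp: power2_eq_square algebra_simps)
  also have "\<dots> = 2 - 2 * u 0" using u n by (simp add: sum.delta)
  finally have q: "q = 2 - 2 * u 0" .
  have tq: "t * t * q = 2 * t" by (cases "q = 0") (auto simp: t_def)
  have "(\<Sum>k<n. ((if i = k then 1 else 0) - t * w i * w k) * ((if k = j then 1 else 0) - t * w k * w j))
      = (if i = j then 1 else 0)" if "i < n" "j < n" for i j
  proof -
    have "(\<Sum>k<n. ((if i = k then 1 else 0) - t * w i * w k) * ((if k = j then 1 else 0) - t * w k * w j))
      = (\<Sum>k<n. (if i = k then (if k = j then 1 else 0) - t * w k * w j else 0)
           - (if k = j then t * w i * w k else 0) + (t * t * w i * w j) * (w k)\<^sup>2)"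
      by (intro sum.cong refl) (auto simp: power2_eq_square algebra_simps)
    also have "\<dots> = (if i = j then 1 else 0) - t * w i * w j - t * w i * w j + (t * t * w i * w j) * q"
      using that by (simp add: sum.distrib sum_subtractf q_def sum_distrib_left)
    also have "\<dots> = (if i = j then 1 else 0) - 2 * t * w i * w j + (t * t * q) * w i * w j"
      by (simp add: algebra_simps)
    finally show ?thesis by (simp add: tq)
  qed
  then have "H * H = 1\<^sub>m n"
    by (intro eq_matI) (auto simp: H_def scalar_prod_def atLeast0LessThan)
  moreover have "H $$ (i, 0) = u i" if "i < n" for i
  proof (cases "q = 0")
    case True
    then have "w i = 0" using that unfolding q_def
      by (subst (asm) sum_nonneg_eq_0_iff) auto
    with that n show ?thesis by (auto simp: H_def w_def split: if_splits)
  next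
    case False
    then have "t * w 0 = - 1" using q by (auto simp: t_def w_def field_simps)
    then have "t * w i * w 0 = - w i" by (metis mult.assoc mult.commute mult_minus1_right)
    with that n show ?thesis by (auto simp: H_def w_def)
  qed
  moreover have "transpose_mat H = H" by (intro eq_matI) (auto simp: H_def)
  ultimately show ?thesis by (intro bexI[of _ H]) (auto simp: H_def)
qed

text \<open>
  Conjugation with a reflection that moves a unit eigenvector to \<open>unit_vec n 0\<close> splits off a block of
  size one, since by symmetry the first row vanishes together with the first column. The induction
  hypothesis diagonalizes the remaining block.
\<close>

theorem spectral_theorem_symmetric_real:
  fixes A :: "real mat"
  assumes "A \<in> carrier_mat n n" and "transpose_mat A = A"
  shows "\<exists>U\<in>carrier_mat n n. \<exists>d. transpose_mat U * U = 1\<^sub>m n \<and> transpose_mat U * A * U = mat_diag n d"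
  using assms
proof (induction n arbitrary: A)
  case 0
  show ?case by (intro bexI[of _ "1\<^sub>m 0"] exI[of _ undefined]) (use 0 in \<open>auto intro!: eq_matI simp: mat_diag_def\<close>)
next
  case (Suc m A)
  let ?n = "Suc m"
  note A = Suc.prems(1) and sym = Suc.prems(2)
  obtain e v where v: "v \<in> carrier_vec ?n" "v \<noteq> 0\<^sub>v ?n" "A *\<^sub>v v = e \<cdot>\<^sub>v v"
    using symmetric_real_eigenvector[OF A sym] by auto
  define s where "s = (\<Sum>i<?n. (v $ i)\<^sup>2)"
  have "s \<noteq> 0"
  proof
    assume "s = 0"
    then have "\<forall>i<?n. (v $ i)\<^sup>2 = 0"
      unfolding s_def by (subst (asm) sum_nonneg_eq_0_iff) auto
    then have "v = 0\<^sub>v ?n" using v(1) by (intro eq_vecI) auto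
    with v show False by simp
  qed
  moreover have "s \<ge> 0" unfolding s_def by (intro sum_nonneg) auto
  ultimately have s: "s > 0" by simp
  define u where "u = (\<lambda>i. v $ i / sqrt s)"
  have "(\<Sum>i<?n. (u i)\<^sup>2) = 1"
  proof -
    have "(\<Sum>i<?n. (u i)\<^sup>2) = s / s"
      using s unfolding u_def power_divide by (simp add: s_def sum_divide_distrib[symmetric] del: sum.lessThan_Suc)
    then show ?thesis using s by simp
  qed
  then obtain H where H: "H \<in> carrier_mat ?n ?n" and Hs: "transpose_mat H = H"
    and HH: "H * H = 1\<^sub>m ?n" and Hu: "\<And>i. i < ?n \<Longrightarrow> H $$ (i, 0) = u i"
    using householder[of u ?n] by auto
  define A' where "A' = H * A * H"
  have A': "A' \<in> carrier_mat ?n ?n" using A H by (simp add: A'_def)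
  have A's: "transpose_mat A' = A'"
    using A H by (simp add: A'_def transpose_mult[of _ ?n ?n _ ?n] Hs sym assoc_mult_mat[of _ ?n ?n _ ?n _ ?n])
  have col0: "col A' 0 = e \<cdot>\<^sub>v unit_vec ?n 0"
  proof -
    let ?u = "col H 0"
    have "?u = (1 / sqrt s) \<cdot>\<^sub>v v" using H v(1) Hu by (intro eq_vecI) (auto simp: u_def)
    then have Au: "A *\<^sub>v ?u = e \<cdot>\<^sub>v ?u"
      using v A by (simp add: mult_mat_vec[of _ ?n ?n] smult_smult_assoc mult.commute)
    have u: "?u \<in> carrier_vec ?n" using col_dim[of H 0] H by simp
    have "A' = H * (A * H)" using A H by (simp add: A'_def assoc_mult_mat[of _ ?n ?n _ ?n _ ?n])
    then have "col A' 0 = H *\<^sub>v col (A * H) 0"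
      using A H by (simp only: col_mult2[of H ?n ?n "A * H" ?n] mult_carrier_mat zero_less_Suc)
    also have "col (A * H) 0 = A *\<^sub>v ?u"
      using A H by (simp only: col_mult2[of A ?n ?n H ?n] zero_less_Suc)
    finally have "col A' 0 = H *\<^sub>v (A *\<^sub>v ?u)" .
    also have "\<dots> = e \<cdot>\<^sub>v (H *\<^sub>v ?u)" using Au H u by (simp add: mult_mat_vec[of _ ?n ?n])
    also have "H *\<^sub>v ?u = col (H * H) 0" using H by (simp only: col_mult2[of H ?n ?n H ?n] zero_less_Suc)
    finally show ?thesis by (simp add: HH)
  qed
  have A'0: "A' $$ (i, 0) = (if i = 0 then e else 0)" if "i < ?n" for i
  proof -
    have "A' $$ (i, 0) = col A' 0 $ i" using that A' by simp
    then show ?thesis using that by (simp add: col0)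
  qed
  have A'0': "A' $$ (0, i) = (if i = 0 then e else 0)" if "i < ?n" for i
  proof -
    have "A' $$ (0, i) = transpose_mat A' $$ (i, 0)" using A' that by simp
    then show ?thesis using A'0[OF that] A's by simp
  qed
  define A3 where "A3 = mat m m (\<lambda>(i, j). A' $$ (Suc i, Suc j))"
  have A3: "A3 \<in> carrier_mat m m" by (simp add: A3_def)
  have A3s: "transpose_mat A3 = A3"
  proof (intro eq_matI)
    fix i j assume "i < dim_row A3" "j < dim_col A3"
    then have ij: "i < m" "j < m" by (auto simp: A3_def)
    have "A' $$ (Suc j, Suc i) = transpose_mat A' $$ (Suc i, Suc j)" using A' ij by simp
    then show "transpose_mat A3 $$ (i, j) = A3 $$ (i, j)" using ij A's by (simp add: A3_def)
  qed (auto simp: A3_def)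
  let ?E = "mat 1 1 (\<lambda>_. e)"
  have block: "A' = four_block_mat ?E (0\<^sub>m 1 m) (0\<^sub>m m 1) A3"
    using A' by (intro eq_matI) (auto simp: A3_def A'0 A'0' simp flip: One_nat_def)
  obtain U3 d3 where U3: "U3 \<in> carrier_mat m m" and U3U: "transpose_mat U3 * U3 = 1\<^sub>m m"
    and U3A: "transpose_mat U3 * A3 * U3 = mat_diag m d3"
    using Suc.IH[OF A3 A3s] by auto
  define V where "V = four_block_mat (1\<^sub>m 1) (0\<^sub>m 1 m) (0\<^sub>m m 1) U3"
  have V: "V \<in> carrier_mat ?n ?n"
    using U3 four_block_carrier_mat[of "1\<^sub>m 1" 1 1 U3 m m] by (simp add: V_def)
  have Vt: "transpose_mat V = four_block_mat (1\<^sub>m 1) (0\<^sub>m 1 m) (0\<^sub>m m 1) (transpose_mat U3)"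
    using U3 by (simp add: V_def transpose_four_block_mat[of _ 1 1 _ m _ m])
  have VV: "transpose_mat V * V = 1\<^sub>m ?n"
    unfolding Vt unfolding V_def using U3 U3U
    by (simp add: mult_four_block_mat[of _ 1 1 _ m _ m _ _ 1 _ m])
  have VA: "transpose_mat V * A' * V = mat_diag ?n (case_nat e d3)"
  proof -
    have "transpose_mat V * A' = four_block_mat ?E (0\<^sub>m 1 m) (0\<^sub>m m 1) (transpose_mat U3 * A3)"
      unfolding Vt block using U3 A3 by (simp add: mult_four_block_mat[of _ 1 1 _ m _ m _ _ 1 _ m])
    then have "transpose_mat V * A' * V = four_block_mat ?E (0\<^sub>m 1 m) (0\<^sub>m m 1) (transpose_mat U3 * A3 * U3)"
      unfolding V_def using U3 A3 by (simp add: mult_four_block_mat[of _ 1 1 _ m _ m _ _ 1 _ m])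
    also have "\<dots> = mat_diag ?n (case_nat e d3)"
      unfolding U3A by (intro eq_matI) (auto split: nat.split simp: mat_diag_def)
    finally show ?thesis .
  qed
  let ?U = "H * V"
  have "transpose_mat ?U * ?U = transpose_mat V * (H * H) * V"
    using H V by (simp add: transpose_mult[of _ ?n ?n _ ?n] Hs assoc_mult_mat[of _ ?n ?n _ ?n _ ?n])
  then have 1: "transpose_mat ?U * ?U = 1\<^sub>m ?n" using V by (simp add: HH VV)
  have "transpose_mat ?U * A * ?U = transpose_mat V * A' * V"
    using H V A by (simp add: A'_def transpose_mult[of _ ?n ?n _ ?n] Hs assoc_mult_mat[of _ ?n ?n _ ?n _ ?n])
  then show ?case using 1 VA H V by (intro bexI[of _ ?U] exI[of _ "case_nat e d3"]) auto
qed

section \<open>Singular values\<close>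

text \<open>
  The columns of \<open>U\<close> are right singular vectors, and \<open>d\<close> lists the squares of the singular values.
\<close>

definition singular_decomposition :: "nat \<Rightarrow> real mat \<Rightarrow> real mat \<Rightarrow> (nat \<Rightarrow> real) \<Rightarrow> bool" where
  "singular_decomposition n B U d \<longleftrightarrow> U \<in> carrier_mat n n \<and> transpose_mat U * U = 1\<^sub>m n \<and>
     transpose_mat U * (transpose_mat B * B) * U = mat_diag n d"

definition count_singular_values_above :: "nat \<Rightarrow> real mat \<Rightarrow> real \<Rightarrow> nat" where
  "count_singular_values_above n B t = card {i \<in> {1..n}. singular_value B i > t}"

lemma singular_decomposition_exists:
  assumes "B \<in> carrier_mat n n"
  shows "\<exists>U d. singular_decomposition n B U d"
proof -
  have "transpose_mat (transpose_mat B * B) = transpose_mat B * B"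
    using assms by (simp add: transpose_mult[of _ n n _ n])
  moreover have "transpose_mat B * B \<in> carrier_mat n n" using assms by simp
  ultimately show ?thesis
    using spectral_theorem_symmetric_real[of "transpose_mat B * B" n]
    unfolding singular_decomposition_def by blast
qed

lemma scalar_prod_self: "x \<bullet> x = (\<Sum>i<dim_vec x. (x $ i)\<^sup>2)" for x :: "real Matrix.vec"
  by (simp add: scalar_prod_def atLeast0LessThan power2_eq_square)

lemma scalar_prod_mult_mat_vec:
  fixes A :: "real mat"
  assumes "A \<in> carrier_mat nr nc" "x \<in> carrier_vec nc" "y \<in> carrier_vec nr"
  shows "(A *\<^sub>v x) \<bullet> y = x \<bullet> (transpose_mat A *\<^sub>v y)"
  using assms by (simp add: transpose_vec_mult_scalar[symmetric] comm_scalar_prod[of _ nr] comm_scalar_prod[of x nc] )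

context
  fixes n B U d
  assumes sd: "singular_decomposition n B U d" and B: "B \<in> carrier_mat n n"
begin

lemma singular_decomposition_carrier: "U \<in> carrier_mat n n"
  using sd by (simp add: singular_decomposition_def)

lemma singular_decomposition_right_inverse: "U * transpose_mat U = 1\<^sub>m n"
  using sd mat_mult_left_right_inverse[of "transpose_mat U" n U]
  by (auto simp: singular_decomposition_def)

lemma singular_decomposition_norm:
  assumes c: "c \<in> carrier_vec n"
  shows "(U *\<^sub>v c) \<bullet> (U *\<^sub>v c) = (\<Sum>i<n. (c $ i)\<^sup>2)"
proof -
  have "(U *\<^sub>v c) \<bullet> (U *\<^sub>v c) = c \<bullet> ((transpose_mat U * U) *\<^sub>v c)"
    using c singular_decomposition_carrier
    by (simp add: scalar_prod_mult_mat_vec[of _ n n] assoc_mult_mat_vec[of _ n n _ n])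
  then show ?thesis using sd c by (simp add: singular_decomposition_def scalar_prod_self)
qed

text \<open>
  In the coordinates given by \<open>U\<close>, the map \<open>B\<close> scales the \<open>i\<close>-th coordinate by the singular value
  \<open>sqrt (d i)\<close>, as far as norms are concerned.
\<close>

lemma singular_decomposition_norm_image:
  assumes c: "c \<in> carrier_vec n"
  shows "(B *\<^sub>v (U *\<^sub>v c)) \<bullet> (B *\<^sub>v (U *\<^sub>v c)) = (\<Sum>i<n. d i * (c $ i)\<^sup>2)"
proof -
  have "(B *\<^sub>v (U *\<^sub>v c)) \<bullet> (B *\<^sub>v (U *\<^sub>v c)) = c \<bullet> ((transpose_mat U * (transpose_mat B * B) * U) *\<^sub>v c)"
    using c singular_decomposition_carrier B
    by (simp add: scalar_prod_mult_mat_vec[of _ n n] assoc_mult_mat_vec[of _ n n _ n])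
  also have "\<dots> = (\<Sum>i<n. d i * (c $ i)\<^sup>2)"
  proof -
    have "mat_diag n d *\<^sub>v c = Matrix.vec n (\<lambda>i. d i * c $ i)"
      using c by (intro eq_vecI) (auto simp: mat_diag_def scalar_prod_def if_distrib[of "\<lambda>x. x * _"] cong: if_cong)
    moreover have "c \<bullet> Matrix.vec n (\<lambda>i. d i * c $ i) = (\<Sum>i<n. d i * (c $ i)\<^sup>2)"
      using c by (simp add: scalar_prod_def atLeast0LessThan power2_eq_square mult_ac)
    ultimately show ?thesis using sd by (simp add: singular_decomposition_def)
  qed
  finally show ?thesis .
qed

lemma singular_decomposition_nonneg:
  assumes i: "i < n" shows "d i \<ge> 0"
proof -
  have "(\<Sum>j<n. d j * (unit_vec n i $ j)\<^sup>2) = (\<Sum>j<n. if j = i then d i else 0)"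
    using i by (intro sum.cong refl) auto
  then have "(B *\<^sub>v (U *\<^sub>v unit_vec n i)) \<bullet> (B *\<^sub>v (U *\<^sub>v unit_vec n i)) = d i"
    using singular_decomposition_norm_image[of "unit_vec n i"] i by simp
  then show ?thesis by (metis scalar_prod_self sum_nonneg zero_le_power2)
qed

text \<open>The characteristic polynomial of \<open>transpose B * B\<close> splits with roots \<open>d\<close>, so that the list of
  singular values has full length.\<close>

lemma mset_singular_values: "mset (singular_values B) = image_mset (\<lambda>i. sqrt (d i)) (mset_set {..<n})"
proof -
  let ?A = "transpose_mat B * B"
  have A: "?A \<in> carrier_mat n n" using B by simp
  have "similar_mat_wit (mat_diag n d) ?A (transpose_mat U) U"
    using sd A singular_decomposition_right_inverse
    by (intro similar_mat_witI[of _ _ n]) (auto simp: singular_decomposition_def)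
  then have "char_poly ?A = char_poly (mat_diag n d)"
    using char_poly_similar by (metis similar_mat_def)
  also have "\<dots> = (\<Prod>a\<leftarrow>diag_mat (mat_diag n d). [:- a, 1:])"
    by (rule char_poly_upper_triangular[of _ n]) (auto simp: mat_diag_def)
  also have "diag_mat (mat_diag n d) = map d [0..<n]"
    by (auto simp: diag_mat_def mat_diag_def)
  finally have cp: "char_poly ?A = (\<Prod>a\<leftarrow>map d [0..<n]. [:- a, 1:])" .
  have roots: "proots (\<Prod>a\<leftarrow>xs. [:- a, 1:]) = mset xs" for xs :: "real list"
  proof (induction xs)
    case (Cons a xs)
    have "(\<Prod>a\<leftarrow>xs. [:- a, 1:]) \<noteq> 0" by (auto simp: prod_list_zero_iff)
    then show ?case using Cons by (simp add: proots_mult del: mult_pCons_left)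
  qed simp
  then have pr: "proots (char_poly ?A) = image_mset d (mset_set {..<n})"
    unfolding cp roots by (simp add: atLeast0LessThan)
  have "size (image_mset sqrt (proots (char_poly ?A))) = n" by (simp add: pr)
  then have "length (sorted_list_of_multiset (image_mset sqrt (proots (char_poly ?A)))) = n"
    by (metis mset_sorted_list_of_multiset size_mset)
  then show ?thesis using B by (simp add: singular_values_def pr image_mset.compositionality comp_def)
qed

lemma count_singular_values_above_eq:
  assumes t: "t \<ge> 0"
  shows "count_singular_values_above n B t = card {i. i < n \<and> d i > t\<^sup>2}"
proof -
  let ?xs = "singular_values B"
  have len: "length ?xs = n"
    using arg_cong[OF mset_singular_values, of size] by simp
  have "{i \<in> {1..n}. singular_value B i > t} = Suc ` {i. i < length ?xs \<and> ?xs ! i > t}"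
    by (force simp: singular_value_def len image_iff Bex_def gr0_conv_Suc Suc_le_eq)
  then have "count_singular_values_above n B t = length (filter (\<lambda>x. x > t) ?xs)"
    by (simp add: count_singular_values_above_def card_image length_filter_conv_card)
  also have "\<dots> = size (filter_mset (\<lambda>x. x > t) (mset ?xs))"
    by (simp flip: size_mset)
  also have "\<dots> = card {i \<in> {..<n}. sqrt (d i) > t}"
    by (simp add: mset_singular_values filter_mset_image_mset)
  also have "{i \<in> {..<n}. sqrt (d i) > t} = {i. i < n \<and> d i > t\<^sup>2}"
    using t by (auto simp: not_le[symmetric] intro: real_le_lsqrt dest: sqrt_le_D)
  finally show ?thesis .
qed

end

section \<open>Perturbation of singular values\<close>

text \<open>
  The span of the columns of \<open>U\<close> with index in \<open>I\<close> meets the span of those of \<open>U'\<close> with index in \<open>J\<close>: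
  membership in both imposes \<open>(n - card I) + (n - card J) < n\<close> linear conditions.
\<close>

lemma subspaces_of_excess_dimension_meet:
  fixes U U' :: "real mat"
  assumes U: "U \<in> carrier_mat n n" "U * transpose_mat U = 1\<^sub>m n"
    and U': "U' \<in> carrier_mat n n" "transpose_mat U' * U' = 1\<^sub>m n"
    and IJ: "I \<subseteq> {..<n}" "J \<subseteq> {..<n}" and card: "card I + card J > n"
  shows "\<exists>c\<in>carrier_vec n. \<exists>c'\<in>carrier_vec n. U *\<^sub>v c = U' *\<^sub>v c' \<and> c' \<noteq> 0\<^sub>v n \<and>
    (\<forall>i<n. i \<notin> I \<longrightarrow> c $ i = 0) \<and> (\<forall>j<n. j \<notin> J \<longrightarrow> c' $ j = 0)"
proof -
  define T where "T = transpose_mat U * U'"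
  have T: "T \<in> carrier_mat n n" using U U' by (simp add: T_def)
  obtain inds where inds: "set inds = {..<n} - I" "distinct inds"
    using finite_distinct_list[of "{..<n} - I"] by auto
  obtain js where js: "set js = {..<n} - J" "distinct js"
    using finite_distinct_list[of "{..<n} - J"] by auto
  define rs where "rs = map (Matrix.row T) inds @ map (unit_vec n) js"
  have "length rs = (n - card I) + (n - card J)"
    using inds js IJ by (simp add: rs_def distinct_card[symmetric] card_Diff_subset finite_subset)
  moreover have "card I \<le> n" "card J \<le> n" using IJ card_mono[of "{..<n}"] by force+
  ultimately have len: "length rs < n" using card by linarith
  have "set rs \<subseteq> carrier_vec n"
    using T row_carrier[of T] by (auto simp: rs_def)
  from underdetermined_system[OF this len] obtain c'
    where c': "c' \<in> carrier_vec n" "c' \<noteq> 0\<^sub>v n" and z: "\<And>r. r \<in> set rs \<Longrightarrow> r \<bullet> c' = 0" by auto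
  have 1: "(T *\<^sub>v c') $ i = 0" if "i < n" "i \<notin> I" for i
    using z[of "Matrix.row T i"] inds that T by (auto simp: rs_def)
  have 2: "c' $ j = 0" if "j < n" "j \<notin> J" for j
    using z[of "unit_vec n j"] js that c' by (auto simp: rs_def)
  have "U *\<^sub>v (T *\<^sub>v c') = (U * transpose_mat U) *\<^sub>v (U' *\<^sub>v c')"
    using U(1) U'(1) c' by (simp add: T_def assoc_mult_mat_vec[of _ n n _ n])
  then have "U *\<^sub>v (T *\<^sub>v c') = U' *\<^sub>v c'" using U U' c' by simp
  with 1 2 c' T show ?thesis by (intro bexI[of _ "T *\<^sub>v c'"] bexI[of _ c']) auto
qed

text \<open>
  Weyl's inequality for singular values. If the count dropped, the span of the singular vectors of \<open>B\<close>
  with singular value above \<open>t + e\<close> and the span of those of \<open>B'\<close> with singular value at most \<open>t\<close> would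
  contain a common nonzero \<open>x\<close>; but then \<open>B x\<close> has norm above \<open>(t + e) * |x|\<close>, whereas \<open>B' x\<close> and
  \<open>(B - B') x\<close> have norms at most \<open>t * |x|\<close> and \<open>e * |x|\<close>.
\<close>

lemma count_singular_values_above_perturbation:
  fixes B B' :: "real mat"
  assumes B: "B \<in> carrier_mat n n" and B': "B' \<in> carrier_mat n n"
    and e: "\<And>x. x \<in> carrier_vec n \<Longrightarrow> ((B - B') *\<^sub>v x) \<bullet> ((B - B') *\<^sub>v x) \<le> e\<^sup>2 * (x \<bullet> x)"
    and "e \<ge> 0" "t \<ge> 0"
  shows "count_singular_values_above n B (t + e) \<le> count_singular_values_above n B' t"
proof (rule ccontr)
  assume contr: "\<not> ?thesis"
  define no where "no = (\<lambda>x :: real Matrix.vec. L2_set (\<lambda>i. x $ i) {..<n})"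
  have no: "x \<bullet> x = (no x)\<^sup>2" "no x \<ge> 0" if "x \<in> carrier_vec n" for x
    using that by (auto simp: no_def scalar_prod_self L2_set_def sum_nonneg)
  have no_add: "no (x + y) \<le> no x + no y" if "x \<in> carrier_vec n" "y \<in> carrier_vec n" for x y
  proof -
    have "no (x + y) = L2_set (\<lambda>i. x $ i + y $ i) {..<n}"
      using that by (auto simp: no_def intro!: L2_set_cong)
    then show ?thesis using L2_set_triangle_ineq by (simp add: no_def)
  qed
  obtain U d where sd: "singular_decomposition n B U d"
    using singular_decomposition_exists[OF B] by auto
  obtain U' d' where sd': "singular_decomposition n B' U' d'"
    using singular_decomposition_exists[OF B'] by auto
  define I where "I = {i. i < n \<and> d i > (t + e)\<^sup>2}"
  define J where "J = {i. i < n \<and> \<not> d' i > t\<^sup>2}"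
  have "card J = n - card {i. i < n \<and> d' i > t\<^sup>2}"
  proof -
    have "J = {..<n} - {i. i < n \<and> d' i > t\<^sup>2}" by (auto simp: J_def)
    then show ?thesis by (simp add: card_Diff_subset subset_eq)
  qed
  moreover have "card {i. i < n \<and> d' i > t\<^sup>2} \<le> card {..<n}" by (intro card_mono) auto
  ultimately have "card I + card J > n"
    using contr assms count_singular_values_above_eq[OF sd B, of "t + e"]
      count_singular_values_above_eq[OF sd' B', of t] by (simp add: I_def)
  then obtain c c' where c: "c \<in> carrier_vec n" "c' \<in> carrier_vec n" "U *\<^sub>v c = U' *\<^sub>v c'" "c' \<noteq> 0\<^sub>v n"
      "\<And>i. i < n \<Longrightarrow> i \<notin> I \<Longrightarrow> c $ i = 0" "\<And>j. j < n \<Longrightarrow> j \<notin> J \<Longrightarrow> c' $ j = 0"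
    using subspaces_of_excess_dimension_meet[of U n U' I J] singular_decomposition_right_inverse[OF sd B] sd sd'
    by (auto simp: singular_decomposition_def I_def J_def)
  define x where "x = U *\<^sub>v c"
  have x: "x \<in> carrier_vec n" using c(1) singular_decomposition_carrier[OF sd B] by (simp add: x_def)
  have xc: "(no x)\<^sup>2 = (\<Sum>i<n. (c $ i)\<^sup>2)" and xc': "(no x)\<^sup>2 = (\<Sum>i<n. (c' $ i)\<^sup>2)"
    using singular_decomposition_norm[OF sd B c(1)] singular_decomposition_norm[OF sd' B' c(2)] c(3)
      no(1)[OF x] by (simp_all add: x_def)
  have pos: "no x > 0"
  proof -
    obtain i where i: "i < n" "c' $ i \<noteq> 0" using c(2,4) by (metis carrier_vecD eq_vecI index_zero_vec)
    have "(c' $ i)\<^sup>2 \<le> (\<Sum>i<n. (c' $ i)\<^sup>2)" using i by (intro member_le_sum) auto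
    moreover have "(c' $ i)\<^sup>2 > 0" using i by simp
    ultimately have "(no x)\<^sup>2 > 0" using xc' by linarith
    with no(2)[OF x] show ?thesis by (cases "no x = 0") auto
  qed
  have Bx: "B *\<^sub>v x \<in> carrier_vec n" "B' *\<^sub>v x \<in> carrier_vec n" "(B - B') *\<^sub>v x \<in> carrier_vec n"
    using B B' x by (auto intro!: mult_mat_vec_carrier[of _ n n])
  have "(no (B' *\<^sub>v x))\<^sup>2 \<le> (t * no x)\<^sup>2"
  proof -
    have "(no (B' *\<^sub>v x))\<^sup>2 = (\<Sum>i<n. d' i * (c' $ i)\<^sup>2)"
      using singular_decomposition_norm_image[OF sd' B' c(2)] c(3) no(1)[OF Bx(2)]
      by (simp add: x_def)
    also have "\<dots> \<le> (\<Sum>i<n. t\<^sup>2 * (c' $ i)\<^sup>2)"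
    proof (intro sum_mono)
      fix i assume "i \<in> {..<n}"
      then show "d' i * (c' $ i)\<^sup>2 \<le> t\<^sup>2 * (c' $ i)\<^sup>2"
        using c(6)[of i] by (cases "i \<in> J") (auto simp: J_def intro!: mult_right_mono)
    qed
    finally show ?thesis by (simp add: xc' power_mult_distrib sum_distrib_left)
  qed
  then have upper: "no (B' *\<^sub>v x) \<le> t * no x"
    by (rule power2_le_imp_le) (use \<open>t \<ge> 0\<close> pos in simp)
  have "(no ((B - B') *\<^sub>v x))\<^sup>2 \<le> (e * no x)\<^sup>2"
    using e[OF x] by (simp add: no(1)[OF x] no(1)[OF Bx(3)] power_mult_distrib)
  then have diff: "no ((B - B') *\<^sub>v x) \<le> e * no x"
    by (rule power2_le_imp_le) (use \<open>e \<ge> 0\<close> pos in simp)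
  have "((t + e) * no x)\<^sup>2 < (no (B *\<^sub>v x))\<^sup>2"
  proof -
    obtain i where i: "i < n" "c $ i \<noteq> 0"
    proof -
      have "(\<Sum>i<n. (c $ i)\<^sup>2) \<noteq> 0" using xc pos by (metis less_irrefl zero_eq_power2)
      then have "\<exists>i\<in>{..<n}. (c $ i)\<^sup>2 \<noteq> 0" by (rule contrapos_np) (intro sum.neutral, blast)
      then show ?thesis using that by auto
    qed
    with c(5) have "i \<in> I" by auto
    have "((t + e) * no x)\<^sup>2 = (\<Sum>i<n. (t + e)\<^sup>2 * (c $ i)\<^sup>2)"
      by (simp add: xc power_mult_distrib sum_distrib_left)
    also have "\<dots> < (\<Sum>i<n. d i * (c $ i)\<^sup>2)"
    proof (rule sum_strict_mono_ex1)
      show "\<forall>i\<in>{..<n}. (t + e)\<^sup>2 * (c $ i)\<^sup>2 \<le> d i * (c $ i)\<^sup>2"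
      proof
        fix i assume "i \<in> {..<n}"
        then show "(t + e)\<^sup>2 * (c $ i)\<^sup>2 \<le> d i * (c $ i)\<^sup>2"
          using c(5)[of i] by (cases "i \<in> I") (auto simp: I_def intro!: mult_right_mono)
      qed
      show "\<exists>i\<in>{..<n}. (t + e)\<^sup>2 * (c $ i)\<^sup>2 < d i * (c $ i)\<^sup>2"
        using i \<open>i \<in> I\<close> by (intro bexI[of _ i]) (auto simp: I_def)
    qed simp
    also have "\<dots> = (no (B *\<^sub>v x))\<^sup>2"
      using singular_decomposition_norm_image[OF sd B c(1)] no(1)[OF Bx(1)]
      by (simp add: x_def)
    finally show ?thesis .
  qed
  then have lower: "(t + e) * no x < no (B *\<^sub>v x)"
    using no(2)[OF Bx(1)] by (rule power2_less_imp_less)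
  have "B *\<^sub>v x = B' *\<^sub>v x + (B - B') *\<^sub>v x"
  proof -
    have "(B' + (B - B')) *\<^sub>v x = B' *\<^sub>v x + (B - B') *\<^sub>v x"
      by (rule add_mult_distrib_mat_vec[of _ n n]) (use B B' x in auto)
    moreover have "B' + (B - B') = B" using B B' by (intro eq_matI) auto
    ultimately show ?thesis by simp
  qed
  then have "no (B *\<^sub>v x) \<le> no (B' *\<^sub>v x) + no ((B - B') *\<^sub>v x)"
    using no_add Bx by simp
  with upper diff lower show False by (simp add: algebra_simps)
qed

section \<open>Rank\<close>

lemma distinct_cols_of_injective:
  fixes W :: "real mat"
  assumes W: "W \<in> carrier_mat n r"
    and inj: "\<And>c. c \<in> carrier_vec r \<Longrightarrow> W *\<^sub>v c = 0\<^sub>v n \<Longrightarrow> c = 0\<^sub>v r"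
  shows "distinct (cols W)"
proof (rule ccontr)
  assume "\<not> distinct (cols W)"
  then obtain i j where ij: "i < r" "j < r" "i \<noteq> j" "col W i = col W j"
    using W by (auto simp: distinct_conv_nth)
  have "W *\<^sub>v (unit_vec r i - unit_vec r j) = W *\<^sub>v unit_vec r i - W *\<^sub>v unit_vec r j"
    using W by (intro mult_minus_distrib_mat_vec[of _ n r]) auto
  also have "\<dots> = col W i - col W j" using W ij(1,2) by (intro eq_vecI) auto
  also have "\<dots> = 0\<^sub>v n" unfolding ij(4) using W by (intro eq_vecI) auto
  finally have "unit_vec r i - unit_vec r j = (0\<^sub>v r :: real Matrix.vec)" by (intro inj) auto
  then have "(unit_vec r i - unit_vec r j) $ i = (0 :: real)" using ij by simp
  with ij show False by simp
qed

text \<open>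
  Together with the next lemma this characterizes the rank as the largest dimension of a space on which
  \<open>A\<close> is injective. In this form ranks can be compared by solving linear systems.
\<close>

lemma rank_ge_of_injective_restriction:
  fixes A V :: "real mat"
  assumes A: "A \<in> carrier_mat n nc" and V: "V \<in> carrier_mat nc r"
    and inj: "\<And>c. c \<in> carrier_vec r \<Longrightarrow> A *\<^sub>v (V *\<^sub>v c) = 0\<^sub>v n \<Longrightarrow> c = 0\<^sub>v r"
  shows "r \<le> vec_space.rank n A"
proof -
  interpret vec_space "TYPE(real)" n .
  let ?W = "A * V"
  have W: "?W \<in> carrier_mat n r" using A V by simp
  have injW: "c = 0\<^sub>v r" if "c \<in> carrier_vec r" "?W *\<^sub>v c = 0\<^sub>v n" for c
    using inj[OF that(1)] that A V by (simp add: assoc_mult_mat_vec[of _ n nc _ r])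
  have dist: "distinct (cols ?W)" by (rule distinct_cols_of_injective[OF W injW])
  have indpt: "\<not> lin_dep (set (cols ?W))" using lin_depE[OF W _ dist] injW by metis
  let ?S = "span (set (cols A))"
  have cA: "set (cols A) \<subseteq> carrier_vec n" using A cols_dim by blast
  have sub: "set (cols ?W) \<subseteq> ?S"
  proof
    fix x assume "x \<in> set (cols ?W)"
    then obtain j where j: "j < r" "x = col ?W j" using W by (auto simp: in_set_conv_nth)
    then have "x = A *\<^sub>v col V j" using A V by (simp only: col_mult2[of A n nc V r])
    then have "x \<in> col_space A"
      using A V j by (auto simp: col_space_eq[OF A])
    then show "x \<in> ?S" by (simp add: col_space_def)
  qed
  have sm: "submodule class_ring ?S (module_vec TYPE(real) n)" by (rule span_is_submodule[OF cA])
  interpret sp: vectorspace class_ring "vs ?S"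
    using subspace_is_vs[OF span_is_subspace[OF cA]] .
  have "card (set (cols ?W)) \<le> sp.dim"
  proof (rule sp.li_le_dim(2))
    show "sp.fin_dim" using fin_dim_span_cols[OF A] .
    show "set (cols ?W) \<subseteq> carrier (vs ?S)" using sub by simp
    show "\<not> sp.lin_dep (set (cols ?W))" using indpt span_li_not_depend(2)[OF sub sm] by simp
  qed
  then show ?thesis using dist V by (simp add: rank_def distinct_card)
qed

text \<open>
  The witness \<open>V\<close> selects a maximal linearly independent set of columns of \<open>A\<close>.
\<close>

lemma rank_attained_by_injective_restriction:
  fixes A :: "real mat"
  assumes A: "A \<in> carrier_mat n nc"
  shows "\<exists>V\<in>carrier_mat nc (vec_space.rank n A).
    \<forall>c\<in>carrier_vec (vec_space.rank n A). A *\<^sub>v (V *\<^sub>v c) = 0\<^sub>v n \<longrightarrow> c = 0\<^sub>v (vec_space.rank n A)"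
proof -
  interpret vec_space "TYPE(real)" n .
  obtain S where S: "maximal S (\<lambda>T. T \<subseteq> set (cols A) \<and> lin_indpt T)" "finite S"
    using maximal_exists_superset[of "set (cols A)" "\<lambda>T. T \<subseteq> set (cols A) \<and> lin_indpt T" "{}"]
      finite_lin_indpt2[of "{}"] by auto
  have rk: "rank A = card S" by (rule rank_card_indpt[OF A S(1)])
  have S': "S \<subseteq> set (cols A)" "lin_indpt S" using S by (auto simp: maximal_def)
  obtain ss where ss: "set ss = S" "distinct ss" using finite_distinct_list[OF S(2)] by auto
  define r where "r = rank A"
  have len: "length ss = r" using ss rk by (simp add: r_def distinct_card[symmetric])
  have "\<forall>j<r. \<exists>k<nc. ss ! j = col A k"
  proof (intro allI impI)
    fix j assume "j < r"
    then have "ss ! j \<in> set (cols A)" using S' ss len by (metis nth_mem subsetD)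
    then show "\<exists>k<nc. ss ! j = col A k" using A by (auto simp: in_set_conv_nth)
  qed
  then obtain f where f: "\<And>j. j < r \<Longrightarrow> f j < nc \<and> ss ! j = col A (f j)" by metis
  define V where "V = mat nc r (\<lambda>(i, j). if i = f j then 1 else 0 :: real)"
  have V: "V \<in> carrier_mat nc r" by (simp add: V_def)
  have "cols (A * V) = ss"
  proof (rule nth_equalityI)
    show "length (cols (A * V)) = length ss" using V by (simp add: len)
    fix j assume "j < length (cols (A * V))"
    then have j: "j < r" using V by simp
    have "col (A * V) j = A *\<^sub>v col V j" using j A V by (simp only: col_mult2[of A n nc V r])
    also have "col V j = unit_vec nc (f j)" using j f by (intro eq_vecI) (auto simp: V_def)
    also have "A *\<^sub>v unit_vec nc (f j) = ss ! j" using f[OF j] A by (intro eq_vecI) auto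
    finally show "cols (A * V) ! j = ss ! j" using j V by simp
  qed
  then have "c = 0\<^sub>v r" if "c \<in> carrier_vec r" "A *\<^sub>v (V *\<^sub>v c) = 0\<^sub>v n" for c
    using lin_depI[of "A * V" r c] that A V ss S'
    by (auto simp: assoc_mult_mat_vec[of _ n nc _ r])
  then show ?thesis using V unfolding r_def by blast
qed

text \<open>
  \<open>B\<close> is injective on the span of the singular vectors with nonzero singular value; on any space of
  larger dimension there is a nonzero vector orthogonal to all of them, and \<open>B\<close> annihilates it.
\<close>

lemma rank_eq_count_singular_values:
  assumes B: "B \<in> carrier_mat n n"
  shows "vec_space.rank n B = count_singular_values_above n B 0"
proof -
  obtain U d where sd: "singular_decomposition n B U d"
    using singular_decomposition_exists[OF B] by auto
  note U = singular_decomposition_carrier[OF sd B]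
  have d: "d i > 0 \<longleftrightarrow> d i \<noteq> 0" if "i < n" for i
    using singular_decomposition_nonneg[OF sd B that] by auto
  define I where "I = {i. i < n \<and> d i > 0}"
  have ct: "count_singular_values_above n B 0 = card I"
    using count_singular_values_above_eq[OF sd B, of 0] by (simp add: I_def)
  have zero: "x = 0\<^sub>v n" if "x \<bullet> x = 0" "x \<in> carrier_vec n" for x :: "real Matrix.vec"
  proof -
    have "\<forall>i<n. (x $ i)\<^sup>2 = 0"
      using that by (subst (asm) scalar_prod_self, subst (asm) sum_nonneg_eq_0_iff) auto
    then show ?thesis using that by (intro eq_vecI) auto
  qed
  obtain inds where inds: "set inds = I" "distinct inds"
    using finite_distinct_list[of I] by (auto simp: I_def)
  have len: "length inds = card I" using inds by (simp add: distinct_card[symmetric])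
  have "card I \<le> vec_space.rank n B"
  proof -
    define E where "E = mat n (card I) (\<lambda>(i, j). if i = inds ! j then 1 else 0 :: real)"
    have E: "E \<in> carrier_mat n (card I)" by (simp add: E_def)
    have Ec: "(E *\<^sub>v c) $ (inds ! j) = c $ j" if c: "c \<in> carrier_vec (card I)" and j: "j < card I" for c j
    proof -
      have "inds ! j < n" using inds len j by (metis (no_types, lifting) I_def mem_Collect_eq nth_mem)
      then have "(E *\<^sub>v c) $ (inds ! j) = (\<Sum>k<card I. (if k = j then 1 else 0) * c $ k)"
        using c j inds len by (auto simp: E_def scalar_prod_def atLeast0LessThan nth_eq_iff_index_eq intro!: sum.cong)
      also have "\<dots> = (\<Sum>k<card I. if k = j then c $ k else 0)" by (intro sum.cong) auto
      finally show ?thesis using j by simp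
    qed
    show ?thesis
    proof (rule rank_ge_of_injective_restriction[OF B, of "U * E"])
      show "U * E \<in> carrier_mat n (card I)" using U E by simp
      fix c assume c: "c \<in> carrier_vec (card I)" and z: "B *\<^sub>v (U * E *\<^sub>v c) = 0\<^sub>v n"
      have "(\<Sum>i<n. d i * ((E *\<^sub>v c) $ i)\<^sup>2) = 0"
        using singular_decomposition_norm_image[OF sd B, of "E *\<^sub>v c"] z c U E
        by (simp add: assoc_mult_mat_vec[of _ n n _ "card I"])
      then have "\<forall>i<n. d i * ((E *\<^sub>v c) $ i)\<^sup>2 = 0"
        using singular_decomposition_nonneg[OF sd B] by (subst (asm) sum_nonneg_eq_0_iff) auto
      then have "(E *\<^sub>v c) $ (inds ! j) = 0" if "j < card I" for j
        using that inds len unfolding I_def by (metis (no_types, lifting) mem_Collect_eq less_irrefl mult_eq_0_iff nth_mem zero_eq_power2)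
      then show "c = 0\<^sub>v (card I)" using Ec c by (intro eq_vecI) auto
    qed
  qed
  moreover have "vec_space.rank n B \<le> card I"
  proof (rule ccontr)
    define r where "r = vec_space.rank n B"
    assume "\<not> vec_space.rank n B \<le> card I"
    then have less: "card I < r" by (simp add: r_def)
    obtain V where V: "V \<in> carrier_mat n r"
      and inj: "\<And>c. c \<in> carrier_vec r \<Longrightarrow> B *\<^sub>v (V *\<^sub>v c) = 0\<^sub>v n \<Longrightarrow> c = 0\<^sub>v r"
      using rank_attained_by_injective_restriction[OF B] unfolding r_def by auto
    define T where "T = transpose_mat U * V"
    have T: "T \<in> carrier_mat n r" using U V by (simp add: T_def)
    have "set (map (Matrix.row T) inds) \<subseteq> carrier_vec r" using T row_carrier[of T] by auto
    moreover have "length (map (Matrix.row T) inds) < r" using less len by simp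
    ultimately obtain c where c: "c \<in> carrier_vec r" "c \<noteq> 0\<^sub>v r"
      and z: "\<And>x. x \<in> set (map (Matrix.row T) inds) \<Longrightarrow> x \<bullet> c = 0"
      using underdetermined_system by blast
    have UT: "U *\<^sub>v (T *\<^sub>v c) = V *\<^sub>v c"
    proof -
      have "U *\<^sub>v (T *\<^sub>v c) = (U * transpose_mat U) *\<^sub>v (V *\<^sub>v c)"
        using U V c by (simp add: T_def assoc_mult_mat_vec[of _ n n _ n] assoc_mult_mat_vec[of _ n n _ r])
      then show ?thesis using V c by (simp add: singular_decomposition_right_inverse[OF sd B])
    qed
    have Tc: "T *\<^sub>v c \<in> carrier_vec n" using T c by simp
    have "d i * ((T *\<^sub>v c) $ i)\<^sup>2 = 0" if "i < n" for i
    proof (cases "i \<in> I")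
      case True
      then have "Matrix.row T i \<bullet> c = 0" using inds z by simp
      then show ?thesis using that T by simp
    next
      case False
      then show ?thesis using that d[OF that] by (auto simp: I_def)
    qed
    then have "(\<Sum>i<n. d i * ((T *\<^sub>v c) $ i)\<^sup>2) = 0" by (intro sum.neutral) auto
    then have "(B *\<^sub>v (V *\<^sub>v c)) \<bullet> (B *\<^sub>v (V *\<^sub>v c)) = 0"
      using singular_decomposition_norm_image[OF sd B Tc] by (simp add: UT)
    moreover have "B *\<^sub>v (V *\<^sub>v c) \<in> carrier_vec n" using B V c by simp
    ultimately have "B *\<^sub>v (V *\<^sub>v c) = 0\<^sub>v n" by (rule zero)
    with inj c show False by blast
  qed
  ultimately show ?thesis by (simp add: ct)
qed

text \<open>
  The lower bound comes from the range of \<open>F\<close>, on which \<open>transpose F\<close> is injective; the upper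
  bound holds because \<open>transpose F\<close> has only \<open>k\<close> rows.
\<close>

lemma rank_congruence_full_column_rank:
  fixes F R :: "real mat"
  assumes F: "F \<in> carrier_mat n k" and R: "R \<in> carrier_mat k k"
    and injF: "\<And>c. c \<in> carrier_vec k \<Longrightarrow> F *\<^sub>v c = 0\<^sub>v n \<Longrightarrow> c = 0\<^sub>v k"
    and injR: "\<And>c. c \<in> carrier_vec k \<Longrightarrow> R *\<^sub>v c = 0\<^sub>v k \<Longrightarrow> c = 0\<^sub>v k"
  shows "vec_space.rank n (F * R * transpose_mat F) = k"
proof (rule antisym)
  let ?N = "F * R * transpose_mat F"
  have N: "?N \<in> carrier_mat n n" using F R by simp
  have split: "?N *\<^sub>v x = F *\<^sub>v (R *\<^sub>v (transpose_mat F *\<^sub>v x))" if "x \<in> carrier_vec n" for x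
    using F R that by (simp add: assoc_mult_mat_vec[of _ n k _ n] assoc_mult_mat_vec[of _ n k _ k])
  show "k \<le> vec_space.rank n ?N"
  proof (rule rank_ge_of_injective_restriction[OF N F])
    fix c assume c: "c \<in> carrier_vec k" and z: "?N *\<^sub>v (F *\<^sub>v c) = 0\<^sub>v n"
    have "F *\<^sub>v (R *\<^sub>v (transpose_mat F *\<^sub>v (F *\<^sub>v c))) = 0\<^sub>v n"
      using z split F c by simp
    then have "transpose_mat F *\<^sub>v (F *\<^sub>v c) = 0\<^sub>v k"
      using injF injR F R c by simp
    then have "(F *\<^sub>v c) \<bullet> (F *\<^sub>v c) = 0"
      using scalar_prod_mult_mat_vec[OF F c, of "F *\<^sub>v c"] F c by simp
    then have "\<forall>i<n. ((F *\<^sub>v c) $ i)\<^sup>2 = 0"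
      using F by (subst (asm) scalar_prod_self, subst (asm) sum_nonneg_eq_0_iff) auto
    then have "F *\<^sub>v c = 0\<^sub>v n" using F by (intro eq_vecI) auto
    then show "c = 0\<^sub>v k" using injF c by simp
  qed
  show "vec_space.rank n ?N \<le> k"
  proof (rule ccontr)
    define r where "r = vec_space.rank n ?N"
    assume "\<not> vec_space.rank n ?N \<le> k"
    then have less: "k < r" by (simp add: r_def)
    obtain V where V: "V \<in> carrier_mat n r"
      and inj: "\<And>c. c \<in> carrier_vec r \<Longrightarrow> ?N *\<^sub>v (V *\<^sub>v c) = 0\<^sub>v n \<Longrightarrow> c = 0\<^sub>v r"
      using rank_attained_by_injective_restriction[OF N] unfolding r_def by auto
    define T where "T = transpose_mat F * V"
    have T: "T \<in> carrier_mat k r" using F V by (simp add: T_def)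
    have "set (rows T) \<subseteq> carrier_vec r" using T row_carrier[of T] by (auto simp: rows_def)
    moreover have "length (rows T) < r" using less T by simp
    ultimately obtain c where c: "c \<in> carrier_vec r" "c \<noteq> 0\<^sub>v r"
      and z: "\<And>x. x \<in> set (rows T) \<Longrightarrow> x \<bullet> c = 0"
      using underdetermined_system by blast
    have "T *\<^sub>v c = 0\<^sub>v k" using T z by (intro eq_vecI) (auto simp: rows_def)
    then have "transpose_mat F *\<^sub>v (V *\<^sub>v c) = 0\<^sub>v k"
      using F V c by (simp add: T_def assoc_mult_mat_vec[of _ k n _ r])
    then have "?N *\<^sub>v (V *\<^sub>v c) = F *\<^sub>v (R *\<^sub>v 0\<^sub>v k)" using split V c by simp
    also have "\<dots> = 0\<^sub>v n"
    proof -
      have "R *\<^sub>v 0\<^sub>v k = 0\<^sub>v k" using R by (intro eq_vecI) auto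
      moreover have "F *\<^sub>v 0\<^sub>v k = 0\<^sub>v n" using F by (intro eq_vecI) auto
      ultimately show ?thesis by simp
    qed
    finally show False using inj c by blast
  qed
qed

section \<open>Irreducible transition matrices\<close>

lemma stochastic_matrix_pow:
  assumes "stochastic_matrix K Q"
  shows "stochastic_matrix K (Q ^\<^sub>m n)"
proof (induction n)
  case 0
  show ?case using assms by (auto simp: stochastic_matrix_def)
next
  case (Suc n)
  let ?R = "Q ^\<^sub>m n"
  have Q: "Q \<in> carrier_mat K K" and R: "?R \<in> carrier_mat K K"
    using assms Suc by (auto simp: stochastic_matrix_def)
  have entry: "(Q ^\<^sub>m Suc n) $$ (i, j) = (\<Sum>k<K. ?R $$ (i, k) * Q $$ (k, j))" if "i < K" "j < K" for i j
    using Q R that by (simp add: scalar_prod_def atLeast0LessThan)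
  show ?case unfolding stochastic_matrix_def
  proof (intro conjI allI impI)
    show "Q ^\<^sub>m Suc n \<in> carrier_mat K K" using mult_carrier_mat[OF R Q] by simp
    show "0 \<le> (Q ^\<^sub>m Suc n) $$ (i, j)" if "i < K" "j < K" for i j
      using assms Suc that by (subst entry) (auto simp: stochastic_matrix_def intro!: sum_nonneg)
    show "(\<Sum>j<K. (Q ^\<^sub>m Suc n) $$ (i, j)) = 1" if "i < K" for i
    proof -
      have "(\<Sum>j<K. (Q ^\<^sub>m Suc n) $$ (i, j)) = (\<Sum>j<K. \<Sum>k<K. ?R $$ (i, k) * Q $$ (k, j))"
        using that entry by simp
      also have "\<dots> = (\<Sum>k<K. ?R $$ (i, k) * (\<Sum>j<K. Q $$ (k, j)))"
        by (subst sum.swap) (simp add: sum_distrib_left)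
      also have "\<dots> = 1" using assms Suc that by (simp add: stochastic_matrix_def)
      finally show ?thesis .
    qed
  qed
qed

lemma harmonic_pow:
  assumes Q: "Q \<in> carrier_mat K K"
    and h: "\<And>i. i < K \<Longrightarrow> (\<Sum>j<K. Q $$ (i, j) * h j) = (h i :: real)" and i: "i < K"
  shows "(\<Sum>j<K. (Q ^\<^sub>m n) $$ (i, j) * h j) = h i"
  using i
proof (induction n arbitrary: i)
  case 0
  then have "(\<Sum>j<K. (Q ^\<^sub>m 0) $$ (i, j) * h j) = (\<Sum>j<K. if j = i then h i else 0)"
    using Q by (intro sum.cong) auto
  then show ?case using 0 by simp
next
  case (Suc n)
  have "(\<Sum>j<K. (Q ^\<^sub>m Suc n) $$ (i, j) * h j)
      = (\<Sum>j<K. \<Sum>k<K. (Q ^\<^sub>m n) $$ (i, k) * Q $$ (k, j) * h j)"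
    using Q Suc.prems by (intro sum.cong) (auto simp: scalar_prod_def atLeast0LessThan sum_distrib_right)
  also have "\<dots> = (\<Sum>k<K. (Q ^\<^sub>m n) $$ (i, k) * (\<Sum>j<K. Q $$ (k, j) * h j))"
    by (subst sum.swap) (simp add: sum_distrib_left mult.assoc)
  also have "\<dots> = h i" using h Suc by simp
  finally show ?case .
qed

text \<open>
  The maximum principle. Evaluating \<open>h - Q h = c\<close> where \<open>h\<close> is maximal and where it is minimal gives
  \<open>c = 0\<close>. Then \<open>h\<close> at a maximal point is its own average with respect to every power of \<open>Q\<close>, so \<open>h\<close>
  is maximal at every state that some power charges, that is, everywhere.
\<close>

lemma ergodic_harmonic_constant:
  assumes st: "stochastic_matrix K Q" and erg: "ergodic_matrix K Q"
    and h: "\<And>i. i < K \<Longrightarrow> h i - (\<Sum>j<K. Q $$ (i, j) * h j) = (c :: real)"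
    and ij: "i < K" "j < K"
  shows "h i = h j"
proof -
  have Q: "Q \<in> carrier_mat K K" and nn: "\<And>i j. i < K \<Longrightarrow> j < K \<Longrightarrow> 0 \<le> Q $$ (i, j)"
    and rs: "\<And>i. i < K \<Longrightarrow> (\<Sum>j<K. Q $$ (i, j)) = 1"
    using st by (auto simp: stochastic_matrix_def)
  have gap: "(\<Sum>j<K. Q $$ (i, j) * (h i - h j)) = c" if "i < K" for i
    using h[OF that] rs[OF that] by (simp add: right_diff_distrib sum_subtractf sum_distrib_right[symmetric])
  have "\<exists>a<K. \<forall>k<K. h k \<le> h a"
  proof -
    have "Max (h ` {..<K}) \<in> h ` {..<K}" using ij by (intro Max_in) auto
    then obtain a where "a < K" "h a = Max (h ` {..<K})" by force
    moreover have "\<forall>k<K. h k \<le> Max (h ` {..<K})" by simp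
    ultimately show ?thesis by metis
  qed
  then obtain a where a: "a < K" "\<And>k. k < K \<Longrightarrow> h k \<le> h a" by auto
  have "\<exists>b<K. \<forall>k<K. h b \<le> h k"
  proof -
    have "Min (h ` {..<K}) \<in> h ` {..<K}" using ij by (intro Min_in) auto
    then obtain a where "a < K" "h a = Min (h ` {..<K})" by force
    moreover have "\<forall>k<K. Min (h ` {..<K}) \<le> h k" by simp
    ultimately show ?thesis by metis
  qed
  then obtain b where b: "b < K" "\<And>k. k < K \<Longrightarrow> h b \<le> h k" by auto
  have "0 \<le> c" unfolding gap[OF a(1), symmetric] using a nn by (intro sum_nonneg) auto
  moreover have "c \<le> 0" unfolding gap[OF b(1), symmetric] using b nn
    by (intro sum_nonpos) (auto intro!: mult_nonneg_nonpos)
  ultimately have "c = 0" by simp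
  then have harm: "(\<Sum>j<K. Q $$ (i, j) * h j) = h i" if "i < K" for i using h[OF that] by simp
  have "h k = h a" if k: "k < K" for k
  proof -
    obtain n where n: "(Q ^\<^sub>m n) $$ (a, k) > 0" using erg a(1) k unfolding ergodic_matrix_def by blast
    have st': "stochastic_matrix K (Q ^\<^sub>m n)" by (rule stochastic_matrix_pow[OF st])
    have "(\<Sum>j<K. (Q ^\<^sub>m n) $$ (a, j) * (h a - h j)) = 0"
      using harmonic_pow[of Q K h a n] Q harm a st'
      by (simp add: right_diff_distrib sum_subtractf sum_distrib_right[symmetric] stochastic_matrix_def)
    then have "(Q ^\<^sub>m n) $$ (a, k) * (h a - h k) = 0"
      using k a st' by (subst (asm) sum_nonneg_eq_0_iff) (auto simp: stochastic_matrix_def)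
    with n show ?thesis by simp
  qed
  then show ?thesis using ij by metis
qed

text \<open>
  The inverse of \<open>I - Q + 1 u\<close>, where \<open>u\<close> is the uniform distribution as a row vector. The classical
  fundamental matrix of Kemeny and Snell has the stationary distribution in place of \<open>u\<close>; with \<open>u\<close> the
  matrix depends on \<open>Q\<close> only, without reference to a stationary distribution. The choice operator has a
  witness for irreducible \<open>Q\<close> and \<open>K > 0\<close>.
\<close>

definition fundamental_matrix :: "nat \<Rightarrow> real mat \<Rightarrow> real mat" where
  "fundamental_matrix K Q = (SOME Z. Z \<in> carrier_mat K K \<and>
     (let F = mat K K (\<lambda>(i, j). (if i = j then 1 else 0) - Q $$ (i, j) + 1 / real K) in
        F * Z = 1\<^sub>m K \<and> Z * F = 1\<^sub>m K))"

context
  fixes K :: nat and Q :: "real mat"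
  assumes st: "stochastic_matrix K Q" and erg: "ergodic_matrix K Q" and K: "K > 0"
begin

lemma fundamental_matrix:
  defines "F \<equiv> mat K K (\<lambda>(i, j). (if i = j then 1 else 0) - Q $$ (i, j) + 1 / real K)"
  shows "fundamental_matrix K Q \<in> carrier_mat K K" "F * fundamental_matrix K Q = 1\<^sub>m K"
    "fundamental_matrix K Q * F = 1\<^sub>m K"
proof -
  have Q: "Q \<in> carrier_mat K K" and rs: "\<And>i. i < K \<Longrightarrow> (\<Sum>j<K. Q $$ (i, j)) = 1"
    using st by (auto simp: stochastic_matrix_def)
  have F: "F \<in> carrier_mat K K" by (simp add: F_def)
  have "Determinant.det F \<noteq> 0"
  proof
    assume "Determinant.det F = 0"
    then obtain x where x: "x \<in> carrier_vec K" "x \<noteq> 0\<^sub>v K" "F *\<^sub>v x = 0\<^sub>v K"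
      using det_0_iff_vec_prod_zero_field[OF F] by auto
    define m where "m = (\<Sum>j<K. x $ j) / real K"
    have eq: "x $ i - (\<Sum>j<K. Q $$ (i, j) * x $ j) = - m" if i: "i < K" for i
    proof -
      have "(F *\<^sub>v x) $ i = (\<Sum>j<K. ((if i = j then 1 else 0) - Q $$ (i, j) + 1 / real K) * x $ j)"
        using i x(1) by (auto simp: F_def scalar_prod_def atLeast0LessThan intro!: sum.cong)
      also have "\<dots> = (\<Sum>j<K. (if j = i then x $ i else 0) - Q $$ (i, j) * x $ j + x $ j / real K)"
        by (intro sum.cong) (auto simp: algebra_simps)
      also have "\<dots> = x $ i - (\<Sum>j<K. Q $$ (i, j) * x $ j) + m"
        using i by (simp add: sum.distrib sum_subtractf m_def sum_divide_distrib)
      finally show ?thesis using x(3) i by simp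
    qed
    have const: "x $ i = x $ 0" if "i < K" for i
      using ergodic_harmonic_constant[OF st erg, of "\<lambda>i. x $ i" "- m" i 0] eq that K by simp
    have "(\<Sum>j<K. x $ j) = (\<Sum>j<K. x $ 0)" by (intro sum.cong const) auto
    then have m: "m = x $ 0" using K by (simp add: m_def)
    have m0: "m = 0"
    proof -
      have "(\<Sum>j<K. Q $$ (0, j) * x $ j) = (\<Sum>j<K. Q $$ (0, j) * x $ 0)"
        by (intro sum.cong arg_cong2[of _ _ _ _ "(*)"] const) auto
      also have "\<dots> = x $ 0" using rs[OF K] by (simp add: sum_distrib_right[symmetric])
      finally show ?thesis using eq[OF K] by simp
    qed
    have "x $ i = 0" if "i < K" for i using const[OF that] m m0 by simp
    then have "x = 0\<^sub>v K" using x(1) by (intro eq_vecI) auto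
    with x show False by simp
  qed
  then obtain Z where "Z \<in> carrier_mat K K" "F * Z = 1\<^sub>m K" "Z * F = 1\<^sub>m K"
    using det_non_zero_imp_unit[OF F] by (auto simp: Units_def ring_mat_def)
  then have "\<exists>Z. Z \<in> carrier_mat K K \<and> F * Z = 1\<^sub>m K \<and> Z * F = 1\<^sub>m K" by auto
  from someI_ex[OF this]
  show "fundamental_matrix K Q \<in> carrier_mat K K" "F * fundamental_matrix K Q = 1\<^sub>m K"
    "fundamental_matrix K Q * F = 1\<^sub>m K"
    by (auto simp: fundamental_matrix_def F_def Let_def)
qed

context
  fixes \<pi> :: "real Matrix.vec"
  assumes pi: "\<pi> \<in> carrier_vec K" "stationary_distribution \<pi> Q" "(\<Sum>i<K. \<pi> $ i) = 1" "\<And>i. i < K \<Longrightarrow> 0 \<le> \<pi> $ i"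
begin

lemma stationary_sum: "j < K \<Longrightarrow> (\<Sum>i<K. \<pi> $ i * Q $$ (i, j)) = \<pi> $ j"
proof -
  assume j: "j < K"
  have Q: "Q \<in> carrier_mat K K" using st by (auto simp: stochastic_matrix_def)
  have "(transpose_mat Q *\<^sub>v \<pi>) $ j = (\<Sum>i<K. \<pi> $ i * Q $$ (i, j))"
    using Q pi(1) j by (auto simp: scalar_prod_def atLeast0LessThan mult.commute intro!: sum.cong)
  then show ?thesis using pi(2) by (simp add: stationary_distribution_def)
qed

text \<open>
  A stationary \<open>\<pi>\<close> satisfies \<open>\<pi> (I - Q + 1 u) = u\<close>, hence \<open>\<pi> = u Z\<close> with the fundamental matrix \<open>Z\<close>.
\<close>

lemma stationary_distribution_unique:
  assumes j: "j < K"
  shows "\<pi> $ j = (\<Sum>i<K. fundamental_matrix K Q $$ (i, j) / real K)"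
proof -
  let ?Z = "fundamental_matrix K Q"
  define F where "F = mat K K (\<lambda>(i, j). (if i = j then 1 else 0) - Q $$ (i, j) + 1 / real K)"
  note Z = fundamental_matrix[folded F_def]
  have piF: "(\<Sum>i<K. \<pi> $ i * F $$ (i, k)) = 1 / real K" if k: "k < K" for k
  proof -
    have "(\<Sum>i<K. \<pi> $ i * F $$ (i, k)) = (\<Sum>i<K. (if i = k then \<pi> $ k else 0) - \<pi> $ i * Q $$ (i, k) + \<pi> $ i / real K)"
      using k by (intro sum.cong) (auto simp: F_def algebra_simps)
    also have "\<dots> = 1 / real K"
      using k stationary_sum[OF k] pi(3) by (simp add: sum.distrib sum_subtractf sum_divide_distrib[symmetric])
    finally show ?thesis .
  qed
  have "\<pi> $ j = (\<Sum>i<K. \<pi> $ i * (F * ?Z) $$ (i, j))"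
  proof -
    have "(\<Sum>i<K. \<pi> $ i * (F * ?Z) $$ (i, j)) = (\<Sum>i<K. if i = j then \<pi> $ j else 0)"
      using Z j by (intro sum.cong) auto
    then show ?thesis using j by simp
  qed
  also have "\<dots> = (\<Sum>i<K. \<Sum>k<K. \<pi> $ i * F $$ (i, k) * ?Z $$ (k, j))"
    using Z(1) j by (intro sum.cong) (auto simp: F_def scalar_prod_def atLeast0LessThan sum_distrib_left mult.assoc)
  also have "\<dots> = (\<Sum>k<K. (\<Sum>i<K. \<pi> $ i * F $$ (i, k)) * ?Z $$ (k, j))"
    by (subst sum.swap) (simp add: sum_distrib_right)
  finally show ?thesis using piF by simp
qed

text \<open>
  Here \<open>(I - Q + 1 u) h = v\<close>, and multiplying by \<open>\<pi>\<close> from the left shows that the term \<open>u h\<close> vanishes.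
  No power of \<open>Q\<close> has to converge, so periodic chains are covered.
\<close>

lemma poisson_equation:
  assumes v: "(\<Sum>i<K. \<pi> $ i * v i) = 0" and i: "i < K"
  defines "h \<equiv> \<lambda>i. \<Sum>j<K. fundamental_matrix K Q $$ (i, j) * v j"
  shows "h i - (\<Sum>j<K. Q $$ (i, j) * h j) = v i"
proof -
  let ?Z = "fundamental_matrix K Q"
  define F where "F = mat K K (\<lambda>(i, j). (if i = j then 1 else 0) - Q $$ (i, j) + 1 / real K)"
  note Z = fundamental_matrix[folded F_def]
  define m where "m = (\<Sum>j<K. h j) / real K"
  have eq: "h k - (\<Sum>j<K. Q $$ (k, j) * h j) + m = v k" if k: "k < K" for k
  proof -
    have "h k - (\<Sum>j<K. Q $$ (k, j) * h j) + m
      = (\<Sum>j<K. (if j = k then h k else 0) - Q $$ (k, j) * h j + h j / real K)"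
      using k by (simp add: sum.distrib sum_subtractf m_def sum_divide_distrib)
    also have "\<dots> = (\<Sum>j<K. F $$ (k, j) * h j)"
      using k by (intro sum.cong) (auto simp: F_def algebra_simps)
    also have "\<dots> = (\<Sum>l<K. (\<Sum>j<K. F $$ (k, j) * ?Z $$ (j, l)) * v l)"
      unfolding h_def sum_distrib_left sum_distrib_right by (subst sum.swap) (simp add: mult.assoc)
    also have "\<dots> = (\<Sum>l<K. (F * ?Z) $$ (k, l) * v l)"
      using Z(1) k by (intro sum.cong) (auto simp: F_def scalar_prod_def atLeast0LessThan intro!: sum.cong)
    also have "\<dots> = (\<Sum>l<K. if l = k then v k else 0)"
      using Z k by (intro sum.cong) auto
    finally show ?thesis using k by simp
  qed
  have "(\<Sum>k<K. \<pi> $ k * (h k - (\<Sum>j<K. Q $$ (k, j) * h j) + m)) = 0" using eq v by simp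
  moreover have "(\<Sum>k<K. \<pi> $ k * (\<Sum>j<K. Q $$ (k, j) * h j)) = (\<Sum>j<K. (\<Sum>k<K. \<pi> $ k * Q $$ (k, j)) * h j)"
    unfolding sum_distrib_left sum_distrib_right by (subst sum.swap) (simp add: mult.assoc)
  moreover have "\<dots> = (\<Sum>j<K. \<pi> $ j * h j)" by (simp add: stationary_sum)
  moreover have "(\<Sum>k<K. \<pi> $ k * m) = m" using pi(3) by (simp add: sum_distrib_right[symmetric])
  ultimately have "m = 0" by (simp add: algebra_simps sum.distrib sum_subtractf)
  with eq[OF i] show ?thesis by simp
qed

lemma stationary_distribution_pos:
  assumes j: "j < K"
  shows "\<pi> $ j > 0"
proof -
  have Q: "Q \<in> carrier_mat K K" using st by (auto simp: stochastic_matrix_def)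
  obtain i where i: "i < K" "\<pi> $ i > 0"
  proof -
    have "(\<Sum>i<K. \<pi> $ i) \<noteq> 0" using pi(3) by simp
    then obtain i where "i < K" "\<pi> $ i \<noteq> 0" by (meson lessThan_iff sum.not_neutral_contains_not_neutral)
    with pi(4)[of i] show ?thesis by (intro that[of i]) auto
  qed
  obtain n where n: "(Q ^\<^sub>m n) $$ (i, j) > 0" using erg i(1) j unfolding ergodic_matrix_def by blast
  have inv: "(\<Sum>k<K. \<pi> $ k * (Q ^\<^sub>m n) $$ (k, j)) = \<pi> $ j" if "j < K" for j n
    using that
  proof (induction n arbitrary: j)
    case 0
    then have "(\<Sum>k<K. \<pi> $ k * (Q ^\<^sub>m 0) $$ (k, j)) = (\<Sum>k<K. if k = j then \<pi> $ j else 0)"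
      using Q by (intro sum.cong) auto
    then show ?case using 0 by simp
  next
    case (Suc n)
    have "(\<Sum>k<K. \<pi> $ k * (Q ^\<^sub>m Suc n) $$ (k, j))
        = (\<Sum>k<K. \<Sum>l<K. \<pi> $ k * (Q ^\<^sub>m n) $$ (k, l) * Q $$ (l, j))"
      using Q Suc.prems by (intro sum.cong) (auto simp: scalar_prod_def atLeast0LessThan sum_distrib_left mult.assoc)
    also have "\<dots> = (\<Sum>l<K. (\<Sum>k<K. \<pi> $ k * (Q ^\<^sub>m n) $$ (k, l)) * Q $$ (l, j))"
      by (subst sum.swap) (simp add: sum_distrib_right)
    also have "\<dots> = \<pi> $ j" using Suc stationary_sum by simp
    finally show ?case .
  qed
  have "\<pi> $ i * (Q ^\<^sub>m n) $$ (i, j) \<le> (\<Sum>k<K. \<pi> $ k * (Q ^\<^sub>m n) $$ (k, j))"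
    using i j pi(4) stochastic_matrix_pow[OF st, of n]
    by (intro member_le_sum) (auto simp: stochastic_matrix_def)
  moreover have "\<pi> $ i * (Q ^\<^sub>m n) $$ (i, j) > 0" using i n by simp
  ultimately show ?thesis using inv[OF j] by simp
qed

end
end

section \<open>The joint law of a hidden Markov model\<close>

abbreviation paths :: "nat \<Rightarrow> nat \<Rightarrow> (nat \<Rightarrow> nat) set" where
  "paths K n \<equiv> {1..n} \<rightarrow>\<^sub>E {..<K}"

locale hmm =
  fixes \<mu> :: "'y measure" and P :: "'w measure" and X :: "nat \<Rightarrow> 'w \<Rightarrow> nat" and Y :: "nat \<Rightarrow> 'w \<Rightarrow> 'y"
    and K :: nat and \<pi> :: "real Matrix.vec" and Q :: "real mat" and f :: "nat \<Rightarrow> 'y \<Rightarrow> real"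
  assumes model: "hidden_markov_model \<mu> P X Y K \<pi> Q f"
begin

sublocale prob_space P using model by (simp add: hidden_markov_model_def)

lemma chain: "markov_chain P X K \<pi> Q" and stochastic: "stochastic_matrix K Q"
  and pi_carrier: "\<pi> \<in> carrier_vec K"
  using model by (auto simp: hidden_markov_model_def markov_chain_def)

lemma measurable_X: "1 \<le> j \<Longrightarrow> X j \<in> measurable P (count_space {..<K})"
  using chain by (simp add: markov_chain_def)

lemma X_less: "1 \<le> j \<Longrightarrow> \<omega> \<in> space P \<Longrightarrow> X j \<omega> < K"
  using measurable_space[OF measurable_X] by force

lemma K_pos: "K > 0"
  using not_empty X_less[of 1] by fastforce

lemma measurable_Y: "1 \<le> j \<Longrightarrow> Y j \<in> measurable P \<mu>"
  using model by (simp add: hidden_markov_model_def)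

text \<open>
  The law of an observation in the hidden state \<open>k\<close>. For \<open>k \<ge> K\<close> the value is the law for the state
  \<open>0\<close>, so that product measures over arbitrary index functions consist of probability measures.
\<close>

definition emission :: "nat \<Rightarrow> 'y measure" where
  "emission k = density \<mu> (\<lambda>y. ennreal (f (if k < K then k else 0) y))"

lemma density_measurable: "k < K \<Longrightarrow> f k \<in> borel_measurable \<mu>"
  using model by (auto simp: hidden_markov_model_def L2_def)

lemma prob_space_emission: "prob_space (emission k)"
  using model K_pos by (auto simp: hidden_markov_model_def emission_def)

lemma sets_emission [measurable_cong]: "sets (emission k) = sets \<mu>"
  by (simp add: emission_def)

lemma product_prob_space_emission: "product_prob_space (\<lambda>j. emission (x j))"
  unfolding product_prob_space_def product_prob_space_axioms_def product_sigma_finite_def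
  using prob_space_emission prob_space_imp_sigma_finite by blast

lemma finite_product_prob_space_emission: "finite I \<Longrightarrow> finite_product_prob_space (\<lambda>j. emission (x j)) I"
  by (simp add: finite_product_prob_space_def product_prob_space_emission finite_product_sigma_finite_def
      finite_product_sigma_finite_axioms_def product_prob_space.axioms(1))

lemma AE_emission: "(AE y in \<mu>. R y) \<Longrightarrow> AE y in emission k. R y"
  using K_pos density_measurable[of k] density_measurable[of 0] unfolding emission_def
  by (subst AE_density) (auto elim: eventually_mono)

lemma integral_emission:
  assumes "k < K" "g \<in> borel_measurable \<mu>"
  shows "(\<integral>y. g y \<partial>emission k) = (\<integral>y. g y * f k y \<partial>\<mu>)"
    and "integrable (emission k) g \<longleftrightarrow> integrable \<mu> (\<lambda>y. g y * f k y)"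
proof -
  have "AE y in \<mu>. 0 \<le> f k y" using model assms(1) by (simp add: hidden_markov_model_def)
  then show "(\<integral>y. g y \<partial>emission k) = (\<integral>y. g y * f k y \<partial>\<mu>)"
    "integrable (emission k) g \<longleftrightarrow> integrable \<mu> (\<lambda>y. g y * f k y)"
    using assms density_measurable
    by (simp_all add: emission_def integral_density integrable_density mult.commute)
qed

definition path_event :: "nat \<Rightarrow> (nat \<Rightarrow> nat) \<Rightarrow> 'w set" where
  "path_event n x = {\<omega> \<in> space P. \<forall>j\<in>{1..n}. X j \<omega> = x j}"

definition path_prob :: "nat \<Rightarrow> (nat \<Rightarrow> nat) \<Rightarrow> real" where
  "path_prob n x = prob (path_event n x)"

lemma subalgebra_process: "subalgebra P (sigma_of_process P X)"
proof -
  have "X j -` {k} \<inter> space P \<in> sets P" if "1 \<le> j" for j k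
  proof (cases "k < K")
    case True
    then show ?thesis using measurable_sets[OF measurable_X[OF that], of "{k}"] by simp
  next
    case False
    then have "X j -` {k} \<inter> space P = {}" using X_less[OF that] by auto
    then show ?thesis by simp
  qed
  then show ?thesis
    unfolding subalgebra_def sigma_of_process_def
    by (auto intro!: sets.sigma_sets_subset simp: sets_measure_of_conv space_measure_of_conv)
qed

lemma path_event_in_process: "path_event n x \<in> sets (sigma_of_process P X)"
proof -
  let ?G = "{X j -` {k} \<inter> space P | j k. 1 \<le> j}"
  have G: "?G \<subseteq> Pow (space P)" by auto
  have S: "space (sigma_of_process P X) = space P"
    by (simp add: sigma_of_process_def space_measure_of_conv)
  show ?thesis
  proof (cases "n = 0")
    case True
    then have "path_event n x = space (sigma_of_process P X)" using S by (simp add: path_event_def)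
    then show ?thesis by (metis sets.top)
  next
    case False
    have "path_event n x = (\<Inter>j\<in>{1..n}. X j -` {x j} \<inter> space P)"
      using False by (auto simp: path_event_def)
    also have "\<dots> \<in> sets (sigma_of_process P X)"
    proof (rule sets.finite_INT)
      fix j assume "j \<in> {1..n}"
      then have "X j -` {x j} \<inter> space P \<in> ?G" by auto
      then show "X j -` {x j} \<inter> space P \<in> sets (sigma_of_process P X)"
        using G by (auto simp: sigma_of_process_def)
    qed (use False in auto)
    finally show ?thesis .
  qed
qed

lemma path_event_sets [measurable]: "path_event n x \<in> sets P"
  using path_event_in_process subalgebra_process by (auto simp: subalgebra_def)

lemma path_prob_nonneg: "0 \<le> path_prob n x" by (simp add: path_prob_def)

lemma path_prob_cong: "(\<And>j. j \<in> {1..n} \<Longrightarrow> x j = x' j) \<Longrightarrow> path_prob n x = path_prob n x'"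
  by (auto simp: path_prob_def path_event_def intro!: arg_cong[of _ _ prob])

lemma path_prob_1: "x 1 < K \<Longrightarrow> path_prob 1 x = \<pi> $ x 1"
  using chain by (simp add: markov_chain_def path_prob_def path_event_def)

text \<open>
  The model constrains the transition only after paths of positive probability; after the others both
  sides vanish.
\<close>

lemma path_prob_Suc:
  assumes "n \<ge> 1" "x (Suc n) < K"
  shows "path_prob (Suc n) x = path_prob n x * Q $$ (x n, x (Suc n))"
proof (cases "path_prob n x = 0")
  case True
  have "path_prob (Suc n) x \<le> path_prob n x"
    unfolding path_prob_def by (intro finite_measure_mono path_event_sets) (auto simp: path_event_def)
  then show ?thesis using True path_prob_nonneg[of "Suc n" x] by simp
next
  case False
  then have "\<P>(\<omega> in P. X (Suc n) \<omega> = x (Suc n) \<bar> \<forall>j\<in>{1..n}. X j \<omega> = x j) = Q $$ (x n, x (Suc n))"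
    using chain assms by (auto simp: markov_chain_def path_prob_def path_event_def)
  moreover have "{\<omega> \<in> space P. X (Suc n) \<omega> = x (Suc n) \<and> (\<forall>j\<in>{1..n}. X j \<omega> = x j)} = path_event (Suc n) x"
    by (auto simp: path_event_def atLeastAtMostSuc_conv)
  ultimately show ?thesis using False
    by (simp add: cond_prob_def path_prob_def path_event_def[of n] field_simps)
qed

lemma finite_paths: "finite (paths K n)"
  by (intro finite_PiE) auto

lemma indicator_path_partition:
  assumes "\<omega> \<in> space P"
  shows "(\<Sum>x\<in>paths K n. indicator (path_event n x) \<omega>) = (1 :: real)"
proof -
  let ?x = "\<lambda>j\<in>{1..n}. X j \<omega>"
  have "?x \<in> paths K n" using X_less assms by auto
  moreover have "indicator (path_event n x) \<omega> = (if x = ?x then 1 else 0 :: real)" if "x \<in> paths K n" for x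
  proof -
    have "\<omega> \<in> path_event n x \<longleftrightarrow> x = ?x"
      using that assms by (auto simp: path_event_def fun_eq_iff PiE_def extensional_def restrict_def)
    then show ?thesis by (simp add: indicator_def)
  qed
  ultimately show ?thesis using finite_paths by (simp add: sum.delta)
qed

lemma sum_path_prob: "(\<Sum>x\<in>paths K n. path_prob n x) = 1"
proof -
  have "(\<Sum>x\<in>paths K n. path_prob n x) = (\<integral>\<omega>. (\<Sum>x\<in>paths K n. indicator (path_event n x) \<omega>) \<partial>P)"
    by (subst Bochner_Integration.integral_sum)
      (auto simp: path_prob_def emeasure_eq_measure intro!: integrable_real_indicator)
  also have "\<dots> = (\<integral>\<omega>. 1 \<partial>P)" by (intro Bochner_Integration.integral_cong) (simp_all add: indicator_path_partition del: One_nat_def)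
  finally show ?thesis by (simp add: prob_space)
qed

definition Y_vec :: "nat \<Rightarrow> 'w \<Rightarrow> nat \<Rightarrow> 'y" where
  "Y_vec n \<omega> = (\<lambda>j\<in>{1..n}. Y j \<omega>)"

lemma measurable_Y_vec [measurable]: "Y_vec n \<in> measurable P (\<Pi>\<^sub>M j\<in>{1..n}. \<mu>)"
  unfolding Y_vec_def by (intro measurable_restrict measurable_Y) auto

lemma measurable_Y_vec_uniform: "Y_vec n \<in> measurable (uniform_measure P A) (\<Pi>\<^sub>M j\<in>{1..n}. \<mu>)"
  using measurable_Y_vec[of n] measurable_cong_sets[OF sets_uniform_measure refl, of P A] by blast

text \<open>
  Integrating the conditional expectation of the product of indicators over the event that the hidden
  path is \<open>x\<close>, which is measurable with respect to the hidden process.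
\<close>

lemma prob_path_and_observations:
  assumes x: "x \<in> paths K n" and A: "\<And>j. j \<in> {1..n} \<Longrightarrow> A j \<in> sets \<mu>"
  shows "prob (path_event n x \<inter> {\<omega>\<in>space P. \<forall>j\<in>{1..n}. Y j \<omega> \<in> A j})
    = path_prob n x * (\<Prod>j\<in>{1..n}. measure (emission (x j)) (A j))"
proof -
  interpret sub: finite_measure_subalgebra P "sigma_of_process P X"
    by (intro finite_measure_subalgebra.intro finite_measure_subalgebra_axioms.intro
        finite_measure_axioms subalgebra_process)
  let ?I = "\<lambda>\<omega>. \<Prod>j\<in>{1..n}. indicator (A j) (Y j \<omega>) :: real"
  let ?B = "{\<omega>\<in>space P. \<forall>j\<in>{1..n}. Y j \<omega> \<in> A j}"
  have B: "?B \<in> sets P"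
    using measurable_Y A by (intro sets.sets_Collect_finite_All) (auto intro!: measurable_sets_Collect)
  have I: "?I \<omega> = indicator ?B \<omega>" if "\<omega> \<in> space P" for \<omega>
    using that by (auto simp: indicator_def)
  have "integrable P (indicator ?B :: 'w \<Rightarrow> real)" using B by (intro integrable_real_indicator) (auto simp: emeasure_eq_measure)
  then have int: "integrable P ?I" by (subst Bochner_Integration.integrable_cong[OF refl I]) auto
  have ce: "AE \<omega> in P. real_cond_exp P (sigma_of_process P X) ?I \<omega> =
      (\<Prod>j\<in>{1..n}. measure (density \<mu> (\<lambda>y. ennreal (f (X j \<omega>) y))) (A j))"
    using model A unfolding hidden_markov_model_def by blast
  have "prob (path_event n x \<inter> ?B) = (\<integral>\<omega>\<in>path_event n x. ?I \<omega> \<partial>P)"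
  proof -
    have "(\<integral>\<omega>\<in>path_event n x. ?I \<omega> \<partial>P) = (\<integral>\<omega>. indicator (path_event n x \<inter> ?B) \<omega> \<partial>P)"
      unfolding set_lebesgue_integral_def using I
      by (intro Bochner_Integration.integral_cong) (auto simp: indicator_inter_arith)
    then show ?thesis using B by simp
  qed
  also have "\<dots> = (\<integral>\<omega>\<in>path_event n x. real_cond_exp P (sigma_of_process P X) ?I \<omega> \<partial>P)"
    by (rule sub.real_cond_exp_intA[OF int path_event_in_process])
  also have "\<dots> = (\<integral>\<omega>\<in>path_event n x. (\<Prod>j\<in>{1..n}. measure (emission (x j)) (A j)) \<partial>P)"
    unfolding set_lebesgue_integral_def
  proof (rule integral_cong_AE)
    show "(\<lambda>\<omega>. indicator (path_event n x) \<omega> *\<^sub>R real_cond_exp P (sigma_of_process P X) ?I \<omega>) \<in> borel_measurable P"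
      by simp
    show "AE \<omega> in P. indicator (path_event n x) \<omega> *\<^sub>R real_cond_exp P (sigma_of_process P X) ?I \<omega> =
      indicator (path_event n x) \<omega> *\<^sub>R (\<Prod>j\<in>{1..n}. measure (emission (x j)) (A j))"
      using ce
    proof eventually_elim
      case (elim \<omega>)
      show ?case
      proof (cases "\<omega> \<in> path_event n x")
        case True
        then have "(\<Prod>j\<in>{1..n}. measure (density \<mu> (\<lambda>y. ennreal (f (X j \<omega>) y))) (A j))
          = (\<Prod>j\<in>{1..n}. measure (emission (x j)) (A j))"
          using x by (intro prod.cong) (auto simp: path_event_def emission_def PiE_iff)
        then show ?thesis using elim by simp
      qed simp
    qed
  qed simp
  finally show ?thesis by (simp add: set_lebesgue_integral_def path_prob_def mult.commute)
qed

text \<open>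
  Given a hidden path of positive probability, the observations are independent with the laws of the
  states on the path.
\<close>

lemma distr_observations_given_path:
  assumes x: "x \<in> paths K n" and pos: "path_prob n x > 0"
  shows "distr (uniform_measure P (path_event n x)) (\<Pi>\<^sub>M j\<in>{1..n}. \<mu>) (Y_vec n) = (\<Pi>\<^sub>M j\<in>{1..n}. emission (x j))"
proof -
  interpret pe: product_prob_space "\<lambda>j. emission (x j)" by (rule product_prob_space_emission)
  let ?U = "uniform_measure P (path_event n x)"
  have em: "emeasure P (path_event n x) = ennreal (path_prob n x)"
    by (simp add: path_prob_def emeasure_eq_measure)
  interpret U: prob_space ?U
    using pos by (intro prob_space_uniform_measure) (auto simp: em)
  note meas = measurable_Y_vec_uniform[of n "path_event n x"]
  show ?thesis
  proof (rule pe.PiM_eqI)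
    show "sets (distr ?U (\<Pi>\<^sub>M j\<in>{1..n}. \<mu>) (Y_vec n)) = sets (\<Pi>\<^sub>M j\<in>{1..n}. emission (x j))"
      by (simp add: sets_emission cong: sets_PiM_cong)
    fix A assume "\<And>j. j \<in> {1..n} \<Longrightarrow> A j \<in> sets (emission (x j))"
    then have A: "\<And>j. j \<in> {1..n} \<Longrightarrow> A j \<in> sets \<mu>" by (simp add: sets_emission)
    have "Y_vec n -` (Pi\<^sub>E {1..n} A) \<inter> space ?U = {\<omega>\<in>space P. \<forall>j\<in>{1..n}. Y j \<omega> \<in> A j}"
      by (auto simp: Y_vec_def PiE_iff)
    then have "emeasure (distr ?U (\<Pi>\<^sub>M j\<in>{1..n}. \<mu>) (Y_vec n)) (Pi\<^sub>E {1..n} A)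
      = ennreal (measure ?U {\<omega>\<in>space P. \<forall>j\<in>{1..n}. Y j \<omega> \<in> A j})"
      using A meas by (subst emeasure_distr) (auto intro!: sets_PiM_I_finite simp: U.emeasure_eq_measure)
    also have "measure ?U {\<omega>\<in>space P. \<forall>j\<in>{1..n}. Y j \<omega> \<in> A j}
      = prob (path_event n x \<inter> {\<omega>\<in>space P. \<forall>j\<in>{1..n}. Y j \<omega> \<in> A j}) / path_prob n x"
    proof -
      have "{\<omega>\<in>space P. \<forall>j\<in>{1..n}. Y j \<omega> \<in> A j} \<in> sets P"
        using measurable_Y A by (intro sets.sets_Collect_finite_All) (auto intro!: measurable_sets_Collect)
      then show ?thesis
        using pos by (subst measure_uniform_measure) (auto simp: em path_prob_def)
    qed
    also have "\<dots> = (\<Prod>j\<in>{1..n}. measure (emission (x j)) (A j))"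
      using prob_path_and_observations[OF x A] pos by simp
    also have "ennreal \<dots> = (\<Prod>j\<in>{1..n}. emeasure (emission (x j)) (A j))"
      using prob_space_emission
      by (simp add: prod_ennreal finite_measure.emeasure_eq_measure prob_space.finite_measure)
    finally show "emeasure (distr ?U (\<Pi>\<^sub>M j\<in>{1..n}. \<mu>) (Y_vec n)) (Pi\<^sub>E {1..n} A)
      = (\<Prod>j\<in>{1..n}. emeasure (emission (x j)) (A j))" .
  qed simp
qed

text \<open>
  The law of the observations is a finite mixture of product measures, indexed by the hidden paths. All
  later estimates are made for one product measure at a time and then averaged.
\<close>

lemma integral_observations:
  assumes F: "F \<in> borel_measurable (\<Pi>\<^sub>M j\<in>{1..n}. \<mu>)"
    and int: "\<And>x. x \<in> paths K n \<Longrightarrow> integrable (\<Pi>\<^sub>M j\<in>{1..n}. emission (x j)) F"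
  shows "(\<integral>\<omega>. F (Y_vec n \<omega>) \<partial>P) = (\<Sum>x\<in>paths K n. path_prob n x * (\<integral>y. F y \<partial>(\<Pi>\<^sub>M j\<in>{1..n}. emission (x j))))"
proof -
  have FY: "(\<lambda>\<omega>. F (Y_vec n \<omega>)) \<in> borel_measurable P"
    using measurable_compose[OF measurable_Y_vec F] .
  have *: "has_bochner_integral P (\<lambda>\<omega>. indicator (path_event n x) \<omega> * F (Y_vec n \<omega>))
      (path_prob n x * (\<integral>y. F y \<partial>(\<Pi>\<^sub>M j\<in>{1..n}. emission (x j))))" if x: "x \<in> paths K n" for x
  proof (cases "path_prob n x = 0")
    case True
    then have "AE \<omega> in P. \<omega> \<notin> path_event n x" by (simp add: path_prob_def AE_iff_measurable[OF path_event_sets] prob_eq_0)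
    then have "AE \<omega> in P. indicator (path_event n x) \<omega> * F (Y_vec n \<omega>) = 0" by eventually_elim auto
    then show ?thesis using FY True
      by (subst has_bochner_integral_cong_AE[where g = "\<lambda>_. 0"]) (auto intro: has_bochner_integral_zero)
  next
    case False
    then have pos: "path_prob n x > 0" using path_prob_nonneg[of n x] by simp
    let ?U = "uniform_measure P (path_event n x)"
    have U: "?U = density P (\<lambda>\<omega>. ennreal (indicator (path_event n x) \<omega> / path_prob n x))"
      unfolding uniform_measure_def
      by (intro density_cong) (use pos in \<open>auto simp: path_prob_def emeasure_eq_measure divide_ennreal indicator_def
         ennreal_1[symmetric] simp del: ennreal_1\<close>)
    note d = distr_observations_given_path[OF x pos]
    have "integrable (distr ?U (\<Pi>\<^sub>M j\<in>{1..n}. \<mu>) (Y_vec n)) F" unfolding d by (rule int[OF x])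
    then have "integrable ?U (\<lambda>\<omega>. F (Y_vec n \<omega>))" using F by (subst (asm) integrable_distr_eq) (auto intro: measurable_Y_vec_uniform[unfolded One_nat_def])
    then have i: "integrable P (\<lambda>\<omega>. indicator (path_event n x) \<omega> / path_prob n x * F (Y_vec n \<omega>))"
      unfolding U using FY pos by (subst (asm) integrable_density) (auto simp: path_prob_nonneg)
    have "(\<integral>y. F y \<partial>(\<Pi>\<^sub>M j\<in>{1..n}. emission (x j))) = (\<integral>\<omega>. F (Y_vec n \<omega>) \<partial>?U)"
      unfolding d[symmetric] using F by (subst integral_distr) (auto intro: measurable_Y_vec_uniform[unfolded One_nat_def])
    also have "\<dots> = (\<integral>\<omega>. indicator (path_event n x) \<omega> / path_prob n x * F (Y_vec n \<omega>) \<partial>P)"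
      unfolding U using FY pos by (subst integral_density) (auto simp: path_prob_nonneg)
    finally have "has_bochner_integral P (\<lambda>\<omega>. indicator (path_event n x) \<omega> / path_prob n x * F (Y_vec n \<omega>))
      (\<integral>y. F y \<partial>(\<Pi>\<^sub>M j\<in>{1..n}. emission (x j)))"
      using i by (simp add: has_bochner_integral_iff)
    from has_bochner_integral_mult_right[OF this, of "path_prob n x"] show ?thesis
      using pos by (simp add: mult.assoc[symmetric])
  qed
  have "has_bochner_integral P (\<lambda>\<omega>. \<Sum>x\<in>paths K n. indicator (path_event n x) \<omega> * F (Y_vec n \<omega>))
     (\<Sum>x\<in>paths K n. path_prob n x * (\<integral>y. F y \<partial>(\<Pi>\<^sub>M j\<in>{1..n}. emission (x j))))"
    by (intro has_bochner_integral_sum *)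
  moreover have "(\<Sum>x\<in>paths K n. indicator (path_event n x) \<omega> * F (Y_vec n \<omega>)) = F (Y_vec n \<omega>)" if "\<omega> \<in> space P" for \<omega>
    using indicator_path_partition[OF that, of n] by (simp add: sum_distrib_right[symmetric])
  ultimately have "has_bochner_integral P (\<lambda>\<omega>. F (Y_vec n \<omega>))
     (\<Sum>x\<in>paths K n. path_prob n x * (\<integral>y. F y \<partial>(\<Pi>\<^sub>M j\<in>{1..n}. emission (x j))))"
    by (subst has_bochner_integral_cong[OF refl _ refl]) auto
  then show ?thesis by (rule has_bochner_integral_integral_eq)
qed

lemma prob_observations:
  assumes B: "B \<in> sets (\<Pi>\<^sub>M j\<in>{1..n}. \<mu>)"
  shows "prob {\<omega>\<in>space P. Y_vec n \<omega> \<in> B} = (\<Sum>x\<in>paths K n. path_prob n x * measure (\<Pi>\<^sub>M j\<in>{1..n}. emission (x j)) B)"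
proof -
  have sets: "sets (\<Pi>\<^sub>M j\<in>{1..n}. emission (x j)) = sets (\<Pi>\<^sub>M j\<in>{1..n}. \<mu>)" for x :: "nat \<Rightarrow> nat"
    by (simp add: sets_emission cong: sets_PiM_cong)
  have "prob {\<omega>\<in>space P. Y_vec n \<omega> \<in> B} = (\<integral>\<omega>. indicator {\<omega>\<in>space P. Y_vec n \<omega> \<in> B} \<omega> \<partial>P)"
    by (simp add: Int_absorb2)
  also have "\<dots> = (\<integral>\<omega>. indicator B (Y_vec n \<omega>) \<partial>P)"
    by (intro Bochner_Integration.integral_cong) (auto simp: indicator_def)
  also have "\<dots> = (\<Sum>x\<in>paths K n. path_prob n x * (\<integral>y. indicator B y \<partial>(\<Pi>\<^sub>M j\<in>{1..n}. emission (x j))))"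
  proof (rule integral_observations)
    fix x
    interpret pe: finite_product_prob_space "\<lambda>j. emission (x j)" "{1..n}"
      by (rule finite_product_prob_space_emission) simp
    show "integrable (\<Pi>\<^sub>M j\<in>{1..n}. emission (x j)) (indicator B :: _ \<Rightarrow> real)"
      using B sets pe.P.emeasure_finite by (intro integrable_real_indicator) (auto simp: less_top[symmetric])
  qed (use B in simp)
  also have "\<dots> = (\<Sum>x\<in>paths K n. path_prob n x * measure (\<Pi>\<^sub>M j\<in>{1..n}. emission (x j)) B)"
    using B sets by simp
  finally show ?thesis .
qed

end

section \<open>Hoeffding and Azuma inequalities\<close>

lemma hoeffding_lemma_finite:
  fixes q d :: "nat \<Rightarrow> real"
  assumes q: "\<And>j. j < K \<Longrightarrow> 0 \<le> q j" "(\<Sum>j<K. q j) = 1"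
    and d: "\<And>j. j < K \<Longrightarrow> \<bar>d j\<bar> \<le> c" "(\<Sum>j<K. q j * d j) = 0" and l: "l > 0"
  shows "(\<Sum>j<K. q j * exp (l * d j)) \<le> exp (l\<^sup>2 * c\<^sup>2 / 2)"
proof -
  define N where "N = point_measure {..<K} (\<lambda>j. ennreal (q j))"
  have N: "prob_space N"
    unfolding N_def
  proof (rule prob_space_point_measure)
    show "(\<Sum>j<K. ennreal (q j)) = 1" using q by (subst sum_ennreal) auto
  qed auto
  interpret interval_bounded_random_variable N d "- c" c
  proof (intro interval_bounded_random_variable.intro N interval_bounded_random_variable_axioms.intro)
    show "d \<in> borel_measurable N" by (simp add: N_def)
    show "AE x in N. d x \<in> {- c..c}"
      unfolding N_def using d(1) by (subst AE_point_measure) (auto simp: abs_le_iff minus_le_iff)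
  qed
  have "expectation d = 0"
    unfolding N_def using q d by (subst lebesgue_integral_point_measure_finite) (auto simp: mult.commute)
  from Hoeffdings_lemma_nn_integral_0[OF l this]
  have "(\<Sum>j<K. ennreal (q j) * ennreal (exp (l * d j))) \<le> ennreal (exp (l\<^sup>2 * (c - - c)\<^sup>2 / 8))"
    unfolding N_def by (subst (asm) nn_integral_point_measure_finite) (auto simp: mult.commute)
  also have "(\<Sum>j<K. ennreal (q j) * ennreal (exp (l * d j))) = ennreal (\<Sum>j<K. q j * exp (l * d j))"
    using q by (subst sum_ennreal[symmetric]) (auto simp: ennreal_mult intro!: sum.cong)
  finally have "(\<Sum>j<K. q j * exp (l * d j)) \<le> exp (l\<^sup>2 * (c - - c)\<^sup>2 / 8)" by simp
  also have "l\<^sup>2 * (c - - c)\<^sup>2 / 8 = l\<^sup>2 * c\<^sup>2 / 2" by (simp add: power2_eq_square algebra_simps)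
  finally show ?thesis .
qed

lemma sum_paths_Suc:
  fixes G :: "(nat \<Rightarrow> nat) \<Rightarrow> real"
  shows "(\<Sum>x\<in>paths K (Suc m). G x) = (\<Sum>x\<in>paths K m. \<Sum>k<K. G (x(Suc m := k)))"
proof -
  have ins: "{1..Suc m} = insert (Suc m) {1..m}" by auto
  have "(\<Sum>x\<in>paths K (Suc m). G x) = (\<Sum>z\<in>{..<K} \<times> paths K m. G (case z of (k, x) \<Rightarrow> x(Suc m := k)))"
    unfolding ins PiE_insert_eq by (subst sum.reindex[OF inj_combinator]) auto
  also have "\<dots> = (\<Sum>k<K. \<Sum>x\<in>paths K m. G (x(Suc m := k)))"
    by (simp add: sum.cartesian_product case_prod_unfold)
  finally show ?thesis by (simp add: sum.swap[of _ "{..<K}"])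
qed

context hmm
begin

text \<open>
  The differences \<open>D\<close> are centred given the past, so each step multiplies the exponential moment by at
  most the factor of Hoeffding's lemma. The expectation is written as a sum over paths, and the induction
  splits off the last state.
\<close>

lemma azuma_exponential_moment:
  assumes D: "\<And>i j. i < K \<Longrightarrow> j < K \<Longrightarrow> \<bar>D i j\<bar> \<le> c" "\<And>i. i < K \<Longrightarrow> (\<Sum>j<K. Q $$ (i, j) * D i j) = 0"
    and l: "l > 0"
  shows "(\<Sum>x\<in>paths K (Suc n). path_prob (Suc n) x * exp (l * (\<Sum>s=1..n. D (x s) (x (Suc s))))) \<le> exp (real n * (l\<^sup>2 * c\<^sup>2 / 2))"
proof (induction n)
  case 0
  show ?case using sum_path_prob[of 1] by simp
next
  case (Suc n)
  define S where "S = (\<lambda>x :: nat \<Rightarrow> nat. \<Sum>s=1..n. D (x s) (x (Suc s)))"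
  have step: "(\<Sum>k<K. path_prob (Suc (Suc n)) (x(Suc (Suc n) := k)) *
        exp (l * (\<Sum>s=1..Suc n. D ((x(Suc (Suc n) := k)) s) ((x(Suc (Suc n) := k)) (Suc s)))))
      \<le> path_prob (Suc n) x * exp (l * S x) * exp (l\<^sup>2 * c\<^sup>2 / 2)" if x: "x \<in> paths K (Suc n)" for x
  proof -
    have i: "x (Suc n) < K" using x by (auto simp: PiE_iff)
    have "path_prob (Suc (Suc n)) (x(Suc (Suc n) := k)) *
        exp (l * (\<Sum>s=1..Suc n. D ((x(Suc (Suc n) := k)) s) ((x(Suc (Suc n) := k)) (Suc s))))
      = path_prob (Suc n) x * exp (l * S x) * (Q $$ (x (Suc n), k) * exp (l * D (x (Suc n)) k))"
      if k: "k < K" for k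
    proof -
      have "path_prob (Suc (Suc n)) (x(Suc (Suc n) := k)) = path_prob (Suc n) x * Q $$ (x (Suc n), k)"
        using path_prob_Suc[of "Suc n" "x(Suc (Suc n) := k)"] k path_prob_cong[of "Suc n" "x(Suc (Suc n) := k)" x]
        by simp
      moreover have "(\<Sum>s=1..Suc n. D ((x(Suc (Suc n) := k)) s) ((x(Suc (Suc n) := k)) (Suc s)))
        = S x + D (x (Suc n)) k"
        by (simp add: S_def)
      ultimately show ?thesis by (simp add: distrib_left exp_add mult_ac)
    qed
    then have "(\<Sum>k<K. path_prob (Suc (Suc n)) (x(Suc (Suc n) := k)) *
        exp (l * (\<Sum>s=1..Suc n. D ((x(Suc (Suc n) := k)) s) ((x(Suc (Suc n) := k)) (Suc s)))))
      = path_prob (Suc n) x * exp (l * S x) * (\<Sum>k<K. Q $$ (x (Suc n), k) * exp (l * D (x (Suc n)) k))"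
      by (simp add: sum_distrib_left)
    also have "\<dots> \<le> path_prob (Suc n) x * exp (l * S x) * exp (l\<^sup>2 * c\<^sup>2 / 2)"
      using i D l stochastic path_prob_nonneg
      by (intro mult_left_mono hoeffding_lemma_finite) (auto simp: stochastic_matrix_def)
    finally show ?thesis .
  qed
  have "(\<Sum>x\<in>paths K (Suc (Suc n)). path_prob (Suc (Suc n)) x * exp (l * (\<Sum>s=1..Suc n. D (x s) (x (Suc s)))))
    \<le> (\<Sum>x\<in>paths K (Suc n). path_prob (Suc n) x * exp (l * S x) * exp (l\<^sup>2 * c\<^sup>2 / 2))"
    unfolding sum_paths_Suc[where m = "Suc n"] by (intro sum_mono step)
  also have "\<dots> \<le> exp (real n * (l\<^sup>2 * c\<^sup>2 / 2)) * exp (l\<^sup>2 * c\<^sup>2 / 2)"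
    unfolding sum_distrib_right[symmetric] using Suc.IH by (intro mult_right_mono) (auto simp: S_def)
  also have "\<dots> = exp (real (Suc n) * (l\<^sup>2 * c\<^sup>2 / 2))" by (simp add: exp_add[symmetric] algebra_simps)
  finally show ?case .
qed

lemma azuma_one_sided:
  assumes D: "\<And>i j. i < K \<Longrightarrow> j < K \<Longrightarrow> \<bar>D i j\<bar> \<le> c" "\<And>i. i < K \<Longrightarrow> (\<Sum>j<K. Q $$ (i, j) * D i j) = 0"
    and c: "c > 0" and u: "u > 0" and n: "n \<ge> 1"
  shows "(\<Sum>x\<in>paths K (Suc n). path_prob (Suc n) x * of_bool ((\<Sum>s=1..n. D (x s) (x (Suc s))) \<ge> u))
    \<le> exp (- u\<^sup>2 / (2 * real n * c\<^sup>2))"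
proof -
  \<comment> \<open>This value minimizes the Chernoff bound \<open>exp (n * l\<^sup>2 * c\<^sup>2 / 2 - l * u)\<close>.\<close>
  define l where "l = u / (real n * c\<^sup>2)"
  have l: "l > 0" using u n c by (simp add: l_def)
  have "(\<Sum>x\<in>paths K (Suc n). path_prob (Suc n) x * of_bool ((\<Sum>s=1..n. D (x s) (x (Suc s))) \<ge> u))
    \<le> (\<Sum>x\<in>paths K (Suc n). path_prob (Suc n) x * exp (l * (\<Sum>s=1..n. D (x s) (x (Suc s)))) * exp (- l * u))"
    unfolding mult.assoc exp_add[symmetric] using l path_prob_nonneg
    by (intro sum_mono mult_left_mono) (auto simp: right_diff_distrib[symmetric] simp flip: right_diff_distrib)
  also have "\<dots> \<le> exp (real n * (l\<^sup>2 * c\<^sup>2 / 2)) * exp (- l * u)"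
    unfolding sum_distrib_right[symmetric]
    by (intro mult_right_mono azuma_exponential_moment D l) auto
  also have "\<dots> = exp (- u\<^sup>2 / (2 * real n * c\<^sup>2))"
    unfolding exp_add[symmetric] l_def using n c by (simp add: field_simps power2_eq_square)
  finally show ?thesis .
qed

lemma azuma_two_sided:
  assumes D: "\<And>i j. i < K \<Longrightarrow> j < K \<Longrightarrow> \<bar>D i j\<bar> \<le> c" "\<And>i. i < K \<Longrightarrow> (\<Sum>j<K. Q $$ (i, j) * D i j) = 0"
    and c: "c > 0" and u: "u > 0" and n: "n \<ge> 1"
  shows "(\<Sum>x\<in>paths K (Suc n). path_prob (Suc n) x * of_bool (\<bar>\<Sum>s=1..n. D (x s) (x (Suc s))\<bar> \<ge> u))
    \<le> 2 * exp (- u\<^sup>2 / (2 * real n * c\<^sup>2))"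
proof -
  have "(\<Sum>x\<in>paths K (Suc n). path_prob (Suc n) x * of_bool (\<bar>\<Sum>s=1..n. D (x s) (x (Suc s))\<bar> \<ge> u))
    \<le> (\<Sum>x\<in>paths K (Suc n). path_prob (Suc n) x * of_bool ((\<Sum>s=1..n. D (x s) (x (Suc s))) \<ge> u)
        + path_prob (Suc n) x * of_bool ((\<Sum>s=1..n. - D (x s) (x (Suc s))) \<ge> u))"
    using path_prob_nonneg by (intro sum_mono) (auto simp: sum_negf abs_if split: if_splits)
  also have "\<dots> \<le> exp (- u\<^sup>2 / (2 * real n * c\<^sup>2)) + exp (- u\<^sup>2 / (2 * real n * c\<^sup>2))"
    unfolding sum.distrib
    by (intro add_mono azuma_one_sided) (use assms in \<open>auto simp: sum_negf\<close>)
  finally show ?thesis by simp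
qed

end

lemma (in product_prob_space) indep_vars_coordinates:
  "prob_space.indep_vars (PiM I M) M (\<lambda>i y. y i) I"
proof (cases "I = {}")
  case True
  have "P.indep_vars M (\<lambda>i y. y i) {}" unfolding P.indep_vars_def P.indep_sets_def by auto
  then show ?thesis by (simp only: True)
next
  case False
  have "distr (PiM I M) (PiM I M) (\<lambda>y. \<lambda>i\<in>I. y i) = PiM I M"
    by (subst distr_cong[OF refl refl, of _ _ "\<lambda>y. y"]) (auto simp: space_PiM distr_id)
  moreover have "(\<Pi>\<^sub>M i\<in>I. distr (PiM I M) (M i) (\<lambda>y. y i)) = PiM I M"
    using prob_space by (intro PiM_cong refl distr_PiM_component) auto
  ultimately show ?thesis using False by (subst P.indep_vars_iff_distr_eq_PiM') auto
qed

lemma (in product_prob_space) integral_product_two_coordinates: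
  fixes u v :: "'a \<Rightarrow> real"
  assumes ij: "i \<in> I" "j \<in> I" "i \<noteq> j" and u: "integrable (M i) u" and v: "integrable (M j) v"
  shows "integrable (PiM I M) (\<lambda>y. u (y i) * v (y j))"
    "(\<integral>y. u (y i) * v (y j) \<partial>PiM I M) = (\<integral>y. u y \<partial>M i) * (\<integral>y. v y \<partial>M j)"
proof -
  define w where "w = (\<lambda>k. if k = i then u else v)"
  have w: "w k \<in> borel_measurable (M k)" if "k \<in> {i, j}" for k
    using that u v ij by (auto simp: w_def)
  have "P.indep_vars M (\<lambda>i y. y i) {i, j}"
    using P.indep_vars_subset[OF indep_vars_coordinates] ij by auto
  then have ind: "P.indep_vars (\<lambda>_. borel) (\<lambda>k y. w k (y k)) {i, j}"
    by (rule P.indep_vars_compose2) (rule w)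
  have dc: "distr (PiM I M) (M k) (\<lambda>y. y k) = M k" if "k \<in> I" for k
    using prob_space that by (intro distr_PiM_component) auto
  have int: "integrable (PiM I M) (\<lambda>y. w k (y k))" "(\<integral>y. w k (y k) \<partial>PiM I M) = (\<integral>y. w k y \<partial>M k)"
    if k: "k \<in> {i, j}" for k
  proof -
    have kI: "k \<in> I" using k ij by auto
    have wk: "integrable (M k) (w k)" using k u v ij by (auto simp: w_def)
    have "integrable (distr (PiM I M) (M k) (\<lambda>y. y k)) (w k)" using wk by (simp only: dc[OF kI])
    then show "integrable (PiM I M) (\<lambda>y. w k (y k))"
      by (rule integrable_distr[rotated]) (use kI in simp)
    have "(\<integral>y. w k y \<partial>distr (PiM I M) (M k) (\<lambda>y. y k)) = (\<integral>y. w k (y k) \<partial>PiM I M)"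
      using kI w[OF k] by (intro integral_distr) auto
    then show "(\<integral>y. w k (y k) \<partial>PiM I M) = (\<integral>y. w k y \<partial>M k)" by (simp only: dc[OF kI])
  qed
  have prod: "(\<Prod>k\<in>{i, j}. w k (y k)) = u (y i) * v (y j)" for y
    using ij by (simp add: w_def)
  show "integrable (PiM I M) (\<lambda>y. u (y i) * v (y j))"
    using P.indep_vars_integrable[OF _ ind int(1)] by (simp add: prod)
  show "(\<integral>y. u (y i) * v (y j) \<partial>PiM I M) = (\<integral>y. u y \<partial>M i) * (\<integral>y. v y \<partial>M j)"
    using P.indep_vars_lebesgue_integral[OF _ ind int(1)] int(2)[of i] int(2)[of j] ij
    by (simp add: prod) (simp add: w_def)
qed

text \<open>
  If \<open>S\<close> contains no two consecutive numbers, the index pairs \<open>{s, Suc s}\<close> are disjoint, so that the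
  products over them are independent.
\<close>

lemma hoeffding_consecutive_products:
  fixes u v :: "'a \<Rightarrow> real" and M :: "nat \<Rightarrow> 'a measure" and n :: nat
  defines "I \<equiv> {1..Suc n}"
  assumes M: "\<And>i. prob_space (M i)" and S: "S \<subseteq> {1..n}" and nocons: "\<And>s. s \<in> S \<Longrightarrow> Suc s \<notin> S"
    and u: "\<And>i. u \<in> borel_measurable (M i)" "\<And>i. AE y in M i. \<bar>u y\<bar> \<le> B"
    and v: "\<And>i. v \<in> borel_measurable (M i)" "\<And>i. AE y in M i. \<bar>v y\<bar> \<le> B"
    and B: "B > 0" and e: "e > 0" and n: "n \<ge> 1"
  shows "measure (PiM I M) {y \<in> space (PiM I M).
      \<bar>\<Sum>s\<in>S. u (y s) * v (y (Suc s)) - (\<integral>y. u y \<partial>M s) * (\<integral>y. v y \<partial>M (Suc s))\<bar> \<ge> e}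
    \<le> 2 * exp (- e\<^sup>2 / (2 * real n * B ^ 4))"
proof (cases "S = {}")
  case True
  then have "{y \<in> space (PiM I M).
      \<bar>\<Sum>s\<in>S. u (y s) * v (y (Suc s)) - (\<integral>y. u y \<partial>M s) * (\<integral>y. v y \<partial>M (Suc s))\<bar> \<ge> e} = {}"
    using e by simp
  then show ?thesis by (simp only: measure_empty) simp
next
  case False
  note I = I_def
  interpret product_prob_space M I
    using M by (simp add: product_prob_space_def product_prob_space_axioms_def product_sigma_finite_def
        prob_space_imp_sigma_finite)
  have fin: "finite S" using S finite_subset by blast
  define W where "W = (\<lambda>s y. u (y s) * v (y (Suc s)))"
  have iu: "integrable (M i) u" and iv: "integrable (M i) v" for i
    using u v by (auto intro!: M.integrable_const_bound[of _ B])
  have EW: "(\<integral>y. W s y \<partial>PiM I M) = (\<integral>y. u y \<partial>M s) * (\<integral>y. v y \<partial>M (Suc s))" if "s \<in> S" for s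
    unfolding W_def using that S I by (intro integral_product_two_coordinates iu iv) auto
  have "P.indep_vars (\<lambda>s. PiM {s, Suc s} M) (\<lambda>s y. restrict (\<lambda>i. y i) {s, Suc s}) S"
    by (rule P.indep_vars_restrict[OF indep_vars_coordinates])
      (use S I nocons in \<open>auto simp: disjoint_family_on_def\<close>)
  then have "P.indep_vars (\<lambda>_. borel) (\<lambda>s y. W s (restrict (\<lambda>i. y i) {s, Suc s})) S"
    by (rule P.indep_vars_compose2) (use u v in \<open>simp add: W_def\<close>)
  then have ind: "P.indep_vars (\<lambda>_. borel) W S"
    by (simp add: W_def)
  have bound: "AE y in PiM I M. W s y \<in> {- B\<^sup>2..B\<^sup>2}" if s: "s \<in> S" for s
  proof -
    have "AE y in PiM I M. \<bar>u (y s)\<bar> \<le> B"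
      using u s S I prob_space by (intro AE_PiM_component) auto
    moreover have "AE y in PiM I M. \<bar>v (y (Suc s))\<bar> \<le> B"
      using v s S I prob_space by (intro AE_PiM_component) auto
    ultimately show ?thesis
    proof eventually_elim
      case (elim y)
      then have "\<bar>W s y\<bar> \<le> B * B" using B unfolding W_def abs_mult by (intro mult_mono) auto
      then show ?case by (auto simp: power2_eq_square)
    qed
  qed
  interpret Hoeffding_ineq "PiM I M" S W "\<lambda>_. - B\<^sup>2" "\<lambda>_. B\<^sup>2" "\<Sum>s\<in>S. P.expectation (W s)"
    by unfold_locales (use fin ind bound in auto)
  have sq: "(\<Sum>s\<in>S. (B\<^sup>2 - - B\<^sup>2)\<^sup>2) = 4 * real (card S) * B ^ 4"
    by (simp add: power2_eq_square power4_eq_xxxx algebra_simps)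
  have cS: "card S > 0" "card S \<le> n" using False fin S card_mono[of "{1..n}" S] by (auto simp: card_gt_0_iff)
  have "measure (PiM I M) {y \<in> space (PiM I M). \<bar>(\<Sum>s\<in>S. W s y) - (\<Sum>s\<in>S. P.expectation (W s))\<bar> \<ge> e}
    \<le> 2 * exp (- 2 * e\<^sup>2 / (\<Sum>s\<in>S. (B\<^sup>2 - - B\<^sup>2)\<^sup>2))"
    by (rule Hoeffding_ineq_abs_ge) (use e B cS in \<open>simp_all only: sq, simp_all\<close>)
  also have "\<dots> \<le> 2 * exp (- e\<^sup>2 / (2 * real n * B ^ 4))"
  proof -
    have "e\<^sup>2 / (2 * real n * B ^ 4) \<le> e\<^sup>2 / (2 * real (card S) * B ^ 4)"
      using cS B by (intro divide_left_mono mult_right_mono) auto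
    moreover have "- 2 * e\<^sup>2 / (\<Sum>s\<in>S. (B\<^sup>2 - - B\<^sup>2)\<^sup>2) = - (e\<^sup>2 / (2 * real (card S) * B ^ 4))"
      unfolding sq using cS B by (simp add: field_simps)
    ultimately show ?thesis by simp
  qed
  finally show ?thesis by (simp add: W_def EW[unfolded W_def] sum_subtractf)
qed

section \<open>Concentration of sums over consecutive observations\<close>

locale stationary_hmm = hmm \<mu> P X Y K \<pi> Q f
  for \<mu> :: "'y measure" and P :: "'w measure" and X Y K \<pi> Q f +
  assumes stationary: "stationary_distribution \<pi> Q" and ergodic: "ergodic_matrix K Q"
begin

lemma pi_eq_prob: "k < K \<Longrightarrow> \<pi> $ k = prob {\<omega> \<in> space P. X 1 \<omega> = k}"
  using chain by (simp add: markov_chain_def)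

lemma pi_nonneg: "k < K \<Longrightarrow> 0 \<le> \<pi> $ k"
  by (simp add: pi_eq_prob)

lemma sum_pi: "(\<Sum>k<K. \<pi> $ k) = 1"
proof -
  \<comment> \<open>Paths are undefined outside their index set, so these are all paths of length one.\<close>
  have "(\<Sum>k<K. \<pi> $ k) = (\<Sum>k<K. path_prob 1 ((\<lambda>_. undefined)(Suc 0 := k)))"
    using path_prob_1[of "(\<lambda>_. undefined)(Suc 0 := _)"] by (intro sum.cong) auto
  also have "\<dots> = (\<Sum>x\<in>paths K (Suc 0). path_prob 1 x)"
    by (subst sum_paths_Suc) (simp add: fun_upd_def)
  finally show ?thesis using sum_path_prob[of "Suc 0"] by simp
qed

lemmas pi_facts = pi_carrier stationary sum_pi pi_nonneg
lemmas chain_facts = stochastic ergodic K_pos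

text \<open>
  Only the first two hidden states matter, and their joint law is \<open>\<pi> i * Q (i, j)\<close>.
\<close>

lemma mean_consecutive_product:
  assumes u: "u \<in> borel_measurable \<mu>" "\<And>k. k < K \<Longrightarrow> integrable (emission k) u"
    and v: "v \<in> borel_measurable \<mu>" "\<And>k. k < K \<Longrightarrow> integrable (emission k) v"
  shows "(\<integral>\<omega>. u (Y 1 \<omega>) * v (Y 2 \<omega>) \<partial>P)
    = (\<Sum>i<K. \<Sum>j<K. \<pi> $ i * Q $$ (i, j) * ((\<integral>y. u y \<partial>emission i) * (\<integral>y. v y \<partial>emission j)))"
proof -
  let ?F = "\<lambda>y :: nat \<Rightarrow> 'y. u (y 1) * v (y 2)"
  have F: "integrable (\<Pi>\<^sub>M j\<in>{1..2}. emission (x j)) ?F"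
    "(\<integral>y. ?F y \<partial>(\<Pi>\<^sub>M j\<in>{1..2}. emission (x j))) = (\<integral>y. u y \<partial>emission (x 1)) * (\<integral>y. v y \<partial>emission (x 2))"
    if "x 1 < K" "x 2 < K" for x
  proof -
    interpret product_prob_space "\<lambda>j. emission (x j)" "{1..2}" by (rule product_prob_space_emission)
    show "integrable (\<Pi>\<^sub>M j\<in>{1..2}. emission (x j)) ?F"
      "(\<integral>y. ?F y \<partial>(\<Pi>\<^sub>M j\<in>{1..2}. emission (x j))) = (\<integral>y. u y \<partial>emission (x 1)) * (\<integral>y. v y \<partial>emission (x 2))"
      by (rule integral_product_two_coordinates; use u v that in simp)+
  qed
  have "(\<integral>\<omega>. u (Y 1 \<omega>) * v (Y 2 \<omega>) \<partial>P) = (\<integral>\<omega>. ?F (Y_vec 2 \<omega>) \<partial>P)"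
    by (simp add: Y_vec_def)
  also have "\<dots> = (\<Sum>x\<in>paths K 2. path_prob 2 x * (\<integral>y. ?F y \<partial>(\<Pi>\<^sub>M j\<in>{1..2}. emission (x j))))"
  proof (rule integral_observations)
    show "?F \<in> borel_measurable (\<Pi>\<^sub>M j\<in>{1..2}. \<mu>)" using u v by simp
    show "integrable (\<Pi>\<^sub>M j\<in>{1..2}. emission (x j)) ?F" if "x \<in> paths K 2" for x
      using that by (intro F) (auto simp: PiE_iff)
  qed
  also have "\<dots> = (\<Sum>x\<in>paths K 2. path_prob 2 x * ((\<integral>y. u y \<partial>emission (x 1)) * (\<integral>y. v y \<partial>emission (x 2))))"
    by (intro sum.cong refl arg_cong2[of _ _ _ _ "(*)"] F) (auto simp: PiE_iff)
  also have "\<dots> = (\<Sum>i<K. \<Sum>j<K. \<pi> $ i * Q $$ (i, j) * ((\<integral>y. u y \<partial>emission i) * (\<integral>y. v y \<partial>emission j)))"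
  proof -
    have two: "2 = Suc (Suc 0)" by simp
    have pp: "path_prob (Suc (Suc 0)) (z(Suc 0 := i, Suc (Suc 0) := j)) = \<pi> $ i * Q $$ (i, j)"
      if "i < K" "j < K" for z i j
      using path_prob_Suc[of "Suc 0" "z(Suc 0 := i, Suc (Suc 0) := j)"] path_prob_1[of "z(Suc 0 := i, Suc (Suc 0) := j)"] that
      by simp
    show ?thesis
      unfolding two by (subst sum_paths_Suc, subst sum_paths_Suc) (simp add: pp)
  qed
  finally show ?thesis .
qed

text \<open>
  The deviation is split into four parts, each at most \<open>e / 4\<close> outside a small event. Given the hidden
  path, the sum is centred at the sum of \<open>g (X s) (X (s + 1))\<close>, and its deviation from it is treated for odd
  and for even \<open>s\<close> separately with Hoeffding's inequality. For the sum of the \<open>g\<close> let \<open>h\<close> solve the Poisson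
  equation \<open>h - Q h = gb - m\<close>, where \<open>gb\<close> is the conditional mean of \<open>g\<close> given its first argument and
  \<open>m\<close> the stationary mean. Then \<open>g i j - m = D i j + h i - h j\<close> with martingale differences \<open>D\<close>, so the sum
  consists of a martingale, to which Azuma's inequality applies, and of the telescoping boundary term
  \<open>h (X 1) - h (X (n + 1))\<close>, which \<open>4 * c \<le> e\<close> makes small. The constant \<open>c\<close> bounds \<open>D\<close>.
\<close>

lemma concentration_consecutive_products:
  fixes u v :: "'y \<Rightarrow> real"
  assumes u: "u \<in> borel_measurable \<mu>" "AE y in \<mu>. \<bar>u y\<bar> \<le> B"
    and v: "v \<in> borel_measurable \<mu>" "AE y in \<mu>. \<bar>v y\<bar> \<le> B" and B: "B > 0"
  defines "c \<equiv> 2 * B\<^sup>2 + 4 * B\<^sup>2 * (\<Sum>i<K. \<Sum>j<K. \<bar>fundamental_matrix K Q $$ (i, j)\<bar>)"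
  assumes n: "n \<ge> 1" and e: "e > 0" "4 * c \<le> e"
  shows "prob {\<omega> \<in> space P. \<bar>(\<Sum>s=1..n. u (Y s \<omega>) * v (Y (Suc s) \<omega>)) - real n * (\<integral>\<omega>. u (Y 1 \<omega>) * v (Y 2 \<omega>) \<partial>P)\<bar> \<ge> e}
    \<le> 6 * exp (- e\<^sup>2 / (32 * real n * c\<^sup>2))"
proof -
  let ?Z = "fundamental_matrix K Q"
  define \<zeta> where "\<zeta> = (\<Sum>i<K. \<Sum>j<K. \<bar>?Z $$ (i, j)\<bar>)"
  have \<zeta>: "\<zeta> \<ge> 0" unfolding \<zeta>_def by (intro sum_nonneg) auto
  have c: "c = 2 * B\<^sup>2 + 4 * B\<^sup>2 * \<zeta>" by (simp add: c_def \<zeta>_def)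
  have cB: "c \<ge> 2 * B\<^sup>2" "c \<ge> 4 * B\<^sup>2 * \<zeta>" "c > 0"
    using \<zeta> B by (auto simp: c add_pos_nonneg)
  define ou where "ou = (\<lambda>i. \<integral>y. u y \<partial>emission i)"
  define ov where "ov = (\<lambda>i. \<integral>y. v y \<partial>emission i)"
  have bounded: "integrable (emission i) w" "\<bar>\<integral>y. w y \<partial>emission i\<bar> \<le> B"
    if w: "w \<in> borel_measurable \<mu>" "AE y in \<mu>. \<bar>w y\<bar> \<le> B" for w and i
  proof -
    interpret em: prob_space "emission i" by (rule prob_space_emission)
    have m: "w \<in> borel_measurable (emission i)" using w by (simp add: measurable_cong_sets[OF sets_emission refl])
    show int: "integrable (emission i) w"
      using AE_emission[OF w(2)] m by (intro em.integrable_const_bound[of _ B]) auto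
    have "\<bar>\<integral>y. w y \<partial>emission i\<bar> \<le> (\<integral>y. \<bar>w y\<bar> \<partial>emission i)" by (rule integral_abs_bound)
    also have "\<dots> \<le> (\<integral>y. B \<partial>emission i)" using int AE_emission[OF w(2)] by (intro integral_mono_AE) auto
    finally show "\<bar>\<integral>y. w y \<partial>emission i\<bar> \<le> B" by (simp add: em.prob_space)
  qed
  define g where "g = (\<lambda>i j. ou i * ov j)"
  have g: "\<bar>g i j\<bar> \<le> B\<^sup>2" for i j
    using bounded(2)[OF u] bounded(2)[OF v] B unfolding g_def ou_def ov_def abs_mult power2_eq_square
    by (intro mult_mono) auto
  define gb where "gb = (\<lambda>i. \<Sum>j<K. Q $$ (i, j) * g i j)"
  have Qnn: "\<And>i j. i < K \<Longrightarrow> j < K \<Longrightarrow> 0 \<le> Q $$ (i, j)" and Qrs: "\<And>i. i < K \<Longrightarrow> (\<Sum>j<K. Q $$ (i, j)) = 1"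
    using stochastic by (auto simp: stochastic_matrix_def)
  have average: "\<bar>\<Sum>j<K. p j * w j\<bar> \<le> b"
    if "\<And>j. j < K \<Longrightarrow> 0 \<le> p j" "(\<Sum>j<K. p j) = 1" "\<And>j. j < K \<Longrightarrow> \<bar>w j\<bar> \<le> b" for p w and b :: real
  proof -
    have "\<bar>\<Sum>j<K. p j * w j\<bar> \<le> (\<Sum>j<K. p j * b)"
      using that by (intro order.trans[OF sum_abs] sum_mono) (auto simp: abs_mult intro!: mult_left_mono)
    then show ?thesis using that by (simp add: sum_distrib_right[symmetric])
  qed
  have gb: "\<bar>gb i\<bar> \<le> B\<^sup>2" if "i < K" for i
    unfolding gb_def by (rule average) (use Qnn Qrs that g in auto)
  define m where "m = (\<Sum>i<K. \<pi> $ i * gb i)"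
  have m: "\<bar>m\<bar> \<le> B\<^sup>2"
    unfolding m_def by (rule average) (use pi_nonneg sum_pi gb in auto)
  have mean: "(\<integral>\<omega>. u (Y 1 \<omega>) * v (Y 2 \<omega>) \<partial>P) = m"
    using bounded(1)[OF u] bounded(1)[OF v] u v
    by (subst mean_consecutive_product)
      (auto simp: m_def gb_def g_def ou_def ov_def sum_distrib_left mult.assoc)
  define h where "h = (\<lambda>i. \<Sum>j<K. ?Z $$ (i, j) * (gb j - m))"
  have h: "\<bar>h i\<bar> \<le> 2 * B\<^sup>2 * \<zeta>" if i: "i < K" for i
  proof -
    have "\<bar>h i\<bar> \<le> (\<Sum>j<K. \<bar>?Z $$ (i, j)\<bar> * (2 * B\<^sup>2))"
      unfolding h_def
    proof (intro order.trans[OF sum_abs] sum_mono)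
      fix j assume "j \<in> {..<K}"
      then have "\<bar>gb j - m\<bar> \<le> 2 * B\<^sup>2" using gb[of j] m by auto
      then show "\<bar>?Z $$ (i, j) * (gb j - m)\<bar> \<le> \<bar>?Z $$ (i, j)\<bar> * (2 * B\<^sup>2)"
        unfolding abs_mult by (intro mult_left_mono) auto
    qed
    also have "\<dots> = 2 * B\<^sup>2 * (\<Sum>j<K. \<bar>?Z $$ (i, j)\<bar>)"
      by (simp add: sum_distrib_right[symmetric] mult.commute)
    also have "\<dots> \<le> 2 * B\<^sup>2 * \<zeta>"
      unfolding \<zeta>_def using i by (intro mult_left_mono member_le_sum[of i]) (auto intro: sum_nonneg)
    finally show ?thesis .
  qed
  have poisson: "h i - (\<Sum>j<K. Q $$ (i, j) * h j) = gb i - m" if "i < K" for i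
    unfolding h_def using that sum_pi
    by (intro poisson_equation[OF chain_facts pi_facts])
      (auto simp: right_diff_distrib sum_subtractf m_def sum_distrib_right[symmetric])
  define D where "D = (\<lambda>i j. g i j - gb i + h j - (\<Sum>k<K. Q $$ (i, k) * h k))"
  have D: "\<bar>D i j\<bar> \<le> c" if ij: "i < K" "j < K" for i j
  proof -
    have "\<bar>\<Sum>k<K. Q $$ (i, k) * h k\<bar> \<le> 2 * B\<^sup>2 * \<zeta>"
      by (rule average) (use Qnn Qrs ij h in auto)
    then show ?thesis using g[of i j] gb[of i] h[of j] ij unfolding D_def c by linarith
  qed
  have D0: "(\<Sum>j<K. Q $$ (i, j) * D i j) = 0" if i: "i < K" for i
  proof -
    have "(\<Sum>j<K. Q $$ (i, j) * D i j) = (\<Sum>j<K. Q $$ (i, j) * g i j) - (\<Sum>j<K. Q $$ (i, j)) * gb i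
      + (\<Sum>j<K. Q $$ (i, j) * h j) - (\<Sum>j<K. Q $$ (i, j)) * (\<Sum>k<K. Q $$ (i, k) * h k)"
      unfolding sum_distrib_right sum_subtractf[symmetric] sum.distrib[symmetric]
      by (intro sum.cong) (auto simp: D_def algebra_simps sum_distrib_left)
    then show ?thesis using Qrs[OF i] by (simp add: gb_def)
  qed
  have telescope: "(\<Sum>s=1..k. g (x s) (x (Suc s))) - real k * m = (\<Sum>s=1..k. D (x s) (x (Suc s))) + h (x 1) - h (x (Suc k))"
    if "\<And>s. s \<in> {1..k} \<Longrightarrow> x s < K" for x k
    using that
  proof (induction k)
    case (Suc k)
    have "x (Suc k) < K" using Suc.prems by auto
    from poisson[OF this] have "g (x (Suc k)) (x (Suc (Suc k))) - m = D (x (Suc k)) (x (Suc (Suc k))) + h (x (Suc k)) - h (x (Suc (Suc k)))"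
      by (simp add: D_def)
    moreover have "(\<Sum>s=1..k. g (x s) (x (Suc s))) - real k * m = (\<Sum>s=1..k. D (x s) (x (Suc s))) + h (x 1) - h (x (Suc k))"
      using Suc by auto
    ultimately show ?case by (simp add: algebra_simps)
  qed simp
  let ?M = "\<Pi>\<^sub>M j\<in>{1..Suc n}. \<mu>"
  let ?W = "\<lambda>s y :: nat \<Rightarrow> 'y. u (y s) * v (y (Suc s))"
  define Bad where "Bad = {y \<in> space ?M. \<bar>(\<Sum>s=1..n. ?W s y) - real n * m\<bar> \<ge> e}"
  have Bad: "Bad \<in> sets ?M" unfolding Bad_def using u v by measurable
  define E where "E = exp (- e\<^sup>2 / (32 * real n * c\<^sup>2))"
  have given_path: "measure (\<Pi>\<^sub>M j\<in>{1..Suc n}. emission (x j)) Bad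
      \<le> 4 * E + of_bool (\<bar>\<Sum>s=1..n. D (x s) (x (Suc s))\<bar> \<ge> e / 4)" if x: "x \<in> paths K (Suc n)" for x
  proof (cases "\<bar>\<Sum>s=1..n. D (x s) (x (Suc s))\<bar> \<ge> e / 4")
    case True
    interpret finite_product_prob_space "\<lambda>j. emission (x j)" "{1..Suc n}"
      by (rule finite_product_prob_space_emission) simp
    show ?thesis using True prob_le_1[of Bad] by (simp add: E_def add_increasing)
  next
    case False
    let ?N = "\<Pi>\<^sub>M j\<in>{1..Suc n}. emission (x j)"
    interpret finite_product_prob_space "\<lambda>j. emission (x j)" "{1..Suc n}"
      by (rule finite_product_prob_space_emission) simp
    have xK: "x s < K" if "s \<in> {1..Suc n}" for s using x that by (auto simp: PiE_iff)
    have setsN: "sets ?N = sets ?M" by (simp add: sets_emission cong: sets_PiM_cong)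
    define dev where "dev = (\<lambda>S y. \<Sum>s\<in>S. ?W s y - g (x s) (x (Suc s)))"
    define So where "So = {s \<in> {1..n}. odd s}"
    define Se where "Se = {s \<in> {1..n}. even s}"
    have tail: "measure ?N {y \<in> space ?N. \<bar>dev S y\<bar> \<ge> e / 4} \<le> 2 * E"
      if S: "S \<subseteq> {1..n}" "\<And>s. s \<in> S \<Longrightarrow> Suc s \<notin> S" for S
    proof -
      have "measure ?N {y \<in> space ?N. \<bar>dev S y\<bar> \<ge> e / 4} \<le> 2 * exp (- (e / 4)\<^sup>2 / (2 * real n * B ^ 4))"
        unfolding dev_def g_def ou_def ov_def
        by (rule hoeffding_consecutive_products)
          (use S u v B e n prob_space_emission AE_emission in
            \<open>auto simp: measurable_cong_sets[OF sets_emission refl]\<close>)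
      also have "\<dots> \<le> 2 * E"
      proof -
        have "B ^ 4 = (B\<^sup>2)\<^sup>2" by simp
        also have "\<dots> \<le> c\<^sup>2" using cB B by (intro power_mono) auto
        finally have "e\<^sup>2 / (32 * real n * c\<^sup>2) \<le> e\<^sup>2 / (32 * real n * B ^ 4)"
          using n B cB by (intro divide_left_mono mult_left_mono) auto
        then show ?thesis unfolding E_def by (simp add: power_divide)
      qed
      finally show ?thesis .
    qed
    have "Bad \<subseteq> {y \<in> space ?N. \<bar>dev So y\<bar> \<ge> e / 4} \<union> {y \<in> space ?N. \<bar>dev Se y\<bar> \<ge> e / 4}"
    proof
      fix y assume y: "y \<in> Bad"
      have "{1..n} = So \<union> Se" by (auto simp: So_def Se_def)
      then have "(\<Sum>s=1..n. ?W s y - g (x s) (x (Suc s))) = (\<Sum>s\<in>So \<union> Se. ?W s y - g (x s) (x (Suc s)))"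
        by (simp only:)
      also have "\<dots> = dev So y + dev Se y"
        unfolding dev_def by (rule sum.union_disjoint) (auto simp: So_def Se_def)
      finally have "(\<Sum>s=1..n. ?W s y - g (x s) (x (Suc s))) = dev So y + dev Se y" .
      then have "(\<Sum>s=1..n. ?W s y) - real n * m
          = dev So y + dev Se y + ((\<Sum>s=1..n. g (x s) (x (Suc s))) - real n * m)"
        by (simp add: sum_subtractf)
      also have "\<dots> = dev So y + dev Se y + ((\<Sum>s=1..n. D (x s) (x (Suc s))) + h (x 1) - h (x (Suc n)))"
        using xK by (subst telescope) auto
      finally have eq: "(\<Sum>s=1..n. ?W s y) - real n * m
          = dev So y + dev Se y + ((\<Sum>s=1..n. D (x s) (x (Suc s))) + h (x 1) - h (x (Suc n)))" .
      have "\<bar>h (x 1) - h (x (Suc n))\<bar> \<le> e / 4"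
      proof -
        have "\<bar>h (x 1)\<bar> \<le> 2 * B\<^sup>2 * \<zeta>" "\<bar>h (x (Suc n))\<bar> \<le> 2 * B\<^sup>2 * \<zeta>"
          using xK[of 1] xK[of "Suc n"] by (auto intro: h)
        then show ?thesis using cB(2) e(2) by linarith
      qed
      moreover have "\<bar>(\<Sum>s=1..n. ?W s y) - real n * m\<bar> \<ge> e" "y \<in> space ?N"
        using y sets_eq_imp_space_eq[OF setsN] by (auto simp: Bad_def)
      ultimately have "\<bar>dev So y\<bar> \<ge> e / 4 \<or> \<bar>dev Se y\<bar> \<ge> e / 4"
        using False unfolding eq by linarith
      then show "y \<in> {y \<in> space ?N. \<bar>dev So y\<bar> \<ge> e / 4} \<union> {y \<in> space ?N. \<bar>dev Se y\<bar> \<ge> e / 4}"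
        using \<open>y \<in> space ?N\<close> by auto
    qed
    moreover have dev_sets: "{y \<in> space ?N. \<bar>dev S y\<bar> \<ge> e / 4} \<in> sets ?N" if "S \<subseteq> {1..n}" for S
    proof -
      have [measurable]: "dev S \<in> borel_measurable ?N"
        unfolding dev_def using u v that
        by (intro borel_measurable_sum borel_measurable_diff borel_measurable_times borel_measurable_const
            measurable_compose[OF measurable_component_singleton])
          (auto simp: measurable_cong_sets[OF sets_emission refl])
      show ?thesis by measurable
    qed
    moreover have sub: "So \<subseteq> {1..n}" "Se \<subseteq> {1..n}" by (auto simp: So_def Se_def)
    ultimately have "measure ?N Bad \<le> measure ?N ({y \<in> space ?N. \<bar>dev So y\<bar> \<ge> e / 4} \<union> {y \<in> space ?N. \<bar>dev Se y\<bar> \<ge> e / 4})"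
      by (intro P.finite_measure_mono sets.Un dev_sets)
    also have "\<dots> \<le> measure ?N {y \<in> space ?N. \<bar>dev So y\<bar> \<ge> e / 4} + measure ?N {y \<in> space ?N. \<bar>dev Se y\<bar> \<ge> e / 4}"
      by (intro measure_Un_le dev_sets sub)
    also have "\<dots> \<le> 2 * E + 2 * E"
      by (intro add_mono tail) (auto simp: So_def Se_def)
    finally show ?thesis by simp
  qed
  have "{\<omega> \<in> space P. \<bar>(\<Sum>s=1..n. u (Y s \<omega>) * v (Y (Suc s) \<omega>)) - real n * m\<bar> \<ge> e} = {\<omega> \<in> space P. Y_vec (Suc n) \<omega> \<in> Bad}"
  proof -
    have "(\<Sum>s=1..n. ?W s (Y_vec (Suc n) \<omega>)) = (\<Sum>s=1..n. u (Y s \<omega>) * v (Y (Suc s) \<omega>))" for \<omega>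
      by (intro sum.cong) (auto simp: Y_vec_def)
    then show ?thesis
      using measurable_space[OF measurable_Y_vec] by (auto simp: Bad_def)
  qed
  then have "prob {\<omega> \<in> space P. \<bar>(\<Sum>s=1..n. u (Y s \<omega>) * v (Y (Suc s) \<omega>)) - real n * m\<bar> \<ge> e}
    = (\<Sum>x\<in>paths K (Suc n). path_prob (Suc n) x * measure (\<Pi>\<^sub>M j\<in>{1..Suc n}. emission (x j)) Bad)"
    using prob_observations[OF Bad] by simp
  also have "\<dots> \<le> (\<Sum>x\<in>paths K (Suc n). path_prob (Suc n) x * (4 * E + of_bool (\<bar>\<Sum>s=1..n. D (x s) (x (Suc s))\<bar> \<ge> e / 4)))"
    by (intro sum_mono mult_left_mono given_path path_prob_nonneg)
  also have "\<dots> = 4 * E + (\<Sum>x\<in>paths K (Suc n). path_prob (Suc n) x * of_bool (\<bar>\<Sum>s=1..n. D (x s) (x (Suc s))\<bar> \<ge> e / 4))"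
    using sum_path_prob[of "Suc n"] by (simp only: distrib_left sum.distrib sum_distrib_right[symmetric])
  also have "\<dots> \<le> 4 * E + 2 * exp (- (e / 4)\<^sup>2 / (2 * real n * c\<^sup>2))"
    using D D0 cB e n by (intro add_left_mono azuma_two_sided) auto
  also have "exp (- (e / 4)\<^sup>2 / (2 * real n * c\<^sup>2)) = E" by (simp add: E_def power_divide)
  finally show ?thesis unfolding mean E_def by simp
qed

end

section \<open>The rank of the moment matrix\<close>

lemma L2_measurable: "g \<in> L2 \<mu> \<Longrightarrow> g \<in> borel_measurable \<mu>"
  by (simp add: L2_def)

lemma integrable_mult_L2:
  assumes "g \<in> L2 \<mu>" "h \<in> L2 \<mu>"
  shows "integrable \<mu> (\<lambda>y. g y * h y)"
proof (rule Bochner_Integration.integrable_bound)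
  show "integrable \<mu> (\<lambda>y. (g y)\<^sup>2 + (h y)\<^sup>2)" using assms by (auto simp: L2_def)
  show "(\<lambda>y. g y * h y) \<in> borel_measurable \<mu>" using assms by (auto simp: L2_def)
  have "\<bar>a * b\<bar> \<le> a\<^sup>2 + b\<^sup>2" for a b :: real
  proof -
    have "2 * \<bar>a\<bar> * \<bar>b\<bar> \<le> \<bar>a\<bar>\<^sup>2 + \<bar>b\<bar>\<^sup>2" by (rule sum_squares_bound)
    moreover have "0 \<le> \<bar>a\<bar> * \<bar>b\<bar>" by simp
    ultimately show ?thesis unfolding abs_mult power2_abs by linarith
  qed
  then show "AE y in \<mu>. norm (g y * h y) \<le> norm ((g y)\<^sup>2 + (h y)\<^sup>2)"
    by (auto intro!: AE_I2)
qed

lemma Cauchy_Schwarz_L2: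
  assumes g: "g \<in> L2 \<mu>" and h: "h \<in> L2 \<mu>"
  shows "\<bar>\<integral>y. g y * h y \<partial>\<mu>\<bar> \<le> sqrt (\<integral>y. (g y)\<^sup>2 \<partial>\<mu>) * sqrt (\<integral>y. (h y)\<^sup>2 \<partial>\<mu>)"
proof -
  define a where "a = (\<integral>y. (g y)\<^sup>2 \<partial>\<mu>)"
  define b where "b = (\<integral>y. g y * h y \<partial>\<mu>)"
  define d where "d = (\<integral>y. (h y)\<^sup>2 \<partial>\<mu>)"
  have a: "a \<ge> 0" and d: "d \<ge> 0" by (auto simp: a_def d_def)
  have quad: "a - 2 * t * b + t\<^sup>2 * d \<ge> 0" for t
  proof -
    have "(\<integral>y. (g y - t * h y)\<^sup>2 \<partial>\<mu>) = (\<integral>y. (g y)\<^sup>2 - 2 * t * (g y * h y) + t\<^sup>2 * (h y)\<^sup>2 \<partial>\<mu>)"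
      by (intro Bochner_Integration.integral_cong) (auto simp: power2_eq_square algebra_simps)
    also have "\<dots> = a - 2 * t * b + t\<^sup>2 * d"
      using assms integrable_mult_L2[OF g h] by (simp add: a_def b_def d_def L2_def)
    finally have "(\<integral>y. (g y - t * h y)\<^sup>2 \<partial>\<mu>) = a - 2 * t * b + t\<^sup>2 * d" .
    moreover have "0 \<le> (\<integral>y. (g y - t * h y)\<^sup>2 \<partial>\<mu>)" by (rule Bochner_Integration.integral_nonneg) simp
    ultimately show ?thesis by simp
  qed
  have "b\<^sup>2 \<le> a * d"
  proof (cases "d = 0")
    case True
    have "b = 0"
    proof (rule ccontr)
      assume "b \<noteq> 0"
      \<comment> \<open>Here the quadratic is the affine function \<open>a - 2 * t * b\<close>, which takes the value \<open>- 1\<close>.\<close>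
      with quad[of "(a + 1) / (2 * b)"] True show False by simp
    qed
    then show ?thesis using True by simp
  next
    case False
    with d have "d > 0" by simp
    \<comment> \<open>The quadratic is minimal at \<open>b / d\<close>.\<close>
    with quad[of "b / d"] show ?thesis by (simp add: field_simps power2_eq_square)
  qed
  then have "\<bar>b\<bar> \<le> sqrt (a * d)" by (metis real_sqrt_abs real_sqrt_le_mono)
  then show ?thesis by (simp add: a_def b_def d_def real_sqrt_mult)
qed

lemma L2_sum:
  fixes K :: nat
  shows "(\<And>k. k < K \<Longrightarrow> f k \<in> L2 \<mu>) \<Longrightarrow> (\<lambda>y. \<Sum>k<K. c k * f k y) \<in> L2 \<mu>"
proof (induction K)
  case 0
  show ?case by (simp add: L2_def)
next
  case (Suc K)
  then have 1: "(\<lambda>y. \<Sum>k<K. c k * f k y) \<in> L2 \<mu>" and 2: "f K \<in> L2 \<mu>" by auto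
  have "integrable \<mu> (\<lambda>y. ((\<Sum>k<K. c k * f k y))\<^sup>2 + (2 * c K) * ((\<Sum>k<K. c k * f k y) * f K y) + (c K)\<^sup>2 * (f K y)\<^sup>2)"
    using 1 2 integrable_mult_L2[OF 1 2] by (auto simp: L2_def)
  then have "integrable \<mu> (\<lambda>y. ((\<Sum>k<K. c k * f k y) + c K * f K y)\<^sup>2)"
    by (simp add: power2_sum power_mult_distrib mult_ac add_ac)
  then show ?case using 1 2 by (auto simp: L2_def)
qed

lemma integral_mult_sum_L2:
  assumes "g \<in> L2 \<mu>" "\<And>k. k < K \<Longrightarrow> f k \<in> L2 \<mu>"
  shows "(\<integral>y. g y * (\<Sum>k<K. c k * f k y) \<partial>\<mu>) = (\<Sum>k<K. c k * (\<integral>y. g y * f k y \<partial>\<mu>))"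
proof -
  have "(\<integral>y. g y * (\<Sum>k<K. c k * f k y) \<partial>\<mu>) = (\<integral>y. (\<Sum>k<K. c k * (g y * f k y)) \<partial>\<mu>)"
    by (simp add: sum_distrib_left mult_ac)
  also have "\<dots> = (\<Sum>k<K. c k * (\<integral>y. g y * f k y \<partial>\<mu>))"
    using integrable_mult_L2 assms by (subst Bochner_Integration.integral_sum) auto
  finally show ?thesis .
qed

text \<open>
  A kernel vector \<open>c\<close> of the Gram matrix gives a combination of the \<open>f k\<close> that is orthogonal to
  all \<open>f k\<close>, hence to itself.
\<close>

lemma gram_matrix_det_nonzero:
  assumes f: "\<And>k. k < K \<Longrightarrow> f k \<in> L2 \<mu>" and ind: "L2_lin_indep \<mu> K f"
  shows "Determinant.det (mat K K (\<lambda>(l, k). \<integral>y. f l y * f k y \<partial>\<mu>)) \<noteq> 0"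
proof
  let ?G = "mat K K (\<lambda>(l, k). \<integral>y. f l y * f k y \<partial>\<mu>)"
  assume "Determinant.det ?G = 0"
  then obtain c where c: "c \<in> carrier_vec K" "c \<noteq> 0\<^sub>v K" "?G *\<^sub>v c = 0\<^sub>v K"
    using det_0_iff_vec_prod_zero_field[of ?G K] by auto
  define F where "F = (\<lambda>y. \<Sum>k<K. c $ k * f k y)"
  have F: "F \<in> L2 \<mu>" unfolding F_def by (rule L2_sum[OF f])
  have "(\<integral>y. f l y * F y \<partial>\<mu>) = 0" if l: "l < K" for l
  proof -
    have "(\<integral>y. f l y * F y \<partial>\<mu>) = (\<Sum>k<K. c $ k * (\<integral>y. f l y * f k y \<partial>\<mu>))"
      unfolding F_def using f l by (intro integral_mult_sum_L2) auto
    also have "\<dots> = (?G *\<^sub>v c) $ l"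
      using c(1) l by (auto simp: scalar_prod_def atLeast0LessThan mult.commute intro!: sum.cong)
    finally show ?thesis using c(3) l by simp
  qed
  then have "(\<integral>y. F y * F y \<partial>\<mu>) = 0"
  proof -
    have F': "F y = (\<Sum>k<K. c $ k * f k y)" for y by (simp add: F_def)
    have "(\<integral>y. F y * F y \<partial>\<mu>) = (\<Sum>k<K. c $ k * (\<integral>y. F y * f k y \<partial>\<mu>))"
      using integral_mult_sum_L2[OF F, of K f "\<lambda>k. c $ k"] f by (simp only: F'[symmetric])
    also have "\<dots> = 0" using \<open>\<And>l. l < K \<Longrightarrow> (\<integral>y. f l y * F y \<partial>\<mu>) = 0\<close> by (simp add: mult.commute)
    finally show ?thesis .
  qed
  then have "(\<integral>y. (F y)\<^sup>2 \<partial>\<mu>) = 0" by (simp add: power2_eq_square)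
  then have "AE y in \<mu>. (F y)\<^sup>2 = 0"
    using F by (subst (asm) integral_nonneg_eq_0_iff_AE) (auto simp: L2_def)
  then have "AE y in \<mu>. (\<Sum>k<K. c $ k * f k y) = 0" by (simp add: F_def)
  then have "\<forall>k<K. c $ k = 0"
    using spec[OF ind[unfolded L2_lin_indep_def], of "\<lambda>k. c $ k"] by blast
  then have "c = 0\<^sub>v K" using c(1) by (intro eq_vecI) auto
  with c show False by simp
qed

text \<open>
  Choose \<open>h l\<close> in the union of the spaces so close to \<open>f l\<close> that the matrix of the inner products of
  \<open>h l\<close> and \<open>f k\<close> is invertible, as the Gram matrix of \<open>f\<close> is. Once \<open>\<PP> M\<close> contains all \<open>h l\<close>, a
  vector \<open>c\<close> with \<open>O_mat c = 0\<close> makes the corresponding combination of the \<open>f k\<close> orthogonal to all \<open>h l\<close>, so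
  that matrix annihilates \<open>c\<close>.
\<close>

lemma O_mat_injective_eventually:
  assumes ap: "approximation_spaces \<mu> \<M> \<PP> \<Phi>"
    and f: "\<And>k. k < K \<Longrightarrow> f k \<in> L2 \<mu>" and ind: "L2_lin_indep \<mu> K f"
  shows "\<exists>M0. \<forall>M\<in>\<M>. M \<ge> M0 \<longrightarrow>
    (\<forall>c\<in>carrier_vec K. O_mat \<mu> M (\<Phi> M) K f *\<^sub>v c = 0\<^sub>v M \<longrightarrow> c = 0\<^sub>v K)"
proof -
  have sub: "\<PP> M \<subseteq> L2 \<mu>" if "M \<in> \<M>" for M
    using ap that by (auto simp: approximation_spaces_def L2_subspace_def)
  have "\<forall>i k. \<exists>h M. k < K \<longrightarrow> M \<in> \<M> \<and> h \<in> \<PP> M \<and> sqrt (\<integral>y. (f k y - h y)\<^sup>2 \<partial>\<mu>) < 1 / real (Suc i)"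
  proof (intro allI)
    fix i k
    show "\<exists>h M. k < K \<longrightarrow> M \<in> \<M> \<and> h \<in> \<PP> M \<and> sqrt (\<integral>y. (f k y - h y)\<^sup>2 \<partial>\<mu>) < 1 / real (Suc i)"
    proof (cases "k < K")
      case True
      have "(1 :: real) / real (Suc i) > 0" by simp
      then have "\<exists>h\<in>(\<Union>M\<in>\<M>. \<PP> M). sqrt (\<integral>y. (f k y - h y)\<^sup>2 \<partial>\<mu>) < 1 / real (Suc i)"
        using ap f[OF True] unfolding approximation_spaces_def by blast
      then show ?thesis by blast
    qed auto
  qed
  then obtain h N where hN: "\<And>i k. k < K \<Longrightarrow> N i k \<in> \<M> \<and> h i k \<in> \<PP> (N i k) \<and>
      sqrt (\<integral>y. (f k y - h i k y)\<^sup>2 \<partial>\<mu>) < 1 / real (Suc i)" by metis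
  have h2: "h i k \<in> L2 \<mu>" if "k < K" for i k using hN[OF that, of i] sub by blast
  define E where "E = (\<lambda>i. mat K K (\<lambda>(l, k). \<integral>y. h i l y * f k y \<partial>\<mu>))"
  define G where "G = mat K K (\<lambda>(l, k). \<integral>y. f l y * f k y \<partial>\<mu>)"
  have conv: "(\<lambda>i. \<integral>y. h i l y * f k y \<partial>\<mu>) \<longlonglongrightarrow> (\<integral>y. f l y * f k y \<partial>\<mu>)" if lk: "l < K" "k < K" for l k
  proof (rule LIM_zero_cancel)
    let ?b = "sqrt (\<integral>y. (f k y)\<^sup>2 \<partial>\<mu>)"
    show "(\<lambda>i. (\<integral>y. h i l y * f k y \<partial>\<mu>) - (\<integral>y. f l y * f k y \<partial>\<mu>)) \<longlonglongrightarrow> 0"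
    proof (rule Lim_null_comparison)
      show "\<forall>\<^sub>F i in sequentially. norm ((\<integral>y. h i l y * f k y \<partial>\<mu>) - (\<integral>y. f l y * f k y \<partial>\<mu>)) \<le> ?b / real (Suc i)"
      proof (intro always_eventually allI)
        fix i
        have "(\<lambda>y. f l y - h i l y) \<in> L2 \<mu>"
        proof -
          have "(\<lambda>y. \<Sum>j<2::nat. (if j = 0 then 1 else - 1) * (if j = 0 then f l else h i l) y) \<in> L2 \<mu>"
            by (rule L2_sum) (use f h2 lk in auto)
          then show ?thesis by (simp add: numeral_2_eq_2)
        qed
        from Cauchy_Schwarz_L2[OF this f[OF lk(2)]]
        have "\<bar>\<integral>y. (f l y - h i l y) * f k y \<partial>\<mu>\<bar> \<le> 1 / real (Suc i) * ?b"
          using hN[OF lk(1), of i] by (elim order.trans) (intro mult_right_mono, auto)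
        moreover have "(\<integral>y. (f l y - h i l y) * f k y \<partial>\<mu>) = (\<integral>y. f l y * f k y \<partial>\<mu>) - (\<integral>y. h i l y * f k y \<partial>\<mu>)"
          by (simp add: left_diff_distrib integrable_mult_L2[OF f[OF lk(1)] f[OF lk(2)]]
              integrable_mult_L2[OF h2[OF lk(1)] f[OF lk(2)]])
        ultimately show "norm ((\<integral>y. h i l y * f k y \<partial>\<mu>) - (\<integral>y. f l y * f k y \<partial>\<mu>)) \<le> ?b / real (Suc i)"
          by simp
      qed
      show "(\<lambda>i. ?b / real (Suc i)) \<longlonglongrightarrow> 0"
        using LIMSEQ_Suc[OF lim_const_over_n[of ?b]] by simp
    qed
  qed
  have "(\<lambda>i. Determinant.det (E i)) \<longlonglongrightarrow> Determinant.det G"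
  proof -
    have p: "p i < K" if "p permutes {0..<K}" "i < K" for p i
      using permutes_in_image[OF that(1), of i] that(2) by auto
    have "(\<lambda>i. \<Sum>p\<in>{p. p permutes {0..<K}}. signof p * (\<Prod>l = 0..<K. E i $$ (l, p l)))
      \<longlonglongrightarrow> (\<Sum>p\<in>{p. p permutes {0..<K}}. signof p * (\<Prod>l = 0..<K. G $$ (l, p l)))"
      by (intro tendsto_sum tendsto_mult tendsto_prod tendsto_const)
        (auto simp: E_def G_def p conv)
    then show ?thesis
      by (simp add: Determinant.det_def E_def G_def)
  qed
  moreover have "Determinant.det G \<noteq> 0" unfolding G_def by (rule gram_matrix_det_nonzero[OF f ind])
  ultimately have "\<forall>\<^sub>F i in sequentially. Determinant.det (E i) \<noteq> 0"
    by (rule tendsto_imp_eventually_ne)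
  then obtain i where i: "Determinant.det (E i) \<noteq> 0" by (auto dest: eventually_happens)
  define M0 where "M0 = Max (insert 0 (N i ` {..<K}))"
  have M0: "N i k \<le> M0" if "k < K" for k unfolding M0_def using that by (intro Max_ge) auto
  show ?thesis
  proof (intro exI[of _ M0] ballI impI)
    fix M c assume M: "M \<in> \<M>" "M \<ge> M0" and c: "c \<in> carrier_vec K"
      and zero: "O_mat \<mu> M (\<Phi> M) K f *\<^sub>v c = 0\<^sub>v M"
    define F where "F = (\<lambda>y. \<Sum>k<K. c $ k * f k y)"
    have F: "F \<in> L2 \<mu>" unfolding F_def by (rule L2_sum[OF f])
    have basis: "L2_orthonormal_basis \<mu> M (\<Phi> M) (\<PP> M)" using ap M by (simp add: approximation_spaces_def)
    have \<Phi>: "\<Phi> M a \<in> L2 \<mu>" if "a < M" for a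
      using basis that sub[OF M(1)] by (auto simp: L2_orthonormal_basis_def)
    have orth: "(\<integral>y. F y * \<Phi> M a y \<partial>\<mu>) = 0" if a: "a < M" for a
    proof -
      have "(\<integral>y. \<Phi> M a y * F y \<partial>\<mu>) = (\<Sum>k<K. c $ k * (\<integral>y. \<Phi> M a y * f k y \<partial>\<mu>))"
        unfolding F_def by (rule integral_mult_sum_L2[OF \<Phi>[OF a] f])
      also have "\<dots> = (O_mat \<mu> M (\<Phi> M) K f *\<^sub>v c) $ a"
        using c a by (auto simp: O_mat_def scalar_prod_def atLeast0LessThan mult.commute intro!: sum.cong)
      finally show ?thesis using zero a by (simp add: mult.commute)
    qed
    have "(\<integral>y. h i l y * F y \<partial>\<mu>) = 0" if l: "l < K" for l
    proof -
      have "h i l \<in> \<PP> M" using hN[OF l, of i] M0[OF l] M ap unfolding approximation_spaces_def by (meson order.trans subsetD)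
      then obtain d where d: "AE y in \<mu>. h i l y = (\<Sum>a<M. d a * \<Phi> M a y)"
        using basis unfolding L2_orthonormal_basis_def by blast
      have "(\<integral>y. h i l y * F y \<partial>\<mu>) = (\<integral>y. F y * (\<Sum>a<M. d a * \<Phi> M a y) \<partial>\<mu>)"
      proof (rule integral_cong_AE)
        show "AE y in \<mu>. h i l y * F y = F y * (\<Sum>a<M. d a * \<Phi> M a y)" using d by eventually_elim simp
        show "(\<lambda>y. h i l y * F y) \<in> borel_measurable \<mu>"
          by (intro borel_measurable_times L2_measurable[OF h2[OF l]] L2_measurable[OF F])
        show "(\<lambda>y. F y * (\<Sum>a<M. d a * \<Phi> M a y)) \<in> borel_measurable \<mu>"
          by (intro borel_measurable_times L2_measurable[OF F] borel_measurable_sum borel_measurable_const L2_measurable[OF \<Phi>]) simp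
      qed
      also have "\<dots> = 0" using orth by (subst integral_mult_sum_L2[OF F \<Phi>]) auto
      finally show ?thesis .
    qed
    then have "E i *\<^sub>v c = 0\<^sub>v K"
    proof -
      have "(E i *\<^sub>v c) $ l = (\<integral>y. h i l y * F y \<partial>\<mu>)" if l: "l < K" for l
      proof -
        have "(\<integral>y. h i l y * F y \<partial>\<mu>) = (\<Sum>k<K. c $ k * (\<integral>y. h i l y * f k y \<partial>\<mu>))"
          unfolding F_def using f by (intro integral_mult_sum_L2 h2[OF l]) auto
        then show ?thesis
          using c l by (auto simp: E_def scalar_prod_def atLeast0LessThan mult.commute intro!: sum.cong)
      qed
      moreover note \<open>\<And>l. l < K \<Longrightarrow> (\<integral>y. h i l y * F y \<partial>\<mu>) = 0\<close>
      ultimately show ?thesis by (intro eq_vecI) (auto simp: E_def)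
    qed
    moreover have "E i \<in> carrier_mat K K" by (simp add: E_def)
    ultimately show "c = 0\<^sub>v K"
      using i det_0_iff_vec_prod_zero_field[of "E i" K] c by blast
  qed
qed

context stationary_hmm
begin

lemma f_L2: "k < K \<Longrightarrow> f k \<in> L2 \<mu>"
  using model by (simp add: hidden_markov_model_def)

lemma N_mat_factorization:
  assumes \<phi>: "\<And>a. a < M \<Longrightarrow> \<phi> a \<in> L2 \<mu>"
  shows "N_mat P Y M \<phi> = O_mat \<mu> M \<phi> K f * mat K K (\<lambda>(i, j). \<pi> $ i * Q $$ (i, j)) * transpose_mat (O_mat \<mu> M \<phi> K f)"
    (is "_ = ?O * ?R * transpose_mat ?O")
proof (rule eq_matI)
  have O: "?O \<in> carrier_mat M K" by (simp add: O_mat_def)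
  fix a b assume "a < dim_row (?O * ?R * transpose_mat ?O)" "b < dim_col (?O * ?R * transpose_mat ?O)"
  then have ab: "a < M" "b < M" using O by auto
  have em: "(\<integral>y. \<phi> a y \<partial>emission k) = ?O $$ (a, k)" "integrable (emission k) (\<phi> a)" if "a < M" "k < K" for a k
    using that \<phi>[OF that(1)] integral_emission[OF that(2), of "\<phi> a"] integrable_mult_L2[OF \<phi> f_L2, of a k]
    by (auto simp: O_mat_def L2_def)
  have "N_mat P Y M \<phi> $$ (a, b) = (\<integral>\<omega>. \<phi> a (Y 1 \<omega>) * \<phi> b (Y 2 \<omega>) \<partial>P)"
    using ab by (simp add: N_mat_def)
  also have "\<dots> = (\<Sum>i<K. \<Sum>j<K. \<pi> $ i * Q $$ (i, j) * (?O $$ (a, i) * ?O $$ (b, j)))"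
    using \<phi> ab em by (subst mean_consecutive_product) (auto simp: L2_def)
  also have "\<dots> = (?O * ?R * transpose_mat ?O) $$ (a, b)"
  proof -
    have "(?O * ?R * transpose_mat ?O) $$ (a, b) = (\<Sum>j<K. (\<Sum>i<K. ?O $$ (a, i) * (\<pi> $ i * Q $$ (i, j))) * ?O $$ (b, j))"
      using O ab by (simp add: scalar_prod_def atLeast0LessThan)
    also have "\<dots> = (\<Sum>i<K. \<Sum>j<K. \<pi> $ i * Q $$ (i, j) * (?O $$ (a, i) * ?O $$ (b, j)))"
      unfolding sum_distrib_right by (subst sum.swap) (simp add: mult_ac)
    finally show ?thesis by simp
  qed
  finally show "N_mat P Y M \<phi> $$ (a, b) = (?O * ?R * transpose_mat ?O) $$ (a, b)" .
qed (auto simp: N_mat_def O_mat_def)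

lemma rank_N_mat:
  assumes \<phi>: "\<And>a. a < M \<Longrightarrow> \<phi> a \<in> L2 \<mu>" and inv: "invertible_mat Q"
    and inj: "\<And>c. c \<in> carrier_vec K \<Longrightarrow> O_mat \<mu> M \<phi> K f *\<^sub>v c = 0\<^sub>v M \<Longrightarrow> c = 0\<^sub>v K"
  shows "vec_space.rank M (N_mat P Y M \<phi>) = K"
proof -
  let ?R = "mat K K (\<lambda>(i, j). \<pi> $ i * Q $$ (i, j))"
  have Q: "Q \<in> carrier_mat K K" using stochastic by (simp add: stochastic_matrix_def)
  have injR: "c = 0\<^sub>v K" if c: "c \<in> carrier_vec K" and z: "?R *\<^sub>v c = 0\<^sub>v K" for c
  proof -
    have "(Q *\<^sub>v c) $ i = 0" if i: "i < K" for i
    proof -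
      have "(?R *\<^sub>v c) $ i = \<pi> $ i * (Q *\<^sub>v c) $ i"
        using i Q c by (simp add: scalar_prod_def sum_distrib_left mult.assoc)
      then show ?thesis using z i stationary_distribution_pos[OF chain_facts pi_facts, of i] by simp
    qed
    then have "Q *\<^sub>v c = 0\<^sub>v K" using Q by (intro eq_vecI) auto
    moreover have "Determinant.det Q \<noteq> 0"
    proof -
      obtain Q' where Q': "inverts_mat Q Q'" "inverts_mat Q' Q"
        using inv by (auto simp: invertible_mat_def)
      have QQ: "Q * Q' = 1\<^sub>m K" using Q'(1) Q by (simp add: inverts_mat_def)
      have "dim_col (Q * Q') = K" unfolding QQ by simp
      moreover have "dim_row (Q' * Q) = dim_col (Q' * Q)" using Q'(2) unfolding inverts_mat_def by (metis index_one_mat(2,3))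
      ultimately have "Q' \<in> carrier_mat K K" using Q by auto
      then have "Determinant.det Q * Determinant.det Q' = 1" using Q QQ by (metis Determinant.det_mult Determinant.det_one)
      then show ?thesis by auto
    qed
    ultimately show ?thesis using det_0_iff_vec_prod_zero_field[OF Q] c by blast
  qed
  have "N_mat P Y M \<phi> = O_mat \<mu> M \<phi> K f * ?R * transpose_mat (O_mat \<mu> M \<phi> K f)"
    by (rule N_mat_factorization[OF \<phi>])
  moreover have "vec_space.rank M (O_mat \<mu> M \<phi> K f * ?R * transpose_mat (O_mat \<mu> M \<phi> K f)) = K"
  proof (rule rank_congruence_full_column_rank)
    show "O_mat \<mu> M \<phi> K f \<in> carrier_mat M K" by (simp add: O_mat_def)
    show "?R \<in> carrier_mat K K" by simp
  qed (fact inj injR)+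
  ultimately show ?thesis by (simp only:)
qed

end

section \<open>The spectral order estimator\<close>

lemma norm_mult_mat_vec_le_entries:
  fixes D :: "real mat"
  assumes D: "D \<in> carrier_mat n n" and e: "\<And>a b. a < n \<Longrightarrow> b < n \<Longrightarrow> \<bar>D $$ (a, b)\<bar> \<le> e"
    and x: "x \<in> carrier_vec n"
  shows "(D *\<^sub>v x) \<bullet> (D *\<^sub>v x) \<le> (real n * e)\<^sup>2 * (x \<bullet> x)"
proof -
  have "((D *\<^sub>v x) $ a)\<^sup>2 \<le> real n * e\<^sup>2 * (x \<bullet> x)" if a: "a < n" for a
  proof -
    have "(D *\<^sub>v x) $ a = (\<Sum>b<n. D $$ (a, b) * x $ b)"
      using D x a by (auto simp: scalar_prod_def atLeast0LessThan intro!: sum.cong)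
    then have "((D *\<^sub>v x) $ a)\<^sup>2 \<le> (\<Sum>b<n. (D $$ (a, b))\<^sup>2) * (\<Sum>b<n. (x $ b)\<^sup>2)"
      by (simp only: Cauchy_Schwarz_ineq_sum)
    also have "\<dots> \<le> (\<Sum>b<n. e\<^sup>2) * (\<Sum>b<n. (x $ b)\<^sup>2)"
    proof (intro mult_right_mono sum_mono sum_nonneg)
      fix b assume "b \<in> {..<n}"
      then show "(D $$ (a, b))\<^sup>2 \<le> e\<^sup>2" using e[OF a, of b] by (simp add: abs_le_square_iff[symmetric])
    qed auto
    finally show ?thesis using x by (simp add: scalar_prod_self)
  qed
  then have "(\<Sum>a<n. ((D *\<^sub>v x) $ a)\<^sup>2) \<le> (\<Sum>a<n. real n * e\<^sup>2 * (x \<bullet> x))" by (intro sum_mono) auto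
  then show ?thesis using D by (simp add: scalar_prod_self[of "D *\<^sub>v x"] power_mult_distrib power2_eq_square mult_ac)
qed

text \<open>
  A lower and an upper bound from Weyl's inequality: the singular values of \<open>N\<close> above \<open>2 * t\<close> stay above \<open>t\<close>, and
  the vanishing ones do not rise above \<open>t\<close>.
\<close>

lemma count_singular_values_above_recovers_rank:
  fixes N N' :: "real mat"
  assumes N: "N \<in> carrier_mat n n" and N': "N' \<in> carrier_mat n n" and n: "n > 0"
    and close: "\<And>a b. a < n \<Longrightarrow> b < n \<Longrightarrow> \<bar>N' $$ (a, b) - N $$ (a, b)\<bar> \<le> t / real n"
    and t: "t \<ge> 0" and gap: "count_singular_values_above n N (2 * t) = vec_space.rank n N"
  shows "count_singular_values_above n N' t = vec_space.rank n N"
proof (rule antisym)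
  have D: "N - N' \<in> carrier_mat n n" "N' - N \<in> carrier_mat n n" using N N' by auto
  have "((N' - N) *\<^sub>v x) \<bullet> ((N' - N) *\<^sub>v x) \<le> t\<^sup>2 * (x \<bullet> x)" if "x \<in> carrier_vec n" for x
    using norm_mult_mat_vec_le_entries[OF D(2) _ that, of "t / real n"] close N N' n by simp
  from count_singular_values_above_perturbation[OF N' N this, of 0] t
  show "count_singular_values_above n N' t \<le> vec_space.rank n N"
    by (simp add: rank_eq_count_singular_values[OF N])
  have "((N - N') *\<^sub>v x) \<bullet> ((N - N') *\<^sub>v x) \<le> t\<^sup>2 * (x \<bullet> x)" if "x \<in> carrier_vec n" for x
    using norm_mult_mat_vec_le_entries[OF D(1) _ that, of "t / real n"] close N N' n
    by (simp add: abs_minus_commute)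
  from count_singular_values_above_perturbation[OF N N' this, of t] t gap
  show "vec_space.rank n N \<le> count_singular_values_above n N' t" by simp
qed

lemma singular_value_gap_exists:
  "\<exists>s0>0. \<forall>t\<ge>0. t < s0 \<longrightarrow> count_singular_values_above n N t = count_singular_values_above n N 0"
proof -
  define I where "I = {i \<in> {1..n}. singular_value N i > 0}"
  \<comment> \<open>The smallest positive singular value, cut off at \<open>1\<close> so that the minimum exists.\<close>
  define s0 where "s0 = Min (insert 1 (singular_value N ` I))"
  have fin: "finite I" by (simp add: I_def)
  have "s0 > 0" unfolding s0_def using fin by (subst Min_gr_iff) (auto simp: I_def)
  moreover have "count_singular_values_above n N t = count_singular_values_above n N 0" if t: "0 \<le> t" "t < s0" for t
  proof -
    have "s0 \<le> singular_value N i" if "i \<in> I" for i unfolding s0_def using that fin by (intro Min_le) auto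
    then have "{i \<in> {1..n}. singular_value N i > t} = {i \<in> {1..n}. singular_value N i > 0}"
      using t by (auto simp: I_def) fastforce
    then show ?thesis by (simp add: count_singular_values_above_def)
  qed
  ultimately show ?thesis by blast
qed

text \<open>
  Let \<open>T = n0 * C\<^sup>2 * (1 + ln C)\<close>. The function \<open>ln x / x\<close> is decreasing for \<open>x \<ge> 3\<close>, and \<open>ln T\<close> is at
  most \<open>(ln n0 + 3) * (1 + ln C)\<close>, so that \<open>4 * C\<^sup>2 * ln n / n\<close> is at most \<open>4 * (ln n0 + 3) / n0\<close>
  for \<open>n \<ge> T\<close>, whatever \<open>C\<close> is. The factor \<open>1 + ln C\<close> is what absorbs the dependence of \<open>ln T\<close> on \<open>C\<close>.
\<close>

lemma sample_size_condition:
  fixes s0 :: real and L :: real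
  assumes s0: "s0 > 0"
  shows "\<exists>n0>0. \<forall>C\<ge>1. \<forall>n. real n \<ge> n0 * C\<^sup>2 * (1 + ln C) \<longrightarrow>
     3 \<le> real n \<and> L \<le> real n \<and> 2 * (C * sqrt (ln (real n) / real n)) < s0"
proof -
  have "((\<lambda>x :: real. 4 * (ln x + 3) / x) \<longlongrightarrow> 0) at_top" by real_asymp
  then have "\<forall>\<^sub>F x in at_top. 4 * (ln x + 3) / x < s0\<^sup>2"
    by (rule order_tendstoD) (use s0 in simp)
  then obtain x0 where x0: "\<And>x. x \<ge> x0 \<Longrightarrow> 4 * (ln x + 3) / x < s0\<^sup>2"
    by (auto simp: eventually_at_top_linorder)
  define n0 where "n0 = max x0 (max 3 L)"
  have n0: "n0 \<ge> 3" "n0 \<ge> L" "4 * (ln n0 + 3) / n0 < s0\<^sup>2" using x0[of n0] by (auto simp: n0_def)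
  have "3 \<le> real n \<and> L \<le> real n \<and> 2 * (C * sqrt (ln (real n) / real n)) < s0"
    if C: "C \<ge> 1" and n: "real n \<ge> n0 * C\<^sup>2 * (1 + ln C)" for C n
  proof -
    define T where "T = n0 * C\<^sup>2 * (1 + ln C)"
    have lnC: "ln C \<ge> 0" using C by simp
    then have lnC1: "1 + ln C > 0" by linarith
    have C2: "C\<^sup>2 \<ge> 1" using C by simp
    have "1 * 1 \<le> C\<^sup>2 * (1 + ln C)" using C2 lnC by (intro mult_mono) auto
    then have "n0 * 1 \<le> n0 * (C\<^sup>2 * (1 + ln C))" using n0(1) by (intro mult_left_mono) auto
    then have T: "T \<ge> n0" by (simp add: T_def mult.assoc)
    have nT: "real n \<ge> T" using n by (simp add: T_def)
    then have "real n \<ge> n0" using T by simp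
    with n0 have n3: "real n \<ge> 3" "real n \<ge> L" by linarith+
    note nT = nT n3
    have "ln (real n) / real n \<le> ln T / T"
      using exp_le T n0 nT by (intro ln_x_over_x_mono) auto
    also have "ln T = ln n0 + 2 * ln C + ln (1 + ln C)"
    proof -
      have "C\<^sup>2 > 0" "n0 * C\<^sup>2 > 0" using n0(1) C by auto
      then show ?thesis
        unfolding T_def using lnC1 n0(1) C by (simp add: ln_mult_pos ln_realpow)
    qed
    also have "\<dots> \<le> (ln n0 + 3) * (1 + ln C)"
    proof -
      have "ln (1 + ln C) \<le> ln C" using lnC by (rule ln_add_one_self_le_self)
      moreover have "0 \<le> ln n0 * ln C" using n0(1) lnC by simp
      ultimately show ?thesis using n0(1) by (simp add: algebra_simps)
    qed
    also have "(ln n0 + 3) * (1 + ln C) / T = (ln n0 + 3) / (n0 * C\<^sup>2)"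
      using lnC1 by (simp add: T_def)
    finally have "4 * C\<^sup>2 * (ln (real n) / real n) \<le> 4 * C\<^sup>2 * ((ln n0 + 3) / (n0 * C\<^sup>2))"
      using T n0(1) by (intro mult_left_mono) (auto simp: divide_right_mono)
    also have "\<dots> = 4 * (ln n0 + 3) / n0" using n0(1) C by simp
    also have "\<dots> < s0\<^sup>2" by (rule n0(3))
    finally have "(2 * (C * sqrt (ln (real n) / real n)))\<^sup>2 < s0\<^sup>2"
      using nT by (simp add: power_mult_distrib)
    then have "2 * (C * sqrt (ln (real n) / real n)) < s0"
      by (rule power2_less_imp_less) (use s0 in simp)
    with nT show ?thesis by simp
  qed
  then show ?thesis using n0(1) by (intro exI[of _ n0]) auto
qed

context stationary_hmm
begin

lemma observations_measurable:
  assumes "u \<in> borel_measurable \<mu>" "j \<ge> 1"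
  shows "(\<lambda>\<omega>. u (Y j \<omega>)) \<in> borel_measurable P"
  using measurable_compose[OF measurable_Y[OF assms(2)] assms(1)] .

definition deviation_event :: "nat \<Rightarrow> (nat \<Rightarrow> 'y \<Rightarrow> real) \<Rightarrow> nat \<Rightarrow> real \<Rightarrow> 'w set" where
  "deviation_event M \<phi> n t = {\<omega> \<in> space P. \<exists>a<M. \<exists>b<M.
     \<bar>N_hat Y M \<phi> n \<omega> $$ (a, b) - N_mat P Y M \<phi> $$ (a, b)\<bar> \<ge> t / real M}"

lemma deviation_event_measurable:
  assumes "\<And>a. a < M \<Longrightarrow> \<phi> a \<in> borel_measurable \<mu>"
  shows "deviation_event M \<phi> n t \<in> sets P"
proof -
  have "deviation_event M \<phi> n t = (\<Union>a\<in>{..<M}. \<Union>b\<in>{..<M}. {\<omega> \<in> space P.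
     \<bar>N_hat Y M \<phi> n \<omega> $$ (a, b) - N_mat P Y M \<phi> $$ (a, b)\<bar> \<ge> t / real M})"
    by (auto simp: deviation_event_def)
  also have "\<dots> \<in> sets P"
  proof (intro sets.finite_UN)
    fix a b assume "a \<in> {..<M}" "b \<in> {..<M}"
    then have ab: "a < M" "b < M" by auto
    have "(\<lambda>\<omega>. N_hat Y M \<phi> n \<omega> $$ (a, b)) \<in> borel_measurable P"
      using ab by (simp add: N_hat_def)
        (intro borel_measurable_divide borel_measurable_sum borel_measurable_times observations_measurable assms, auto)
    then show "{\<omega> \<in> space P. \<bar>N_hat Y M \<phi> n \<omega> $$ (a, b) - N_mat P Y M \<phi> $$ (a, b)\<bar> \<ge> t / real M} \<in> sets P"
      by measurable
  qed auto
  finally show ?thesis .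
qed

text \<open>
  For one entry, the concentration inequality with \<open>e = n * t / M\<close> has an exponent proportional to
  \<open>C\<^sup>2 * ln n\<close>, so a large \<open>C\<close> gives the bound \<open>6 / n ^ 3\<close>. The union over the \<open>M\<^sup>2\<close> entries costs the
  factor \<open>6 * M\<^sup>2 \<le> n\<close>.
\<close>

lemma prob_deviation_event_le:
  assumes \<phi>: "\<And>a. a < M \<Longrightarrow> \<phi> a \<in> borel_measurable \<mu>" "\<And>a. a < M \<Longrightarrow> AE y in \<mu>. \<bar>\<phi> a y\<bar> \<le> B"
    and B: "B > 0" and M: "M > 0"
  defines "c \<equiv> 2 * B\<^sup>2 + 4 * B\<^sup>2 * (\<Sum>i<K. \<Sum>j<K. \<bar>fundamental_matrix K Q $$ (i, j)\<bar>)"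
  assumes C: "C \<ge> 1 + 10 * c * real M" and n: "3 \<le> real n" "6 * (real M)\<^sup>2 \<le> real n"
  shows "prob (deviation_event M \<phi> n (C * sqrt (ln (real n) / real n))) \<le> 1 / (real n)\<^sup>2"
proof -
  define t where "t = C * sqrt (ln (real n) / real n)"
  define e where "e = real n * t / real M"
  have cpos: "c > 0"
    using B unfolding c_def by (intro add_pos_nonneg mult_nonneg_nonneg sum_nonneg) auto
  have "ln (exp 1) \<le> ln (real n)" using n exp_le by (intro ln_mono) auto
  then have lnn: "ln (real n) \<ge> 1" by simp
  have cM: "0 \<le> 10 * c * real M" using cpos by simp
  have C': "C \<ge> 1" "C \<ge> 10 * c * real M" using C cM by auto
  have "e\<^sup>2 = (real n)\<^sup>2 * (C\<^sup>2 * (ln (real n) / real n)) / (real M)\<^sup>2"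
    using lnn n by (simp add: e_def t_def power_mult_distrib power_divide)
  also have "\<dots> = real n * C\<^sup>2 * ln (real n) / (real M)\<^sup>2"
    using n by (simp add: power2_eq_square)
  finally have e2: "e\<^sup>2 = real n * C\<^sup>2 * ln (real n) / (real M)\<^sup>2" .
  have "t > 0" using C' lnn n by (simp add: t_def)
  then have e: "e > 0" using n M by (simp add: e_def)
  have C2: "(10 * c * real M)\<^sup>2 \<le> C\<^sup>2" using C' cM by (intro power_mono) auto
  have "(4 * c)\<^sup>2 \<le> e\<^sup>2"
  proof -
    have "(4 * c)\<^sup>2 \<le> (10 * c * real M)\<^sup>2 / (real M)\<^sup>2" using M by (simp add: power_mult_distrib)
    also have "\<dots> \<le> C\<^sup>2 / (real M)\<^sup>2" using C2 by (intro divide_right_mono) auto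
    also have "\<dots> \<le> (real n * ln (real n)) * (C\<^sup>2 / (real M)\<^sup>2)"
    proof -
      have "1 * 1 \<le> real n * ln (real n)" using n lnn by (intro mult_mono) auto
      then have "1 * (C\<^sup>2 / (real M)\<^sup>2) \<le> (real n * ln (real n)) * (C\<^sup>2 / (real M)\<^sup>2)"
        by (intro mult_right_mono) auto
      then show ?thesis by simp
    qed
    finally show ?thesis by (simp add: e2 mult_ac)
  qed
  then have e4: "4 * c \<le> e" by (rule power2_le_imp_le) (use e in simp)
  let ?A = "\<lambda>a b. {\<omega> \<in> space P. \<bar>(\<Sum>s=1..n. \<phi> a (Y s \<omega>) * \<phi> b (Y (Suc s) \<omega>)) - real n * (\<integral>\<omega>. \<phi> a (Y 1 \<omega>) * \<phi> b (Y 2 \<omega>) \<partial>P)\<bar> \<ge> e}"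
  have A: "prob (?A a b) \<le> 6 / (real n) ^ 3" if ab: "a < M" "b < M" for a b
  proof -
    have "prob (?A a b) \<le> 6 * exp (- e\<^sup>2 / (32 * real n * c\<^sup>2))"
      unfolding c_def
      by (rule concentration_consecutive_products) (use \<phi> ab B n e e4 in \<open>auto simp: c_def\<close>)
    also have "\<dots> \<le> 6 * exp (- (3 * ln (real n)))"
    proof -
      \<comment> \<open>The factor \<open>10\<close> in the bound on \<open>C\<close> is chosen such that \<open>10\<^sup>2 / 32 \<ge> 3\<close>.\<close>
      have "3 * ln (real n) \<le> (100 / 32) * ln (real n)" using lnn by simp
      also have "100 / 32 * ln (real n) = (10 * c * real M)\<^sup>2 * ln (real n) / (32 * c\<^sup>2 * (real M)\<^sup>2)"
        using cpos M by (simp add: power_mult_distrib)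
      also have "\<dots> \<le> C\<^sup>2 * ln (real n) / (32 * c\<^sup>2 * (real M)\<^sup>2)"
        using C2 lnn by (intro divide_right_mono mult_right_mono) auto
      also have "\<dots> = e\<^sup>2 / (32 * real n * c\<^sup>2)" using n by (simp add: e2 mult_ac)
      finally show ?thesis by simp
    qed
    also have "exp (- (3 * ln (real n))) = 1 / (real n) ^ 3"
      using n by (simp add: exp_minus exp_of_nat_mult[of 3 "ln (real n)", simplified] inverse_eq_divide)
    finally show ?thesis by simp
  qed
  have meas: "?A a b \<in> sets P" if ab: "a < M" "b < M" for a b
  proof -
    have "(\<lambda>\<omega>. \<Sum>s=1..n. \<phi> a (Y s \<omega>) * \<phi> b (Y (Suc s) \<omega>)) \<in> borel_measurable P"
      by (intro borel_measurable_sum borel_measurable_times observations_measurable \<phi> ab) auto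
    then show ?thesis by measurable
  qed
  have A_sets: "?A (fst z) (snd z) \<in> sets P" if "z \<in> {..<M} \<times> {..<M}" for z
    by (rule meas) (use that in auto)
  have "deviation_event M \<phi> n t \<subseteq> (\<Union>z\<in>{..<M} \<times> {..<M}. ?A (fst z) (snd z))"
  proof
    fix \<omega> assume "\<omega> \<in> deviation_event M \<phi> n t"
    then obtain a b where ab: "a < M" "b < M" "\<omega> \<in> space P"
      and dev: "t / real M \<le> \<bar>N_hat Y M \<phi> n \<omega> $$ (a, b) - N_mat P Y M \<phi> $$ (a, b)\<bar>"
      by (auto simp: deviation_event_def)
    let ?S = "\<Sum>s=1..n. \<phi> a (Y s \<omega>) * \<phi> b (Y (Suc s) \<omega>)"
    let ?m = "\<integral>\<omega>. \<phi> a (Y 1 \<omega>) * \<phi> b (Y 2 \<omega>) \<partial>P"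
    have "e = real n * (t / real M)" by (simp add: e_def)
    also have "\<dots> \<le> real n * \<bar>?S / real n - ?m\<bar>"
      using dev ab by (intro mult_left_mono) (auto simp: N_hat_def N_mat_def)
    also have "\<dots> = \<bar>real n * (?S / real n - ?m)\<bar>" by (simp add: abs_mult)
    also have "real n * (?S / real n - ?m) = ?S - real n * ?m" using n by (simp add: right_diff_distrib)
    finally have "\<omega> \<in> ?A a b" using ab by simp
    with ab show "\<omega> \<in> (\<Union>z\<in>{..<M} \<times> {..<M}. ?A (fst z) (snd z))"
      by (intro UN_I[of "(a, b)"]) auto
  qed
  then have "prob (deviation_event M \<phi> n t) \<le> prob (\<Union>z\<in>{..<M} \<times> {..<M}. ?A (fst z) (snd z))"
    by (rule finite_measure_mono) (rule sets.finite_UN, simp, rule A_sets)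
  also have "\<dots> \<le> (\<Sum>z\<in>{..<M} \<times> {..<M}. prob (?A (fst z) (snd z)))"
    by (rule finite_measure_subadditive_finite, simp) (use A_sets in blast)
  also have "\<dots> \<le> (\<Sum>z\<in>{..<M} \<times> {..<M}. 6 / (real n) ^ 3)"
    by (intro sum_mono A) auto
  also have "\<dots> = 6 * (real M)\<^sup>2 / (real n) ^ 3" by (simp add: power2_eq_square)
  also have "\<dots> \<le> real n / (real n) ^ 3" using n by (intro divide_right_mono) auto
  also have "\<dots> = 1 / (real n)\<^sup>2" using n by (simp add: power2_eq_square power3_eq_cube)
  finally show ?thesis by (simp add: t_def)
qed

lemma K_spectral_eq_rank:
  assumes M: "M > 0" and t: "C * sqrt (ln (real n) / real n) \<ge> 0"
    and gap: "count_singular_values_above M (N_mat P Y M \<phi>) (2 * (C * sqrt (ln (real n) / real n))) = vec_space.rank M (N_mat P Y M \<phi>)"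
    and \<omega>: "\<omega> \<in> space P - deviation_event M \<phi> n (C * sqrt (ln (real n) / real n))"
  shows "K_spectral Y M \<phi> C n \<omega> = vec_space.rank M (N_mat P Y M \<phi>)"
proof -
  have "K_spectral Y M \<phi> C n \<omega> = count_singular_values_above M (N_hat Y M \<phi> n \<omega>) (C * sqrt (ln (real n) / real n))"
    by (simp add: K_spectral_def count_singular_values_above_def)
  also have "\<dots> = vec_space.rank M (N_mat P Y M \<phi>)"
  proof (rule count_singular_values_above_recovers_rank[OF _ _ M _ t gap])
    fix a b assume "a < M" "b < M"
    then have "\<not> C * sqrt (ln (real n) / real n) / real M \<le> \<bar>N_hat Y M \<phi> n \<omega> $$ (a, b) - N_mat P Y M \<phi> $$ (a, b)\<bar>"
      using \<omega> unfolding deviation_event_def by blast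
    then show "\<bar>N_hat Y M \<phi> n \<omega> $$ (a, b) - N_mat P Y M \<phi> $$ (a, b)\<bar> \<le> C * sqrt (ln (real n) / real n) / real M"
      by linarith
  qed (simp_all add: N_mat_def N_hat_def)
  finally show ?thesis .
qed

text \<open>
  The order is recovered outside the deviation events, whose probabilities are summable.
\<close>

lemma spectral_order_estimator:
  assumes \<phi>: "\<And>a. a < M \<Longrightarrow> \<phi> a \<in> borel_measurable \<mu>" "\<And>a. a < M \<Longrightarrow> AE y in \<mu>. \<bar>\<phi> a y\<bar> \<le> B"
    and B: "B > 0" and M: "M > 0"
  defines "c \<equiv> 2 * B\<^sup>2 + 4 * B\<^sup>2 * (\<Sum>i<K. \<Sum>j<K. \<bar>fundamental_matrix K Q $$ (i, j)\<bar>)"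
  assumes C: "C \<ge> 1 + 10 * c * real M" and n1: "n1 \<ge> 0"
    and large: "\<And>n. real n \<ge> n1 \<Longrightarrow> 3 \<le> real n \<and> 6 * (real M)\<^sup>2 \<le> real n \<and>
        count_singular_values_above M (N_mat P Y M \<phi>) (2 * (C * sqrt (ln (real n) / real n))) = vec_space.rank M (N_mat P Y M \<phi>)"
    and rank: "vec_space.rank M (N_mat P Y M \<phi>) = K"
  shows "\<And>n. real n \<ge> n1 \<Longrightarrow> \<P>(\<omega> in P. K_spectral Y M \<phi> C n \<omega> \<noteq> K) \<le> 1 / (real n)\<^sup>2"
    and "AE \<omega> in P. (\<lambda>n. K_spectral Y M \<phi> C n \<omega>) \<longlonglongrightarrow> K"
proof -
  let ?t = "\<lambda>n. C * sqrt (ln (real n) / real n)"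
  let ?D = "\<lambda>n. deviation_event M \<phi> n (?t n)"
  have "c \<ge> 0"
    using B unfolding c_def by (intro add_nonneg_nonneg mult_nonneg_nonneg sum_nonneg) auto
  then have C0: "C \<ge> 0" using C by (simp add: order.trans[OF _ C])
  have t: "?t n \<ge> 0" if "real n \<ge> n1" for n using large[OF that] C0 by simp
  have good: "K_spectral Y M \<phi> C n \<omega> = K" if "real n \<ge> n1" "\<omega> \<in> space P - ?D n" for n \<omega>
    using K_spectral_eq_rank[OF M t[OF that(1)] _ that(2)] large[OF that(1)] rank by simp
  have D: "?D n \<in> sets P" for n by (rule deviation_event_measurable[OF \<phi>(1)])
  have small: "prob (?D n) \<le> 1 / (real n)\<^sup>2" if "real n \<ge> n1" for n
    by (rule prob_deviation_event_le[OF \<phi> B M]) (use C large[OF that] in \<open>auto simp: c_def\<close>)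
  show "\<P>(\<omega> in P. K_spectral Y M \<phi> C n \<omega> \<noteq> K) \<le> 1 / (real n)\<^sup>2" if "real n \<ge> n1" for n
  proof -
    have "\<P>(\<omega> in P. K_spectral Y M \<phi> C n \<omega> \<noteq> K) \<le> prob (?D n)"
      \<comment> \<open>The bound passes through the deviation event, which is measurable; the event on the left need not be.\<close>
      using good[OF that] D by (intro finite_measure_mono) auto
    then show ?thesis using small[OF that] by simp
  qed
  have "\<exists>N. \<forall>n\<ge>N. norm (prob (?D n)) \<le> inverse (real n ^ 2)"
  proof (intro exI allI impI)
    fix n assume "nat \<lceil>n1\<rceil> \<le> n"
    then have "real n \<ge> n1" by linarith
    from small[OF this] show "norm (prob (?D n)) \<le> inverse (real n ^ 2)" by (simp add: inverse_eq_divide)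
  qed
  then have "summable (\<lambda>n. prob (?D n))"
    by (rule summable_comparison_test) (simp add: inverse_power_summable)
  then have "AE \<omega> in P. eventually (\<lambda>n. \<omega> \<in> space P - ?D n) sequentially"
    using D emeasure_finite by (intro borel_cantelli_AE1) (auto simp: less_top[symmetric])
  then show "AE \<omega> in P. (\<lambda>n. K_spectral Y M \<phi> C n \<omega>) \<longlonglongrightarrow> K"
  proof eventually_elim
    case (elim \<omega>)
    have "eventually (\<lambda>n. real n \<ge> n1) sequentially"
      using eventually_ge_at_top[of "nat \<lceil>n1\<rceil>"] by eventually_elim linarith
    with elim have "eventually (\<lambda>n. K_spectral Y M \<phi> C n \<omega> = K) sequentially"
      by eventually_elim (rule good)
    then show ?case by (rule tendsto_eventually)
  qed
qed

end

lemma approximation_basis_L2: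
  assumes "approximation_spaces \<mu> \<M> \<PP> \<Phi>" "M \<in> \<M>" "a < M"
  shows "\<Phi> M a \<in> L2 \<mu>"
proof -
  have "L2_subspace \<mu> (\<PP> M)" "L2_orthonormal_basis \<mu> M (\<Phi> M) (\<PP> M)"
    using assms by (simp_all add: approximation_spaces_def)
  then have "\<PP> M \<subseteq> L2 \<mu>" "\<Phi> M a \<in> \<PP> M"
    using assms(3) by (simp_all add: L2_subspace_def L2_orthonormal_basis_def)
  then show ?thesis by blast
qed

theorem theorem13:
  fixes \<mu> :: "'y measure" and K M :: nat and Q :: "real mat" and \<phi> :: "nat \<Rightarrow> 'y \<Rightarrow> real"
  assumes "sigma_finite_measure \<mu>"
    and "ergodic_matrix K Q" and "invertible_mat Q"
  shows
    "(\<forall>\<M> \<PP> \<Phi> f \<pi> (P :: 'w measure) X Y.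
        approximation_spaces \<mu> \<M> \<PP> \<Phi> \<and> hidden_markov_model \<mu> P X Y K \<pi> Q f \<and>
        stationary_distribution \<pi> Q \<and> L2_lin_indep \<mu> K f \<longrightarrow>
        (\<exists>M0. \<forall>M'\<in>\<M>. M' \<ge> M0 \<longrightarrow> vec_space.rank M' (N_mat P Y M' (\<Phi> M')) = K)) \<and>
     ((\<forall>a<M. \<exists>B. AE y in \<mu>. \<bar>\<phi> a y\<bar> \<le> B) \<longrightarrow>
      (\<exists>C0>0. \<forall>Omat. \<exists>n0>0. \<forall>\<M> \<PP> \<Phi> f \<pi> (P :: 'w measure) X Y M0.
        approximation_spaces \<mu> \<M> \<PP> \<Phi> \<and> hidden_markov_model \<mu> P X Y K \<pi> Q f \<and>
        stationary_distribution \<pi> Q \<and> L2_lin_indep \<mu> K f \<and>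
        (\<forall>M'\<in>\<M>. M' \<ge> M0 \<longrightarrow> vec_space.rank M' (N_mat P Y M' (\<Phi> M')) = K) \<and>
        M \<in> \<M> \<and> M \<ge> M0 \<and> (\<forall>a<M. \<Phi> M a = \<phi> a) \<and> O_mat \<mu> M (\<Phi> M) K f = Omat \<longrightarrow>
        (\<forall>C\<ge>C0.
          (\<forall>n. real n \<ge> n0 * C\<^sup>2 * (1 + ln C) \<longrightarrow>
             \<P>(\<omega> in P. K_spectral Y M (\<Phi> M) C n \<omega> \<noteq> K) \<le> 1 / (real n)\<^sup>2) \<and>
          (AE \<omega> in P. (\<lambda>n. K_spectral Y M (\<Phi> M) C n \<omega>) \<longlonglongrightarrow> K))))"
proof (intro conjI)
  show "\<forall>\<M> \<PP> \<Phi> f \<pi> (P :: 'w measure) X Y.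
        approximation_spaces \<mu> \<M> \<PP> \<Phi> \<and> hidden_markov_model \<mu> P X Y K \<pi> Q f \<and>
        stationary_distribution \<pi> Q \<and> L2_lin_indep \<mu> K f \<longrightarrow>
        (\<exists>M0. \<forall>M'\<in>\<M>. M' \<ge> M0 \<longrightarrow> vec_space.rank M' (N_mat P Y M' (\<Phi> M')) = K)"
  proof (intro allI impI, elim conjE)
    fix \<M> \<PP> \<Phi> f \<pi> and P :: "'w measure" and X Y
    assume ap: "approximation_spaces \<mu> \<M> \<PP> \<Phi>" and model: "hidden_markov_model \<mu> P X Y K \<pi> Q f"
      and st: "stationary_distribution \<pi> Q" and ind: "L2_lin_indep \<mu> K f"
    interpret stationary_hmm \<mu> P X Y K \<pi> Q f
      by unfold_locales (use model st assms in auto)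
    obtain M0 where M0: "\<forall>M\<in>\<M>. M \<ge> M0 \<longrightarrow>
        (\<forall>c\<in>carrier_vec K. O_mat \<mu> M (\<Phi> M) K f *\<^sub>v c = 0\<^sub>v M \<longrightarrow> c = 0\<^sub>v K)"
      using O_mat_injective_eventually[OF ap f_L2 ind] by blast
    show "\<exists>M0. \<forall>M'\<in>\<M>. M' \<ge> M0 \<longrightarrow> vec_space.rank M' (N_mat P Y M' (\<Phi> M')) = K"
    proof (intro exI[of _ M0] ballI impI)
      fix M' assume M': "M' \<in> \<M>" "M' \<ge> M0"
      show "vec_space.rank M' (N_mat P Y M' (\<Phi> M')) = K"
        by (rule rank_N_mat[OF approximation_basis_L2[OF ap M'(1)] assms(3)]) (use M0 M' in blast)+
    qed
  qed
  show "(\<forall>a<M. \<exists>B. AE y in \<mu>. \<bar>\<phi> a y\<bar> \<le> B) \<longrightarrow>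
      (\<exists>C0>0. \<forall>Omat. \<exists>n0>0. \<forall>\<M> \<PP> \<Phi> f \<pi> (P :: 'w measure) X Y M0.
        approximation_spaces \<mu> \<M> \<PP> \<Phi> \<and> hidden_markov_model \<mu> P X Y K \<pi> Q f \<and>
        stationary_distribution \<pi> Q \<and> L2_lin_indep \<mu> K f \<and>
        (\<forall>M'\<in>\<M>. M' \<ge> M0 \<longrightarrow> vec_space.rank M' (N_mat P Y M' (\<Phi> M')) = K) \<and>
        M \<in> \<M> \<and> M \<ge> M0 \<and> (\<forall>a<M. \<Phi> M a = \<phi> a) \<and> O_mat \<mu> M (\<Phi> M) K f = Omat \<longrightarrow>
        (\<forall>C\<ge>C0.
          (\<forall>n. real n \<ge> n0 * C\<^sup>2 * (1 + ln C) \<longrightarrow>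
             \<P>(\<omega> in P. K_spectral Y M (\<Phi> M) C n \<omega> \<noteq> K) \<le> 1 / (real n)\<^sup>2) \<and>
          (AE \<omega> in P. (\<lambda>n. K_spectral Y M (\<Phi> M) C n \<omega>) \<longlonglongrightarrow> K)))"
    (is "_ \<longrightarrow> (\<exists>C0>0. \<forall>Omat. \<exists>n0>0. ?claim C0 Omat n0)")
  proof
    assume "\<forall>a<M. \<exists>B. AE y in \<mu>. \<bar>\<phi> a y\<bar> \<le> B"
    then obtain b where b: "\<And>a. a < M \<Longrightarrow> AE y in \<mu>. \<bar>\<phi> a y\<bar> \<le> b a" by metis
    define B where "B = 1 + (\<Sum>a<M. \<bar>b a\<bar>)"
    have B: "B > 0" unfolding B_def by (intro add_pos_nonneg sum_nonneg) auto
    have bounded: "AE y in \<mu>. \<bar>\<phi> a y\<bar> \<le> B" if a: "a < M" for a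
    proof -
      have "\<bar>b a\<bar> \<le> (\<Sum>a<M. \<bar>b a\<bar>)" using a by (intro member_le_sum) auto
      then have "b a \<le> B" by (simp add: B_def)
      with b[OF a] show ?thesis by (auto elim: eventually_mono)
    qed
    define c where "c = 2 * B\<^sup>2 + 4 * B\<^sup>2 * (\<Sum>i<K. \<Sum>j<K. \<bar>fundamental_matrix K Q $$ (i, j)\<bar>)"
    have c: "c \<ge> 0"
      using B unfolding c_def by (intro add_nonneg_nonneg mult_nonneg_nonneg sum_nonneg) auto
    define C0 where "C0 = 1 + 10 * c * real M"
    have C0: "C0 \<ge> 1" using c by (simp add: C0_def)
    have "\<exists>n0>0. ?claim C0 Omat n0" for Omat
    proof -
      \<comment> \<open>The only possible stationary distribution, and the moment matrix of every model with the
        data \<open>Q\<close> and \<open>Omat\<close>; neither refers to the model.\<close>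
      define \<pi>0 where "\<pi>0 = (\<lambda>j. \<Sum>i<K. fundamental_matrix K Q $$ (i, j) / real K)"
      define N where "N = Omat * mat K K (\<lambda>(i, j). \<pi>0 i * Q $$ (i, j)) * transpose_mat Omat"
      obtain s0 where s0: "s0 > 0"
        "\<And>t. t \<ge> 0 \<Longrightarrow> t < s0 \<Longrightarrow> count_singular_values_above M N t = count_singular_values_above M N 0"
        using singular_value_gap_exists by blast
      obtain n0 where n0: "n0 > 0" and size: "\<And>C n. C \<ge> 1 \<Longrightarrow> real n \<ge> n0 * C\<^sup>2 * (1 + ln C) \<Longrightarrow>
         3 \<le> real n \<and> 6 * (real M)\<^sup>2 \<le> real n \<and> 2 * (C * sqrt (ln (real n) / real n)) < s0"
        using sample_size_condition[OF s0(1)] by blast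
      have "?claim C0 Omat n0"
      proof (intro allI impI, elim conjE)
        fix \<M> \<PP> \<Phi> f \<pi> and P :: "'w measure" and X Y M0 C
        assume ap: "approximation_spaces \<mu> \<M> \<PP> \<Phi>" and model: "hidden_markov_model \<mu> P X Y K \<pi> Q f"
          and st: "stationary_distribution \<pi> Q"
          and rk: "\<forall>M'\<in>\<M>. M' \<ge> M0 \<longrightarrow> vec_space.rank M' (N_mat P Y M' (\<Phi> M')) = K"
          and M: "M \<in> \<M>" "M \<ge> M0" and \<Phi>: "\<forall>a<M. \<Phi> M a = \<phi> a" and O: "O_mat \<mu> M (\<Phi> M) K f = Omat"
          and C: "C \<ge> C0"
        interpret stationary_hmm \<mu> P X Y K \<pi> Q f
          by unfold_locales (use model st assms in auto)
        have L2: "\<Phi> M a \<in> L2 \<mu>" if "a < M" for a using approximation_basis_L2[OF ap M(1) that] .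
        have rank: "vec_space.rank M (N_mat P Y M (\<Phi> M)) = K" using rk M by blast
        have Ncar: "N_mat P Y M (\<Phi> M) \<in> carrier_mat M M" by (simp add: N_mat_def)
        have "K \<le> M" using vec_space.rank_le_nc[OF Ncar] rank by simp
        then have M0: "M > 0" using K_pos by simp
        have "N_mat P Y M (\<Phi> M) = N"
        proof -
          have "mat K K (\<lambda>(i, j). \<pi> $ i * Q $$ (i, j)) = mat K K (\<lambda>(i, j). \<pi>0 i * Q $$ (i, j))"
            using stationary_distribution_unique[OF chain_facts pi_facts]
            by (intro eq_matI) (auto simp: \<pi>0_def)
          then show ?thesis using N_mat_factorization[OF L2] O by (simp add: N_def)
        qed
        then have count: "count_singular_values_above M (N_mat P Y M (\<Phi> M)) t = vec_space.rank M (N_mat P Y M (\<Phi> M))"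
          if "t \<ge> 0" "t < s0" for t
          using s0(2)[OF that] rank_eq_count_singular_values[OF Ncar] by simp
        have C1: "C \<ge> 1" using C C0 by simp
        have large: "3 \<le> real n \<and> 6 * (real M)\<^sup>2 \<le> real n \<and>
          count_singular_values_above M (N_mat P Y M (\<Phi> M)) (2 * (C * sqrt (ln (real n) / real n)))
            = vec_space.rank M (N_mat P Y M (\<Phi> M))" if "real n \<ge> n0 * C\<^sup>2 * (1 + ln C)" for n
        proof -
          have "2 * (C * sqrt (ln (real n) / real n)) \<ge> 0" using C1 size[OF C1 that] by simp
          then show ?thesis using size[OF C1 that] count by blast
        qed
        have AE: "AE y in \<mu>. \<bar>\<Phi> M a y\<bar> \<le> B" if "a < M" for a using \<Phi> bounded that by simp
        have "n0 * C\<^sup>2 * (1 + ln C) \<ge> 0" using n0 C1 by simp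
        note main = spectral_order_estimator[of M "\<Phi> M" B C "n0 * C\<^sup>2 * (1 + ln C)",
            OF L2_measurable[OF L2] AE B M0 C[unfolded C0_def c_def] this large rank]
        show "(\<forall>n. real n \<ge> n0 * C\<^sup>2 * (1 + ln C) \<longrightarrow>
             \<P>(\<omega> in P. K_spectral Y M (\<Phi> M) C n \<omega> \<noteq> K) \<le> 1 / (real n)\<^sup>2) \<and>
          (AE \<omega> in P. (\<lambda>n. K_spectral Y M (\<Phi> M) C n \<omega>) \<longlonglongrightarrow> K)"
          by (intro conjI allI impI main)
      qed
      then show ?thesis using n0 by blast
    qed
    then show "\<exists>C0>0. \<forall>Omat. \<exists>n0>0. ?claim C0 Omat n0" using C0 by (intro exI[of _ C0]) auto
  qed
qed

end
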